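(* For any $n\ge1$, $m\ge1$ and $k\in[n]$, the four sets $\mathscr{T}^{(m)}_{n,k},\mathscr{U}^{(m)}_{n,k},\mathscr{V}^{(m)}_{n,k},\mathscr{W}^{(m)}_{n,k}$ are in bijection with one another. Consequently the number of $k$-dimensional faces of the $m$-Shi arrangement in $\mathbb{R}^n$ equals $|\mathscr{T}^{(m)}_{n,k}|=|\mathscr{U}^{(m)}_{n,k}|=|\mathscr{V}^{(m)}_{n,k}|=|\mathscr{W}^{(m)}_{n,k}|$.
   Context: $[n]=\{1,\dots,n\}$, $[a,b]=\{a,\dots,b\}$. The $m$-Shi arrangement in $\mathbb{R}^n$ consists of the hyperplanes $x_i-x_j=s$ for $1\le i<j\le n$, $s\in[-m+1,m]$; a face is a nonempty solution set of a system choosing for each hyperplane one of $<,=,>$, with dimension that of its affine span. An $(m+1)$-ary tree is a rooted plane tree in which each vertex has $m+1$ or $0$ children; childless vertices are leaves, others nodes; the rank of a non-root vertex is the number of siblings preceding it (ranks $0,\dots,m$). An internal edge joins two nodes; its rank is the rank of its child. If a node has a child of rank $>0$ that is a node, its cadet is the highest-rank such child and the edge to it is a cadet edge. An $[n]$-decorated $(m+1)$-ary tree is an $(m+1)$-ary tree whose nodes are labeled by nonempty subsets of $[n]$ forming a set partition of $[n]$, with each cadet edge declared solid or dashed (others solid); captive node = node joined to its parent by a dashed edge; free node = node not captive. An internal edge is a descent if $\max A>\min B$ ($A$ the parent's label, $B$ the child's label). $\mathscr{T}^{(m)}_{n,k}$: $[n]$-decorated $(m+1)$-ary trees in which all internal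 edges of rank $m$ are descents, with exactly $k$ free nodes. $\mathscr{U}^{(m)}_{n,k}$: $(m+1)$-ary trees with $n$ nodes labeled bijectively by $[n]$, all internal edges of rank $m$ being descents, together with $n-k$ marked nodes each of which has at least one node among its children of rank $<m$. $\mathscr{V}^{(m)}_{n,k}$: Cayley $m$-foliages on vertex set $[n+1]$, i.e. trees on $[n+1]$ with each edge assigned a color in $[0,m-1]$ such that all edges incident to the vertex $n+1$ have color $0$, together with $n-k$ marked internal vertices (vertices of degree $\ge2$) among those labeled $1,\dots,n$. $\mathscr{W}^{(m)}_{n,k}$: pairs $(f,S)$ with $f:[n-1]\to[mn+1]$ and $S\subset[n]$, $|S|=n-k$, such that $\mathrm{Im}(f)\cap[(i-1)m+1,im]\neq\varnothing$ for all $i\in S$. *)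

theory Defs
  imports "HOL-Analysis.Analysis" "HOL-Library.Equipollence" "HOL-Library.Disjoint_Sets"
begin

section \<open>Faces of the Shi arrangement\<close>

text \<open>The triple \<open>(i, j, s)\<close> stands for the hyperplane \<open>x $ i - x $ j = s\<close>. The coordinates of
  \<open>\<real>\<^sup>n\<close> are indexed by a finite linearly ordered type \<open>'n\<close> in place of \<open>1 < \<dots> < n\<close>.\<close>

definition shi_hyperplanes :: "nat \<Rightarrow> ('n::{finite,linorder} \<times> 'n \<times> int) set" where
  "shi_hyperplanes m = {(i, j, s). i < j \<and> s \<in> {- int m + 1..int m}}"

definition shi_faces :: "nat \<Rightarrow> (real ^ 'n::{finite,linorder}) set set" where
  "shi_faces m = {F. F \<noteq> {} \<and>
     (\<exists>R \<in> shi_hyperplanes m \<rightarrow> {(<), (=), (>)}.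
        F = {x. \<forall>(i, j, s) \<in> shi_hyperplanes m. R (i, j, s) (x $ i - x $ j) (of_int s)})}"


section \<open>Labeled plane trees\<close>

datatype 'a ptree = Leaf | Node 'a "'a ptree list"

fun ary :: "nat \<Rightarrow> 'a ptree \<Rightarrow> bool" where
  "ary d Leaf \<longleftrightarrow> True"
| "ary d (Node a ts) \<longleftrightarrow> length ts = d \<and> (\<forall>t\<in>set ts. ary d t)"

fun labels :: "'a ptree \<Rightarrow> 'a list" where
  "labels Leaf = []"
| "labels (Node a ts) = a # concat (map labels ts)"

fun subtrees :: "'a ptree \<Rightarrow> 'a ptree set" where
  "subtrees Leaf = {Leaf}"
| "subtrees (Node a ts) = insert (Node a ts) (\<Union>t\<in>set ts. subtrees t)"

text \<open>In all trees below distinct nodes have distinct labels, so that nodes are identified with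
  their labels and an internal edge with the triple (parent, rank, child).\<close>

definition internal_edges :: "'a ptree \<Rightarrow> ('a \<times> nat \<times> 'a) set" where
  "internal_edges t =
     {(a, r, b). \<exists>ts us. Node a ts \<in> subtrees t \<and> r < length ts \<and> ts ! r = Node b us}"

definition cadet_edges :: "'a ptree \<Rightarrow> ('a \<times> nat \<times> 'a) set" where
  "cadet_edges t =
     {(a, r, b) \<in> internal_edges t. 0 < r \<and> (\<forall>s c. (a, s, c) \<in> internal_edges t \<longrightarrow> s \<le> r)}"


section \<open>The four families\<close>

text \<open>A decorated tree is a pair \<open>(t, D)\<close> where \<open>D\<close> is the set of dashed edges of \<open>t\<close>.\<close>

definition decorated_trees :: "nat \<Rightarrow> nat \<Rightarrow> (nat set ptree \<times> (nat set \<times> nat \<times> nat set) set) set" where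
  "decorated_trees m n = {(t, D). ary (m + 1) t \<and>
     distinct (labels t) \<and> partition_on {1..n} (set (labels t)) \<and> D \<subseteq> cadet_edges t}"

definition captive_nodes :: "('a \<times> nat \<times> 'a) set \<Rightarrow> 'a set" where
  "captive_nodes D = {B. \<exists>A r. (A, r, B) \<in> D}"

definition free_nodes :: "'a ptree \<Rightarrow> ('a \<times> nat \<times> 'a) set \<Rightarrow> 'a set" where
  "free_nodes t D = set (labels t) - captive_nodes D"

definition T_set :: "nat \<Rightarrow> nat \<Rightarrow> nat \<Rightarrow> (nat set ptree \<times> (nat set \<times> nat \<times> nat set) set) set" where
  "T_set m n k = {(t, D) \<in> decorated_trees m n.
     (\<forall>(A, r, B) \<in> internal_edges t. r = m \<longrightarrow> Max A > Min B) \<and>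
     card (free_nodes t D) = k}"

text \<open>The second component is the set of marked nodes. Labels are single numbers here, so a descent
  is an edge whose parent has the larger label.\<close>

definition U_set :: "nat \<Rightarrow> nat \<Rightarrow> nat \<Rightarrow> (nat ptree \<times> nat set) set" where
  "U_set m n k = {(t, M). ary (m + 1) t \<and>
     distinct (labels t) \<and> set (labels t) = {1..n} \<and>
     (\<forall>(a, r, b) \<in> internal_edges t. r = m \<longrightarrow> a > b) \<and>
     M \<subseteq> {1..n} \<and> card M = n - k \<and>
     (\<forall>a\<in>M. \<exists>r b. (a, r, b) \<in> internal_edges t \<and> r < m)}"

definition graph_cycle :: "'a set set \<Rightarrow> 'a list \<Rightarrow> bool" where
  "graph_cycle E vs \<longleftrightarrow> length vs \<ge> 3 \<and> distinct vs \<and>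
     (\<forall>i<length vs. {vs ! i, vs ! ((i + 1) mod length vs)} \<in> E)"

definition graph_tree :: "'a set \<Rightarrow> 'a set set \<Rightarrow> bool" where
  "graph_tree V E \<longleftrightarrow> E \<subseteq> {e. e \<subseteq> V \<and> card e = 2} \<and>
     (\<forall>u\<in>V. \<forall>v\<in>V. (u, v) \<in> {(x, y). {x, y} \<in> E}\<^sup>*) \<and>
     (\<nexists>vs. graph_cycle E vs)"

definition vertex_degree :: "'a set set \<Rightarrow> 'a \<Rightarrow> nat" where
  "vertex_degree E v = card {e \<in> E. v \<in> e}"

text \<open>A foliage is a pair \<open>(E, c)\<close> of an edge set and a coloring of it (extensional, hence determined by
  its values on \<open>E\<close>); \<open>V_set\<close> adds the set of marked vertices.\<close>

definition cayley_foliages :: "nat \<Rightarrow> nat \<Rightarrow> (nat set set \<times> (nat set \<Rightarrow> nat)) set" where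
  "cayley_foliages m n = {(E, c). graph_tree {1..n + 1} E \<and> c \<in> E \<rightarrow>\<^sub>E {0..<m} \<and>
     (\<forall>e\<in>E. n + 1 \<in> e \<longrightarrow> c e = 0)}"

definition V_set :: "nat \<Rightarrow> nat \<Rightarrow> nat \<Rightarrow> (nat set set \<times> (nat set \<Rightarrow> nat) \<times> nat set) set" where
  "V_set m n k = {(E, c, M). (E, c) \<in> cayley_foliages m n \<and>
     M \<subseteq> {1..n} \<and> card M = n - k \<and> (\<forall>v\<in>M. vertex_degree E v \<ge> 2)}"

definition W_set :: "nat \<Rightarrow> nat \<Rightarrow> nat \<Rightarrow> ((nat \<Rightarrow> nat) \<times> nat set) set" where
  "W_set m n k = {(f, S). f \<in> {1..n - 1} \<rightarrow>\<^sub>E {1..m * n + 1} \<and>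
     S \<subseteq> {1..n} \<and> card S = n - k \<and>
     (\<forall>i\<in>S. f ` {1..n - 1} \<inter> {(i - 1) * m + 1..i * m} \<noteq> {})}"

end

theory Submission
  imports Defs "HOL-Computational_Algebra.Polynomial"
begin

text \<open>All five numbers are shown to equal \<open>face_number m n k\<close>, which counts \<open>\<W>\<close> by inclusion-exclusion over
  the blocks missed by \<open>f\<close>.

  Foliages and the trees of \<open>\<U>\<close> are counted by inclusion-exclusion over their leaves: removing a leaf from a
  foliage, or a node without node children of rank less than \<open>m\<close> from a tree, is inverse to inserting it
  anywhere, and not all vertices are internal, so all counts follow by induction. The trees of \<open>\<T>\<close> are
  turned into those of \<open>\<U>\<close> by unfolding the blocks into paths of marked nodes.

  Faces are counted by the finite field method. By deletion and restriction, the number of regions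
  inside a flat is, up to sign, the value at \<open>-1\<close> of the polynomial that counts the points modulo \<open>q\<close> lying on
  exactly the hyperplanes containing the flat. Summing over the flats of dimension \<open>k\<close>, one has to count
  cyclic configurations of \<open>n\<close> labels modulo \<open>q\<close> that form \<open>k\<close> clusters. Each cluster has a unique leader (its
  last label), exactly \<open>q (q - m j) ^ (n - 1)\<close> configurations have \<open>j\<close> prescribed leaders, and
  inclusion-exclusion gives the polynomial.\<close>

section \<open>Counting by leaves\<close>

text \<open>The source of the common value: in each of the three marked families exactly
  \<open>(m * (n - j) + 1) ^ (n - 1)\<close> structures have \<open>j\<close> prescribed vertices
  that are not internal (or blocks that are not hit). For functions this is immediate. For foliages
  and trees, leaf removal settles every nonempty set \<open>L\<close> of prescribed leaves in terms
  of smaller structures, and the case without prescribed leaves is forced by one linear relation: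
  the alternating sum over all \<open>L\<close> counts the structures in which every vertex is
  internal, so it is 0; the proposed formula, a polynomial of degree \<open>n - 1\<close> in
  \<open>card L\<close>, has alternating sum 0 as well. A variant of this argument with leaders in
  place of leaves counts the cyclic configurations. The formula returns for faces because
  \<open>q * (q - m * j) ^ (n - 1)\<close> at \<open>q = -1\<close> is, up to sign,
  \<open>(m * j + 1) ^ (n - 1)\<close>. For this the points modulo \<open>q\<close> must see the
  same flats and dimensions as the real points, which holds for large \<open>q\<close> since
  equations between differences of coordinates force only integral values. Apart from the explicit
  bijection between the first two families, everything is matched by cardinality.\<close>

lemma sum_Pow_insert:
  fixes f :: "'a set \<Rightarrow> 'b::comm_monoid_add"
  assumes "finite N" "x \<notin> N"
  shows "(\<Sum>J\<in>Pow (insert x N). f J) = (\<Sum>J\<in>Pow N. f J + f (insert x J))"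
proof -
  have "inj_on (insert x) (Pow N)"
    using assms(2) by (auto simp: inj_on_def)
  moreover have "Pow N \<inter> insert x ` Pow N = {}"
    using assms(2) by auto
  ultimately show ?thesis
    using assms(1) by (simp add: Pow_insert sum.union_disjoint sum.reindex sum.distrib)
qed

text \<open>One finite difference with step \<open>b\<close> is taken per element of
  \<open>N\<close>, and each lowers the degree, so a polynomial of degree below
  \<open>card N\<close> is annihilated.\<close>

lemma sum_Pow_alternating_power:
  fixes a b :: "'a::comm_ring_1"
  assumes "finite N" "d < card N"
  shows "(\<Sum>J\<in>Pow N. (-1) ^ card J * (a + b * of_nat (card J)) ^ d) = 0"
  using assms
proof (induction N arbitrary: d rule: finite_induct)
  case (insert x N)
  let ?u = "\<lambda>J. a + b * of_nat (card J)"
  have step: "?u J ^ d - (?u J + b) ^ d = - (\<Sum>e<d. of_nat (d choose e) * b ^ (d - e) * ?u J ^ e)"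
    for J :: "'b set"
    by (subst binomial_ring[of "?u J" b d])
      (simp add: lessThan_Suc_atMost[symmetric] mult_ac del: mult_Suc)
  have "(\<Sum>J\<in>Pow (insert x N). (-1) ^ card J * ?u J ^ d)
      = (\<Sum>J\<in>Pow N. (-1) ^ card J * (?u J ^ d - (?u J + b) ^ d))"
    unfolding sum_Pow_insert[OF insert.hyps(1,2)]
  proof (intro sum.cong refl)
    fix J assume "J \<in> Pow N"
    then have "card (insert x J) = Suc (card J)"
      using insert.hyps by (auto intro!: card_insert_disjoint dest: finite_subset)
    then show "(-1) ^ card J * ?u J ^ d + (-1) ^ card (insert x J) * ?u (insert x J) ^ d
      = (-1) ^ card J * (?u J ^ d - (?u J + b) ^ d)"
      by (simp add: algebra_simps)
  qed
  also have "\<dots> = - (\<Sum>J\<in>Pow N. \<Sum>e<d. of_nat (d choose e) * b ^ (d - e) * ((-1) ^ card J * ?u J ^ e))"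
    unfolding step by (simp add: sum_distrib_left sum_negf mult_ac)
  also have "\<dots> = - (\<Sum>e<d. of_nat (d choose e) * b ^ (d - e) * (\<Sum>J\<in>Pow N. (-1) ^ card J * ?u J ^ e))"
    by (subst sum.swap) (simp add: sum_distrib_left)
  also have "\<dots> = 0"
    using insert by (simp add: sum.neutral)
  finally show ?case .
qed simp

lemma sum_Pow_alternating:
  assumes "finite S"
  shows "(\<Sum>L\<in>Pow S. (-1) ^ card L) = (if S = {} then 1 else (0::int))"
  using sum_Pow_alternating_power[OF assms, of 0 "0::int" 0] assms by (auto simp: card_gt_0_iff)

text \<open>After exchanging the sums, the structure \<open>x\<close> is met only by the subsets of
  \<open>S - I x\<close>, whose signs cancel unless \<open>S - I x\<close> is empty.\<close>

lemma card_superset_inclusion_exclusion: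
  assumes "finite X" "finite S"
  shows "int (card {x\<in>X. S \<subseteq> I x}) = (\<Sum>L\<in>Pow S. (-1) ^ card L * int (card {x\<in>X. I x \<inter> L = {}}))"
proof -
  have "(\<Sum>L\<in>Pow S. (-1) ^ card L * int (card {x\<in>X. I x \<inter> L = {}}))
      = (\<Sum>L\<in>Pow S. \<Sum>x\<in>X. if I x \<inter> L = {} then (-1) ^ card L else 0)"
    using assms by (simp add: sum.If_cases Int_def mult.commute)
  also have "\<dots> = (\<Sum>x\<in>X. \<Sum>L\<in>Pow S. if I x \<inter> L = {} then (-1) ^ card L else 0)"
    by (rule sum.swap)
  also have "\<dots> = (\<Sum>x\<in>X. \<Sum>L\<in>Pow (S - I x). (-1) ^ card L)"
    using assms by (intro sum.cong refl sum.mono_neutral_cong_right) auto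
  also have "\<dots> = (\<Sum>x\<in>X. if S \<subseteq> I x then 1 else 0)"
    using assms by (simp add: sum_Pow_alternating)
  also have "\<dots> = int (card {x\<in>X. S \<subseteq> I x})"
    using assms by (simp add: sum.If_cases Int_def)
  finally show ?thesis by simp
qed

text \<open>Think of \<open>I x\<close> as the set of internal vertices of the structure \<open>x\<close>. The recurrence says that a
  structure with prescribed leaves \<open>L\<close> arises by attaching the leaf \<open>a\<close> anywhere outside \<open>L\<close>. Since
  not all vertices are internal, inclusion-exclusion over the leaf sets determines all counts.\<close>

lemma card_prescribed_leaves:
  fixes X :: "'v set \<Rightarrow> 'x set" and I :: "'x \<Rightarrow> 'v set"
  assumes A: "finite A"
    and fin: "\<And>N. N \<subseteq> A \<Longrightarrow> finite (X N)"
    and one: "card (X {}) = 1"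
    and not_all: "\<And>N x. N \<subseteq> A \<Longrightarrow> N \<noteq> {} \<Longrightarrow> x \<in> X N \<Longrightarrow> \<not> N \<subseteq> I x"
    and rec: "\<And>N L a. N \<subseteq> A \<Longrightarrow> L \<subseteq> N \<Longrightarrow> a \<in> L \<Longrightarrow> card {x\<in>X N. I x \<inter> L = {}} =
      (m * (card N - card L) + 1) * card {x\<in>X (N - {a}). I x \<inter> (L - {a}) = {}}"
    and "N \<subseteq> A" "L \<subseteq> N"
  shows "card {x\<in>X N. I x \<inter> L = {}} = (m * (card N - card L) + 1) ^ (card N - 1)"
proof -
  \<comment> \<open>Each use of \<open>rec\<close> lowers \<open>card N\<close> and
    \<open>card L\<close> together, so all \<open>card L\<close> steps contribute the same
    factor.\<close>
  have remove: "card {x\<in>X N. I x \<inter> L = {}} = (m * (card N - card L) + 1) ^ card L * card (X (N - L))"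
    if "N \<subseteq> A" "L \<subseteq> N" for N L
    using that
  proof (induction "card L" arbitrary: N L)
    case 0
    then have "L = {}" using A by (metis card_0_eq finite_subset)
    then show ?case by simp
  next
    case (Suc l)
    then obtain a where a: "a \<in> L" by fastforce
    have finN: "finite N" "finite L" using Suc.prems A by (meson finite_subset)+
    have l: "l = card (L - {a})" using Suc.hyps(2) a by simp
    have "card (N - {a}) - card (L - {a}) = card N - card L"
      using card_Suc_Diff1[OF finN(1), of a] card_Suc_Diff1[OF finN(2) a] a Suc.prems by auto
    moreover have "N - {a} - (L - {a}) = N - L" using a by auto
    ultimately have "card {x\<in>X (N - {a}). I x \<inter> (L - {a}) = {}}
      = (m * (card N - card L) + 1) ^ l * card (X (N - L))"
      using Suc.hyps(1)[OF l, of "N - {a}"] Suc.prems l by auto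
    then show ?case
      using rec[OF Suc.prems a] Suc.hyps(2)[symmetric] by (simp add: algebra_simps)
  qed
  \<comment> \<open>Below, \<open>g\<close> is the claimed count and \<open>h\<close> the true one.
    They agree on nonempty \<open>L\<close>, where \<open>remove\<close> leads to the smaller set
    \<open>N - L\<close>, and both have alternating sum 0 over all \<open>L\<close>; hence they
    agree at the empty set.\<close>
  have total: "card (X N) = (m * card N + 1) ^ (card N - 1)" if "N \<subseteq> A" for N
    using that
  proof (induction "card N" arbitrary: N rule: less_induct)
    case less
    show ?case
    proof (cases "N = {}")
      case True then show ?thesis by (simp add: one)
    next
      case False
      have finN: "finite N" using less.prems A by (meson finite_subset)
      then have pos: "card N > 0" using False by auto
      define g where "g L = int ((m * (card N - card L) + 1) ^ (card N - 1))" for L :: "'v set"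
      define h where "h L = int (card {x\<in>X N. I x \<inter> L = {}})" for L
      have gh: "g L = h L" if "L \<in> Pow N - {{}}" for L
      proof -
        have finL: "finite L" and L: "L \<subseteq> N" and l0: "card L > 0"
          using that finN finite_subset by (auto simp: card_gt_0_iff)
        have c: "card (N - L) = card N - card L" using finL L by (simp add: card_Diff_subset)
        have lN: "card L \<le> card N" using L finN card_mono by blast
        have "card (X (N - L)) = (m * card (N - L) + 1) ^ (card (N - L) - 1)"
          using less.hyps[of "N - L"] c l0 lN less.prems by auto
        then have "card {x\<in>X N. I x \<inter> L = {}} = (m * (card N - card L) + 1) ^ (card L + (card N - card L - 1))"
          using remove[OF less.prems L] by (simp add: power_add c)
        \<comment> \<open>For \<open>L = N\<close> the truncated exponent is off by one, but the
          base is then 1.\<close>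
        moreover have "(m * (card N - card L) + 1) ^ (card L + (card N - card L - 1))
            = (m * (card N - card L) + 1) ^ (card N - 1)"
          using lN l0 by (cases "card N = card L") auto
        ultimately show ?thesis unfolding g_def h_def by simp
      qed
      have "{x\<in>X N. N \<subseteq> I x} = {}" using not_all less.prems False by auto
      then have h0: "(\<Sum>L\<in>Pow N. (-1) ^ card L * h L) = 0"
        unfolding h_def
        by (subst card_superset_inclusion_exclusion[symmetric]) (use fin less.prems finN in auto)
      have "(\<Sum>L\<in>Pow N. (-1) ^ card L * g L)
          = (\<Sum>L\<in>Pow N. (-1) ^ card L * (int (m * card N + 1) + (- int m) * of_nat (card L)) ^ (card N - 1))"
        unfolding g_def
        by (intro sum.cong refl) (use finN in \<open>simp add: of_nat_diff card_mono algebra_simps\<close>)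
      also have "\<dots> = 0"
        using finN pos by (intro sum_Pow_alternating_power) auto
      finally have "(\<Sum>L\<in>Pow N. (-1) ^ card L * g L) = (\<Sum>L\<in>Pow N. (-1) ^ card L * h L)"
        using h0 by simp
      moreover have "(\<Sum>L\<in>Pow N - {{}}. (-1) ^ card L * g L) = (\<Sum>L\<in>Pow N - {{}}. (-1) ^ card L * h L)"
        using gh by simp
      ultimately have "g {} = h {}"
        using finN by (simp add: sum.remove[of "Pow N" "{}"])
      then have "(m * (card N - card ({} :: 'v set)) + 1) ^ (card N - 1) = card {x\<in>X N. I x \<inter> {} = {}}"
        unfolding g_def h_def of_nat_eq_iff .
      then show ?thesis by simp
    qed
  qed
  show ?thesis
  proof (cases "L = {}")
    case True
    then show ?thesis using total assms by simp
  next
    case False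
    have finN: "finite N" "finite L" using finite_subset[OF assms(6) A] finite_subset[OF assms(7)] by auto
    have l0: "card L > 0" using False finN by auto
    have lN: "card L \<le> card N" using finN(1) assms(7) by (rule card_mono)
    have c: "card (N - L) = card N - card L" using finN(2) assms(7) by (simp add: card_Diff_subset)
    have "card {x\<in>X N. I x \<inter> L = {}} = (m * (card N - card L) + 1) ^ (card L + (card N - card L - 1))"
      using remove[OF assms(6,7)] total[OF subset_trans[OF Diff_subset assms(6)], of L]
      by (simp only: power_add c)
    also have "\<dots> = (m * (card N - card L) + 1) ^ (card N - 1)"
      using lN l0 by (cases "card N = card L") auto
    finally show ?thesis .
  qed
qed

text \<open>\<open>n choose k\<close> counts the marked sets of size \<open>n - k\<close>, and the
  sum is the alternating sum over their subsets grouped by size \<open>i\<close>. Integers are used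
  for the signs; \<open>n - i\<close> does not truncate, as \<open>i\<close> is at most
  \<open>n - k\<close>.\<close>

definition face_number :: "nat \<Rightarrow> nat \<Rightarrow> nat \<Rightarrow> int" where
  "face_number m n k = int (n choose k) *
     (\<Sum>i\<le>n - k. int (n - k choose i) * ((-1) ^ i * int (m * (n - i) + 1) ^ (n - 1)))"

lemma sum_Pow_card:
  fixes h :: "nat \<Rightarrow> 'b::comm_semiring_1"
  assumes "finite S"
  shows "(\<Sum>L\<in>Pow S. h (card L)) = (\<Sum>i\<le>card S. of_nat (card S choose i) * h i)"
proof -
  have "(\<Sum>L\<in>Pow S. h (card L)) = (\<Sum>i\<le>card S. \<Sum>L\<in>{L\<in>Pow S. card L = i}. h (card L))"
    using assms by (intro sum.group[symmetric]) (auto intro: card_mono)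
  also have "\<dots> = (\<Sum>i\<le>card S. of_nat (card S choose i) * h i)"
    using assms by (intro sum.cong refl) (simp add: n_subsets Pow_def)
  finally show ?thesis .
qed

lemma face_number_eq_sum:
  assumes "finite N" "card N = n" "k \<le> n"
  shows "face_number m n k =
    (\<Sum>S | S \<subseteq> N \<and> card S = n - k. \<Sum>L\<in>Pow S. (-1) ^ card L * int (m * (n - card L) + 1) ^ (n - 1))"
proof -
  have "(\<Sum>L\<in>Pow S. (-1) ^ card L * int (m * (n - card L) + 1) ^ (n - 1))
    = (\<Sum>i\<le>n - k. int (n - k choose i) * ((-1) ^ i * int (m * (n - i) + 1) ^ (n - 1)))"
    if "S \<subseteq> N" "card S = n - k" for S
    using sum_Pow_card[of S "\<lambda>i. (-1) ^ i * int (m * (n - i) + 1) ^ (n - 1)"] that assms(1)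
      finite_subset by fastforce
  then show ?thesis
    using n_subsets[OF assms(1), of "n - k"] assms(2,3)
    by (simp add: face_number_def binomial_symmetric[of k n])
qed

text \<open>The only input about a family is the number of structures whose internal set avoids
  \<open>L\<close>; inclusion-exclusion for each marked set \<open>S\<close> and summation over
  \<open>S\<close> do the rest. It serves \<open>W_set\<close>, \<open>V_set\<close> and
  \<open>U_set\<close> alike.\<close>

lemma card_marked:
  assumes "finite X" "finite N" "card N = n" "k \<le> n"
    and avoid: "\<And>L. L \<subseteq> N \<Longrightarrow> card {x\<in>X. I x \<inter> L = {}} = (m * (n - card L) + 1) ^ (n - 1)"
  shows "int (card {(x, S). x \<in> X \<and> S \<subseteq> N \<and> card S = n - k \<and> S \<subseteq> I x}) = face_number m n k"
proof -
  have "{(x, S). x \<in> X \<and> S \<subseteq> N \<and> card S = n - k \<and> S \<subseteq> I x}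
    = prod.swap ` (SIGMA S:{S. S \<subseteq> N \<and> card S = n - k}. {x\<in>X. S \<subseteq> I x})"
    by (auto simp: image_iff)
  then have "card {(x, S). x \<in> X \<and> S \<subseteq> N \<and> card S = n - k \<and> S \<subseteq> I x}
    = (\<Sum>S | S \<subseteq> N \<and> card S = n - k. card {x\<in>X. S \<subseteq> I x})"
    using assms(1,2) by (simp add: card_image card_SigmaI)
  moreover have "int (card {x\<in>X. S \<subseteq> I x})
      = (\<Sum>L\<in>Pow S. (-1) ^ card L * int (m * (n - card L) + 1) ^ (n - 1))" if "S \<subseteq> N" for S
  proof -
    have "finite S" using that assms(2) finite_subset by blast
    then show ?thesis
      unfolding card_superset_inclusion_exclusion[OF assms(1) \<open>finite S\<close>]
      using that by (intro sum.cong refl) (auto simp: avoid)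
  qed
  ultimately show ?thesis
    using assms by (simp add: face_number_eq_sum[of N])
qed

section \<open>Functions and the blocks they hit\<close>

lemma card_W_set:
  assumes "k \<le> n" "n \<ge> 1"
  shows "finite (W_set m n k)" "int (card (W_set m n k)) = face_number m n k"
proof -
  define X where "X = ({1..n - 1} \<rightarrow>\<^sub>E {1..m * n + 1})"
  define blk where "blk i = {(i - 1) * m + 1..i * m}" for i :: nat
  \<comment> \<open>\<open>I f\<close> may contain \<open>n + 1\<close>, since the value
    \<open>m * n + 1\<close> can fall into the next block; only subsets of \<open>{1..n}\<close> are
    ever compared with it.\<close>
  define I where "I f = {i. f ` {1..n - 1} \<inter> blk i \<noteq> {}}" for f
  have finX: "finite X" unfolding X_def by (intro finite_PiE) auto
  have W: "W_set m n k = {(f, S). f \<in> X \<and> S \<subseteq> {1..n} \<and> card S = n - k \<and> S \<subseteq> I f}"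
    unfolding W_set_def X_def I_def blk_def by auto
  have "finite (X \<times> Pow {1..n})" using finX by simp
  then show "finite (W_set m n k)" by (rule rev_finite_subset) (auto simp: W)
  have "card {f\<in>X. I f \<inter> L = {}} = (m * (n - card L) + 1) ^ (n - 1)" if L: "L \<subseteq> {1..n}" for L
  proof -
    have finL: "finite L" using L finite_subset by blast
    have lt: "i * m \<le> (j - 1) * m" if "i < j" for i j :: nat
      using that by (intro mult_right_mono) auto
    have disj: "blk i \<inter> blk j = {}" if "i \<noteq> j" for i j
    proof -
      have False if "x \<in> blk i" "x \<in> blk j" for x
        using that lt[of i j] lt[of j i] \<open>i \<noteq> j\<close> unfolding blk_def atLeastAtMost_iff by linarith
      then show ?thesis by blast
    qed
    have sub: "blk i \<subseteq> {1..m * n + 1}" if "i \<in> L" for i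
    proof -
      have "i * m \<le> n * m" using that L by (intro mult_right_mono) auto
      then show ?thesis
        unfolding blk_def by (intro subsetI) (unfold atLeastAtMost_iff mult.commute[of m n], linarith)
    qed
    have cb: "card (blk i) = m" if "i \<in> L" for i
      using that L unfolding blk_def by (cases i) auto
    \<comment> \<open>The blocks with index in \<open>{1..n}\<close> are disjoint intervals of
      length \<open>m\<close> inside \<open>{1..m * n}\<close>, so the last value
      \<open>m * n + 1\<close> lies in none of them and supplies the \<open>+ 1\<close>.\<close>
    have "card (\<Union>i\<in>L. blk i) = (\<Sum>i\<in>L. card (blk i))"
      using finL disj by (intro card_UN_disjoint) (auto simp: blk_def)
    then have "card (\<Union>i\<in>L. blk i) = card L * m" using cb by simp
    moreover have "card ({1..m * n + 1} - (\<Union>i\<in>L. blk i)) = (m * n + 1) - card (\<Union>i\<in>L. blk i)"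
    proof (subst card_Diff_subset)
      show "finite (\<Union>i\<in>L. blk i)" using finL by (simp add: blk_def)
      show "(\<Union>i\<in>L. blk i) \<subseteq> {1..m * n + 1}" using sub by blast
    qed simp
    moreover have "card L \<le> n" using card_mono[OF _ L] by simp
    ultimately have "card ({1..m * n + 1} - (\<Union>i\<in>L. blk i)) = m * (n - card L) + 1"
      by (simp add: diff_mult_distrib2 Suc_diff_le mult.commute)
    moreover have "{f\<in>X. I f \<inter> L = {}} = {1..n - 1} \<rightarrow>\<^sub>E ({1..m * n + 1} - (\<Union>i\<in>L. blk i))"
    proof -
      have "I f \<inter> L = {} \<longleftrightarrow> (\<forall>j\<in>{1..n - 1}. f j \<notin> (\<Union>i\<in>L. blk i))" for f
        unfolding I_def by blast
      then show ?thesis unfolding X_def PiE_iff set_eq_iff mem_Collect_eq by blast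
    qed
    ultimately show ?thesis by (simp add: card_PiE)
  qed
  then show "int (card (W_set m n k)) = face_number m n k"
    unfolding W using finX assms by (intro card_marked) auto
qed

section \<open>Cayley foliages\<close>

lemma graph_tree_edgeD:
  assumes "graph_tree V E" "e \<in> E"
  shows "e \<subseteq> V" "card e = 2"
  using assms unfolding graph_tree_def by auto

lemma graph_tree_edge_at:
  assumes "graph_tree V E" "e \<in> E" "a \<in> e"
  obtains b where "e = {a, b}" "b \<noteq> a" "b \<in> V"
proof -
  obtain x y where "e = {x, y}" "x \<noteq> y"
    using graph_tree_edgeD(2)[OF assms(1,2)] by (auto simp: card_2_iff)
  then show ?thesis
    using assms(3) graph_tree_edgeD(1)[OF assms(1,2)] that by (metis insert_commute insert_iff insert_subset singletonD)
qed

lemma graph_tree_neighbour: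
  assumes "graph_tree V E" "u \<in> V" "v \<in> V" "u \<noteq> v"
  obtains w where "{u, w} \<in> E"
proof -
  have "(u, v) \<in> {(x, y). {x, y} \<in> E}\<^sup>*" using assms unfolding graph_tree_def by auto
  then show ?thesis using assms(4) that by (cases rule: converse_rtranclE) auto
qed

lemma graph_tree_finite_edges:
  assumes "graph_tree V E" "finite V"
  shows "finite E"
  using assms unfolding graph_tree_def by (intro finite_subset[of E "Pow V"]) auto

text \<open>The predecessor and the successor of \<open>a\<close> on the cycle serve; they differ
  because a cycle has at least three vertices.\<close>

lemma graph_cycle_neighbours:
  assumes "graph_cycle E vs" "a \<in> set vs"
  obtains u w where "u \<noteq> w" "{a, u} \<in> E" "{a, w} \<in> E"
proof -
  let ?l = "length vs"
  have l: "?l \<ge> 3" and d: "distinct vs" and e: "\<And>i. i < ?l \<Longrightarrow> {vs ! i, vs ! ((i + 1) mod ?l)} \<in> E"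
    using assms(1) unfolding graph_cycle_def by auto
  obtain i where i: "i < ?l" "vs ! i = a" using assms(2) by (auto simp: in_set_conv_nth)
  define p where "p = (if i = 0 then ?l - 1 else i - 1)"
  define s where "s = (if Suc i = ?l then 0 else Suc i)"
  have p: "p < ?l" "(p + 1) mod ?l = i" using i l unfolding p_def by auto
  have s: "s < ?l" "(i + 1) mod ?l = s"
    using i l unfolding s_def by auto
  have "p \<noteq> s" using i l unfolding p_def s_def by auto
  then have "vs ! p \<noteq> vs ! s" using d p s by (simp add: nth_eq_iff_index_eq)
  moreover have "{a, vs ! p} \<in> E" using e[OF p(1)] p(2) i(2) by (simp add: insert_commute)
  moreover have "{a, vs ! s} \<in> E" using e[OF i(1)] s(2) i(2) by simp
  ultimately show ?thesis using that by blast
qed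

text \<open>A new cycle would have to pass through \<open>a\<close>, which has the single neighbour
  \<open>b\<close>.\<close>

lemma graph_tree_attach:
  assumes T: "graph_tree V E" and a: "a \<notin> V" and b: "b \<in> V"
  shows "graph_tree (insert a V) (insert {a, b} E)"
proof -
  let ?R = "\<lambda>E. {(x, y). {x, y} \<in> E}"
  have noa: "a \<notin> e" if "e \<in> E" for e using graph_tree_edgeD(1)[OF T that] a by auto
  have "(u, v) \<in> (?R (insert {a, b} E))\<^sup>*" if "u \<in> insert a V" "v \<in> insert a V" for u v
  proof -
    have mono: "(?R E)\<^sup>* \<subseteq> (?R (insert {a, b} E))\<^sup>*" by (intro rtrancl_mono) auto
    have "(u, b) \<in> (?R (insert {a, b} E))\<^sup>*"
      using that(1) T b mono unfolding graph_tree_def by (cases "u = a") auto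
    moreover have "(b, v) \<in> (?R (insert {a, b} E))\<^sup>*"
      using that(2) T b mono unfolding graph_tree_def
      by (cases "v = a") (auto simp: insert_commute)
    ultimately show ?thesis by (rule rtrancl_trans)
  qed
  moreover have "\<not> graph_cycle (insert {a, b} E) vs" for vs
  proof
    assume cyc: "graph_cycle (insert {a, b} E) vs"
    show False
    proof (cases "a \<in> set vs")
      case True
      obtain u w where "u \<noteq> w" "{a, u} \<in> insert {a, b} E" "{a, w} \<in> insert {a, b} E"
        using graph_cycle_neighbours[OF cyc True] .
      then show False using noa by (auto simp: doubleton_eq_iff)
    next
      case False
      have "{vs ! i, vs ! ((i + 1) mod length vs)} \<in> E" if i: "i < length vs" for i
      proof -
        have "(i + 1) mod length vs < length vs" using i by (intro mod_less_divisor) auto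
        then have "a \<notin> {vs ! i, vs ! ((i + 1) mod length vs)}"
          using False i by (metis insertE nth_mem singletonD)
        moreover have "{vs ! i, vs ! ((i + 1) mod length vs)} \<in> insert {a, b} E"
          using cyc i unfolding graph_cycle_def by blast
        ultimately show ?thesis by auto
      qed
      then have "graph_cycle E vs" using cyc unfolding graph_cycle_def by blast
      then show False using T unfolding graph_tree_def by blast
    qed
  qed
  moreover have "insert {a, b} E \<subseteq> {e. e \<subseteq> insert a V \<and> card e = 2}"
    using T a b unfolding graph_tree_def by (auto simp: card_insert_if)
  ultimately show ?thesis unfolding graph_tree_def by auto
qed

lemma graph_tree_detach:
  assumes T: "graph_tree V E" and a: "a \<in> V" and ab: "{e\<in>E. a \<in> e} = {{a, b}}" and "b \<noteq> a"
  shows "graph_tree (V - {a}) (E - {{a, b}})"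
proof -
  let ?E = "E - {{a, b}}"
  let ?R = "\<lambda>E. {(x, y). {x, y} \<in> E}"
  have noa: "a \<notin> e" if "e \<in> ?E" for e using ab that by blast
  \<comment> \<open>Walks are rerouted: \<open>a\<close> can only be entered from \<open>b\<close>
    and left towards \<open>b\<close>, so a visit to \<open>a\<close> counts as staying at
    \<open>b\<close>.\<close>
  have "(v \<noteq> a \<longrightarrow> (u, v) \<in> (?R ?E)\<^sup>*) \<and> (v = a \<longrightarrow> (u, b) \<in> (?R ?E)\<^sup>*)"
    if "(u, v) \<in> (?R E)\<^sup>*" "u \<noteq> a" for u v
    using that
  proof (induction rule: rtrancl_induct)
    case (step y z)
    have "{y, z} = {a, b}" if "y = a \<or> z = a"
    proof -
      have "{y, z} \<in> {e\<in>E. a \<in> e}" using step.hyps(2) that by auto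
      then show ?thesis unfolding ab by simp
    qed
    then consider "y = a" "z = b" | "y = b" "z = a" | "y \<noteq> a" "z \<noteq> a" "{y, z} \<in> ?E"
      using step.hyps(2) by (auto simp: doubleton_eq_iff)
    then show ?case
    proof cases
      case 3
      then show ?thesis using step.IH[OF step.prems] by (auto intro: rtrancl_into_rtrancl)
    qed (use step.IH[OF step.prems] \<open>b \<noteq> a\<close> in auto)
  qed auto
  then have "\<forall>u\<in>V - {a}. \<forall>v\<in>V - {a}. (u, v) \<in> (?R ?E)\<^sup>*"
    using T unfolding graph_tree_def by blast
  moreover have "?E \<subseteq> {e. e \<subseteq> V - {a} \<and> card e = 2}"
    using T noa unfolding graph_tree_def by auto
  moreover have "\<not> graph_cycle ?E vs" for vs
  proof
    assume "graph_cycle ?E vs"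
    then have "graph_cycle E vs" unfolding graph_cycle_def by blast
    then show False using T unfolding graph_tree_def by blast
  qed
  ultimately show ?thesis unfolding graph_tree_def by blast
qed

text \<open>If all degrees in \<open>N\<close> were at least 2, the first vertex of a longest path
  ending in \<open>r\<close> would have a second neighbour. Maximality puts this neighbour on the
  path, which closes a cycle.\<close>

lemma graph_tree_leaf_exists:
  assumes T: "graph_tree (insert r N) E" and N: "finite N" "N \<noteq> {}" "r \<notin> N"
  shows "\<exists>a\<in>N. vertex_degree E a < 2"
proof (rule ccontr)
  assume "\<not> ?thesis"
  then have deg: "vertex_degree E a \<ge> 2" if "a \<in> N" for a using that by force
  define path where "path vs \<longleftrightarrow> vs \<noteq> [] \<and> last vs = r \<and> distinct vs \<and> set vs \<subseteq> insert r N \<and>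
    (\<forall>i. Suc i < length vs \<longrightarrow> {vs ! i, vs ! Suc i} \<in> E)" for vs
  have "path [r]" unfolding path_def by auto
  moreover have "length vs < Suc (card (insert r N))" if "path vs" for vs
    using that N card_mono[of "insert r N" "set vs"] distinct_card[of vs] unfolding path_def by fastforce
  ultimately obtain vs where vs: "path vs" and longest: "\<And>us. path us \<Longrightarrow> length us \<le> length vs"
    using ex_has_greatest_nat[of path "[r]" length "Suc (card (insert r N))"] by (metis less_or_eq_imp_le)
  have extend: "path (u # vs)" if "u \<notin> set vs" "{hd vs, u} \<in> E" for u
  proof -
    have "u \<in> insert r N" using graph_tree_edgeD(1)[OF T that(2)] by auto
    moreover have "{(u # vs) ! i, (u # vs) ! Suc i} \<in> E" if "Suc i < length (u # vs)" for i
      using that vs \<open>{hd vs, u} \<in> E\<close> unfolding path_def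
      by (cases i) (auto simp: hd_conv_nth insert_commute)
    ultimately show ?thesis using vs that(1) unfolding path_def by auto
  qed
  show False
  proof (cases vs)
    case Nil then show False using vs path_def by auto
  next
    case (Cons v ws)
    show False
    proof (cases ws)
      case Nil
      then have "vs = [r]" using vs Cons path_def by auto
      moreover obtain a where "a \<in> N" using N by auto
      moreover obtain w where w: "{r, w} \<in> E"
        using graph_tree_neighbour[OF T, of r a] \<open>a \<in> N\<close> N by auto
      moreover have "w \<noteq> r" using graph_tree_edgeD(2)[OF T w] by auto
      ultimately show False using extend[of w] longest[of "w # vs"] by auto
    next
      case (Cons w us)
      then have vs': "vs = v # w # us" using \<open>vs = v # ws\<close> by simp
      have "v \<noteq> r" using vs unfolding path_def vs' by (auto split: if_splits)
      then have "v \<in> N" using vs unfolding path_def vs' by auto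
      then have "card {e\<in>E. v \<in> e} \<ge> 2" using deg unfolding vertex_degree_def by auto
      then have "\<not> {e\<in>E. v \<in> e} \<subseteq> {{v, w}}" using card_mono[of "{{v, w}}" "{e\<in>E. v \<in> e}"] by auto
      then obtain e where e: "e \<in> E" "v \<in> e" "e \<noteq> {v, w}" by auto
      then obtain u where u: "e = {v, u}" "u \<noteq> v" "u \<noteq> w" using graph_tree_edge_at[OF T, of e v] by metis
      then have "u \<in> set vs" using extend[of u] longest[of "u # vs"] e vs' by auto
      then obtain j where j: "j < length vs" "vs ! j = u" by (auto simp: in_set_conv_nth)
      \<comment> \<open>\<open>u\<close> is neither \<open>v\<close> nor \<open>w\<close>, the first
        two vertices of the path, so the prefix up to \<open>u\<close> has the three vertices that a
        cycle needs.\<close>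
      have j2: "j \<ge> 2" using j u vs' by (cases j; cases "j - 1") auto
      have "{take (Suc j) vs ! i, take (Suc j) vs ! (Suc i mod Suc j)} \<in> E" if "i < Suc j" for i
      proof (cases "i = j")
        case True
        have "take (Suc j) vs ! j = u" "take (Suc j) vs ! 0 = v" using j vs' by (simp_all del: take_Suc_Cons)
        then show ?thesis using True u e by (simp add: insert_commute)
      next
        case False
        then show ?thesis using that vs j unfolding path_def by auto
      qed
      moreover have len: "length (take (Suc j) vs) = Suc j" using j by simp
      ultimately have "graph_cycle E (take (Suc j) vs)"
        using vs j2 unfolding graph_cycle_def path_def len by simp
      then show False using T unfolding graph_tree_def by blast
    qed
  qed
qed

text \<open>\<open>cayley_foliages\<close> for an arbitrary label set \<open>N\<close>, with
  \<open>r\<close> in the role of \<open>n + 1\<close>: the label set does not stay an initial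
  segment when leaves are removed.\<close>

definition foliages :: "nat \<Rightarrow> nat \<Rightarrow> nat set \<Rightarrow> (nat set set \<times> (nat set \<Rightarrow> nat)) set" where
  "foliages m r N = {(E, c). graph_tree (insert r N) E \<and> c \<in> E \<rightarrow>\<^sub>E {0..<m} \<and> (\<forall>e\<in>E. r \<in> e \<longrightarrow> c e = 0)}"

definition internal_vertices :: "nat set set \<times> (nat set \<Rightarrow> nat) \<Rightarrow> nat set" where
  "internal_vertices = (\<lambda>(E, c). {v. vertex_degree E v \<ge> 2})"

lemma foliagesI:
  assumes "graph_tree (insert r N) E" "c \<in> E \<rightarrow>\<^sub>E {0..<m}" "\<forall>e\<in>E. r \<in> e \<longrightarrow> c e = 0"
  shows "(E, c) \<in> foliages m r N"
  using assms by (simp add: foliages_def)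

lemma internal_vertices_disjointI:
  assumes "\<And>v. v \<in> L \<Longrightarrow> vertex_degree E v < 2"
  shows "internal_vertices (E, c) \<inter> L = {}"
  using assms by (fastforce simp: internal_vertices_def)

lemma finite_foliages: "finite N \<Longrightarrow> finite (foliages m r N)"
proof -
  assume "finite N"
  then have "finite (SIGMA E:Pow (Pow (insert r N)). E \<rightarrow>\<^sub>E {0..<m})"
    by (intro finite_SigmaI finite_PiE) (auto intro: finite_subset[of _ "Pow (insert r N)"])
  then show ?thesis
    by (rule rev_finite_subset) (auto simp: foliages_def graph_tree_def)
qed

lemma foliages_empty: "foliages m r {} = {({}, \<lambda>_. undefined)}"
proof -
  have "E = {}" if "graph_tree {r} E" for E
  proof -
    have "card e \<le> 1" if "e \<in> E" for e
      using card_mono[OF _ graph_tree_edgeD(1)[OF \<open>graph_tree {r} E\<close> that]] by simp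
    then show ?thesis using graph_tree_edgeD(2)[OF that] by fastforce
  qed
  moreover have "graph_tree {r} {}" unfolding graph_tree_def graph_cycle_def by (auto intro!: exI[of _ 0])
  ultimately show ?thesis unfolding foliages_def by auto
qed

lemma vertex_degree_attach:
  assumes "finite E" "\<And>e. e \<in> E \<Longrightarrow> a \<notin> e"
  shows "vertex_degree (insert {a, b} E) v = vertex_degree E v + (if v \<in> {a, b} then 1 else 0)"
proof -
  have "{e\<in>insert {a, b} E. v \<in> e} = (if v \<in> {a, b} then insert {a, b} {e\<in>E. v \<in> e} else {e\<in>E. v \<in> e})"
    by auto
  moreover have "{a, b} \<notin> E" using assms by auto
  ultimately show ?thesis using assms(1) unfolding vertex_degree_def by simp
qed

text \<open>The leaf \<open>a\<close> is joined to \<open>r\<close> with the forced colour 0, or to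
  a vertex of \<open>N - L\<close> with any of \<open>m\<close> colours. The vertices of
  \<open>L - {a}\<close> are excluded: each already has an edge, so a second one would make it
  internal. This gives the factor \<open>m * (card N - card L) + 1\<close>.\<close>

lemma card_foliages_leaf:
  assumes N: "finite N" "r \<notin> N" and L: "L \<subseteq> N" "a \<in> L" and m: "m \<ge> 1"
  shows "card {x\<in>foliages m r N. internal_vertices x \<inter> L = {}} = (m * (card N - card L) + 1) *
    card {x\<in>foliages m r (N - {a}). internal_vertices x \<inter> (L - {a}) = {}}"
proof -
  define Y where "Y = {x\<in>foliages m r (N - {a}). internal_vertices x \<inter> (L - {a}) = {}}"
  define Z where "Z = {x\<in>foliages m r N. internal_vertices x \<inter> L = {}}"
  define Sl where "Sl = insert (r, 0) ((N - L) \<times> {0..<m})"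
  define \<phi> where "\<phi> = (\<lambda>((E, c), (b, s)). (insert {a, b} E, c({a, b} := s :: nat)))"
  have aN: "a \<in> N" "a \<noteq> r" using L N by auto
  then have V: "insert a (insert r (N - {a})) = insert r N" "insert r N - {a} = insert r (N - {a})" by auto
  have finV: "finite (insert r N)" using N by simp
  have Sl: "card Sl = m * (card N - card L) + 1"
    unfolding Sl_def using N L finite_subset[OF L(1)]
    by (subst card_insert_disjoint) (auto simp: card_cartesian_product card_Diff_subset)
  have noa: "a \<notin> e" if "graph_tree (insert r (N - {a})) E" "e \<in> E" for E e
    using graph_tree_edgeD(1)[OF that] aN by auto
  have inj: "inj_on \<phi> (Y \<times> Sl)"
  proof (rule inj_onI)
    fix x x' assume xx: "x \<in> Y \<times> Sl" "x' \<in> Y \<times> Sl" "\<phi> x = \<phi> x'"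
    obtain E c b s E' c' b' s' where x: "x = ((E, c), (b, s))" and x': "x' = ((E', c'), (b', s'))"
      by (metis surj_pair)
    have A: "(E, c) \<in> Y" "(E', c') \<in> Y" "(b, s) \<in> Sl" "(b', s') \<in> Sl"
      and eq: "\<phi> ((E, c), (b, s)) = \<phi> ((E', c'), (b', s'))" using xx x x' by auto
    have E: "a \<notin> e" if "e \<in> E \<or> e \<in> E'" for e
    proof -
      have "graph_tree (insert r (N - {a})) E" "graph_tree (insert r (N - {a})) E'"
        using A by (auto simp: Y_def foliages_def)
      then show ?thesis using that noa by metis
    qed
    have eqE: "insert {a, b} E = insert {a, b'} E'" and eqc: "c({a, b} := s) = c'({a, b'} := s')"
      using eq unfolding \<phi>_def by auto
    have "{a, b} = {a, b'}" using eqE E by (metis insertCI insertE)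
    then have b: "b = b'" by (auto simp: doubleton_eq_iff)
    have "E = {e\<in>insert {a, b} E. a \<notin> e}" "E' = {e\<in>insert {a, b'} E'. a \<notin> e}" using E by auto
    then have EE: "E = E'" using eqE by simp
    \<comment> \<open>Extensional colourings are undefined off the edge set, so the update at the
      new edge can be undone.\<close>
    have "{a, b} \<notin> E" using E by auto
    then have "c {a, b} = undefined" "c' {a, b} = undefined"
      using A EE unfolding Y_def foliages_def by (auto simp: PiE_iff extensional_def)
    then have "c = c'" using eqc b by (metis fun_upd_triv fun_upd_upd)
    moreover have "s = s'" using eqc b by (metis fun_upd_same)
    ultimately show "x = x'" using EE b x x' by simp
  qed
  moreover have "\<phi> ` (Y \<times> Sl) = Z"
  proof
    show "\<phi> ` (Y \<times> Sl) \<subseteq> Z"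
    proof
      fix x assume "x \<in> \<phi> ` (Y \<times> Sl)"
      then obtain y \<sigma> where y: "y \<in> Y" "\<sigma> \<in> Sl" "x = \<phi> (y, \<sigma>)" by auto
      obtain E c b s where "y = (E, c)" "\<sigma> = (b, s)" by (cases y; cases \<sigma>)
      with y have A: "(E, c) \<in> Y" "(b, s) \<in> Sl" and x: "x = \<phi> ((E, c), (b, s))" by auto
      then have T: "graph_tree (insert r (N - {a})) E" and c: "c \<in> E \<rightarrow>\<^sub>E {0..<m}"
        and c0: "\<forall>e\<in>E. r \<in> e \<longrightarrow> c e = 0" and int: "\<And>v. v \<in> L - {a} \<Longrightarrow> vertex_degree E v < 2"
        by (auto simp: Y_def foliages_def internal_vertices_def disjoint_iff not_le)
      have b: "b \<in> insert r (N - {a})" "b \<notin> L" "b = r \<longrightarrow> s = 0" "s < m"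
        using A(2) L N m unfolding Sl_def by auto
      have finE: "finite E" using graph_tree_finite_edges[OF T] N by simp
      have T': "graph_tree (insert r N) (insert {a, b} E)"
        using graph_tree_attach[OF T, of a b] aN b V by auto
      have deg: "vertex_degree (insert {a, b} E) v < 2" if "v \<in> L" for v
      proof (cases "v = a")
        case True
        have "{e\<in>E. a \<in> e} = {}" using noa[OF T] by auto
        then have "vertex_degree E a = 0" unfolding vertex_degree_def by (simp only: card.empty)
        then show ?thesis using True vertex_degree_attach[OF finE noa[OF T], of b v] by simp
      next
        case False
        then show ?thesis using vertex_degree_attach[OF finE noa[OF T], of b v] int b that by auto
      qed
      have c0': "\<forall>e\<in>insert {a, b} E. r \<in> e \<longrightarrow> (c({a, b} := s)) e = 0"
        using c0 b aN noa[OF T] by auto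
      have c': "c({a, b} := s) \<in> insert {a, b} E \<rightarrow>\<^sub>E {0..<m}"
        using c b by (auto simp: PiE_iff extensional_def)
      show "x \<in> Z"
        unfolding x Z_def \<phi>_def prod.case mem_Collect_eq
        by (intro conjI foliagesI T' c' c0' internal_vertices_disjointI deg)
    qed
    show "Z \<subseteq> \<phi> ` (Y \<times> Sl)"
    proof
      fix x assume "x \<in> Z"
      then obtain E c where A: "(E, c) \<in> Z" and x: "x = (E, c)" by (metis surj_pair)
      then have T: "graph_tree (insert r N) E" and c: "c \<in> E \<rightarrow>\<^sub>E {0..<m}"
        and c0: "\<forall>e\<in>E. r \<in> e \<longrightarrow> c e = 0" and int: "\<And>v. v \<in> L \<Longrightarrow> vertex_degree E v < 2"
        by (auto simp: Z_def foliages_def internal_vertices_def disjoint_iff not_le)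
      have finE: "finite E" using graph_tree_finite_edges[OF T finV] .
      obtain w where w: "{a, w} \<in> E" using graph_tree_neighbour[OF T, of a r] aN by auto
      then have "card {e\<in>E. a \<in> e} \<noteq> 0" using finE by auto
      then have "card {e\<in>E. a \<in> e} = 1" using int[OF L(2)] unfolding vertex_degree_def by linarith
      then obtain e where e: "{e\<in>E. a \<in> e} = {e}" by (auto simp: card_1_singleton_iff)
      then have "e \<in> E" "a \<in> e" by auto
      then obtain b where b: "e = {a, b}" "b \<noteq> a" "b \<in> insert r N" using graph_tree_edge_at[OF T] by metis
      define E' where "E' = E - {{a, b}}"
      have abE: "{a, b} \<in> E" using \<open>e \<in> E\<close> b by simp
      have EE: "E = insert {a, b} E'" "{a, b} \<notin> E'" using abE unfolding E'_def by auto
      have T': "graph_tree (insert r (N - {a})) E'"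
        using graph_tree_detach[OF T, of a b] aN e b V unfolding E'_def by auto
      have finE': "finite E'" using finE unfolding E'_def by simp
      have deg: "vertex_degree E v = vertex_degree E' v + (if v \<in> {a, b} then 1 else 0)" for v
        using vertex_degree_attach[OF finE' noa[OF T'], of b v] EE by simp
      \<comment> \<open>Connectedness gives \<open>b\<close>, if it is not the root, another edge
        after \<open>a\<close> is removed, hence degree at least 2 before.\<close>
      have "b \<notin> L"
      proof
        assume bL: "b \<in> L"
        then have "b \<noteq> r" using L N by auto
        then obtain u where u: "{b, u} \<in> E'" using graph_tree_neighbour[OF T', of b r] b by auto
        then have "vertex_degree E' b \<noteq> 0" using finE' unfolding vertex_degree_def by auto
        then show False using deg[of b] int[OF bL] by simp
      qed
      moreover have "b = r \<Longrightarrow> c {a, b} = 0" using c0 abE by auto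
      moreover have "c {a, b} < m" using c abE by (auto simp: PiE_iff)
      ultimately have "(b, c {a, b}) \<in> Sl" using b unfolding Sl_def by auto
      moreover have "(E', c({a, b} := undefined)) \<in> Y"
      proof -
        have "c({a, b} := undefined) \<in> E' \<rightarrow>\<^sub>E {0..<m}"
          using c EE by (auto simp: PiE_iff extensional_def)
        moreover have "vertex_degree E' v < 2" if "v \<in> L" for v using deg[of v] int[OF that] by auto
        ultimately have "(E', c({a, b} := undefined)) \<in> foliages m r (N - {a})"
          "internal_vertices (E', c({a, b} := undefined)) \<inter> (L - {a}) = {}"
          using T' c0 EE by (auto intro!: foliagesI internal_vertices_disjointI)
        then show ?thesis by (simp add: Y_def)
      qed
      ultimately show "x \<in> \<phi> ` (Y \<times> Sl)"
        using EE x by (intro image_eqI[of _ _ "((E', c({a, b} := undefined)), (b, c {a, b}))"]) (auto simp: \<phi>_def)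
    qed
  qed
  ultimately have "card Z = card (Y \<times> Sl)" by (metis card_image)
  then show ?thesis using Sl unfolding Y_def Z_def by (simp add: card_cartesian_product mult.commute)
qed

lemma card_V_set:
  assumes "k \<le> n" "m \<ge> 1"
  shows "finite (V_set m n k)" "int (card (V_set m n k)) = face_number m n k"
proof -
  let ?r = "n + 1" and ?N = "{1..n}"
  let ?X = "foliages m ?r" and ?I = internal_vertices
  define P where "P = {(x, S). x \<in> ?X ?N \<and> S \<subseteq> ?N \<and> card S = n - k \<and> S \<subseteq> ?I x}"
  have fX: "finite (?X ?N)" by (rule finite_foliages) auto
  have "finite (?X ?N \<times> Pow ?N)" using fX by auto
  then have finP: "finite P" by (rule rev_finite_subset) (auto simp: P_def)
  have ins: "insert ?r ?N = {1..n + 1}" by auto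
  have V: "V_set m n k = (\<lambda>((E, c), S). (E, c, S)) ` P"
    unfolding V_set_def cayley_foliages_def P_def foliages_def internal_vertices_def ins
    by (force simp: image_iff)
  then show "finite (V_set m n k)" using finP by simp
  have "card (V_set m n k) = card P"
    unfolding V by (intro card_image) (auto simp: inj_on_def)
  moreover have "int (card P) = face_number m n k"
    unfolding P_def
  proof (rule card_marked[OF fX])
    fix L assume L: "L \<subseteq> ?N"
    have "card {x\<in>?X ?N. ?I x \<inter> L = {}} = (m * (card ?N - card L) + 1) ^ (card ?N - 1)"
    proof (rule card_prescribed_leaves[where A = ?N])
      fix N x assume "N \<subseteq> ?N" "N \<noteq> {}" "x \<in> ?X N"
      moreover have "finite N" "?r \<notin> N" using \<open>N \<subseteq> ?N\<close> finite_subset by fastforce+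
      ultimately obtain a where "a \<in> N" "vertex_degree (fst x) a < 2"
        using graph_tree_leaf_exists[of ?r N "fst x"] by (auto simp: foliages_def)
      then have "a \<notin> ?I x" by (simp add: internal_vertices_def case_prod_beta)
      then show "\<not> N \<subseteq> ?I x" using \<open>a \<in> N\<close> by blast
    next
      fix N M a assume "N \<subseteq> ?N" "M \<subseteq> N" "a \<in> M"
      moreover have "finite N" "?r \<notin> N" using \<open>N \<subseteq> ?N\<close> finite_subset by fastforce+
      ultimately show "card {x\<in>?X N. ?I x \<inter> M = {}} =
          (m * (card N - card M) + 1) * card {x\<in>?X (N - {a}). ?I x \<inter> (M - {a}) = {}}"
        using assms(2) by (intro card_foliages_leaf)
    qed (use L finite_subset in \<open>auto simp: foliages_empty intro!: finite_foliages\<close>)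
    then show "card {x\<in>?X ?N. ?I x \<inter> L = {}} = (m * (n - card L) + 1) ^ (n - 1)" by simp
  qed (use assms in auto)
  ultimately show "int (card (V_set m n k)) = face_number m n k" by simp
qed

section \<open>Trees with descents\<close>

lemma internal_edges_Leaf [simp]: "internal_edges Leaf = {}"
  by (auto simp: internal_edges_def)

lemma internal_edges_Node: "internal_edges (Node a ts) =
    {(a, r, b) |r b us. r < length ts \<and> ts ! r = Node b us} \<union> (\<Union>t\<in>set ts. internal_edges t)"
  unfolding internal_edges_def by auto

lemma internal_edges_labels:
  "(a, r, b) \<in> internal_edges t \<Longrightarrow> a \<in> set (labels t) \<and> b \<in> set (labels t)"
proof (induction t)
  case (Node c ts)
  consider us where "a = c" "r < length ts" "ts ! r = Node b us"
    | t where "t \<in> set ts" "(a, r, b) \<in> internal_edges t"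
    using Node.prems by (auto simp: internal_edges_Node)
  then show ?case
  proof cases
    case 1
    then have "Node b us \<in> set ts" by (metis nth_mem)
    moreover have "b \<in> set (labels (Node b us))" by simp
    ultimately have "b \<in> (\<Union>t\<in>set ts. set (labels t))" by blast
    then show ?thesis using 1(1) by simp
  next
    case 2
    then show ?thesis using Node.IH by auto
  qed
qed simp

lemma ptree_neq_Leaf: "t \<noteq> Leaf \<longleftrightarrow> (\<exists>a ts. t = Node a ts)"
  by (cases t) auto

lemma labels_eq_Nil_iff: "labels t = [] \<longleftrightarrow> t = Leaf"
  by (cases t) auto

text \<open>A local form of the conditions on trees, fit for structural induction;
  \<open>descending_iff\<close> ties it to \<open>ary\<close> and \<open>internal_edges\<close>. The
  shape \<open>list_all id (map ...)\<close> is what primitive recursion through a list accepts, and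
  \<open>descending_Node\<close> replaces it afterwards.\<close>

primrec descending :: "nat \<Rightarrow> nat ptree \<Rightarrow> bool" where
  "descending m Leaf \<longleftrightarrow> True"
| "descending m (Node a ts) \<longleftrightarrow> length ts = Suc m \<and> list_all id (map (descending m) ts) \<and>
     (\<forall>b us. ts ! m = Node b us \<longrightarrow> b < a)"

lemma descending_Node [simp]:
  "descending m (Node a ts) \<longleftrightarrow> length ts = Suc m \<and> (\<forall>r\<le>m. descending m (ts ! r)) \<and>
     (\<forall>b us. ts ! m = Node b us \<longrightarrow> b < a)"
  by (auto simp: list_all_length less_Suc_eq_le)

declare descending.simps(2) [simp del]

lemma descending_iff:
  "descending m t \<longleftrightarrow> ary (m + 1) t \<and> (\<forall>(a, r, b)\<in>internal_edges t. r = m \<longrightarrow> a > b)"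
proof (induction t)
  case (Node a ts)
  have IH: "length ts = Suc m \<Longrightarrow> (\<forall>r\<le>m. descending m (ts ! r)) \<longleftrightarrow>
      (\<forall>t\<in>set ts. ary (m + 1) t) \<and> (\<forall>t\<in>set ts. \<forall>(a, r, b)\<in>internal_edges t. r = m \<longrightarrow> a > b)"
    using Node by (auto simp: all_set_conv_all_nth less_Suc_eq_le)
  show ?case
  proof (cases "length ts = Suc m")
    case True
    have "(\<forall>(a', r, b)\<in>{(a, r, b) |r b us. r < length ts \<and> ts ! r = Node b us}. r = m \<longrightarrow> a' > b) \<longleftrightarrow>
        (\<forall>b us. ts ! m = Node b us \<longrightarrow> b < a)"
      using True by fastforce
    then show ?thesis
      unfolding descending_Node internal_edges_Node ball_Un ball_UN using IH[OF True] True by auto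
  qed auto
qed simp

text \<open>These act as the internal vertices in \<open>card_prescribed_leaves\<close>. A node
  outside this set may still have a node child, but only at rank \<open>m\<close>, so it can be cut
  out of its chain.\<close>

definition inner_nodes :: "nat \<Rightarrow> nat ptree \<Rightarrow> nat set" where
  "inner_nodes m t = {a. \<exists>r b. (a, r, b) \<in> internal_edges t \<and> r < m}"

lemma inner_nodes_Leaf [simp]: "inner_nodes m Leaf = {}"
  by (simp add: inner_nodes_def)

lemma inner_nodes_Node:
  assumes "length ts = Suc m"
  shows "inner_nodes m (Node a ts) = (if \<exists>r<m. ts ! r \<noteq> Leaf then {a} else {}) \<union> (\<Union>r\<le>m. inner_nodes m (ts ! r))"
proof -
  have "(\<Union>t\<in>set ts. internal_edges t) = (\<Union>r\<le>m. internal_edges (ts ! r))"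
    using assms by (force simp: in_set_conv_nth less_Suc_eq_le)
  then have "inner_nodes m (Node a ts) =
      {c. \<exists>r b. (c, r, b) \<in> {(a, r, b) |r b us. r < length ts \<and> ts ! r = Node b us} \<and> r < m} \<union>
      (\<Union>r\<le>m. inner_nodes m (ts ! r))"
    unfolding inner_nodes_def internal_edges_Node by (simp only: Un_iff UN_iff conj_disj_distribR ex_disj_distrib) blast
  moreover have "{c. \<exists>r b. (c, r, b) \<in> {(a, r, b) |r b us. r < length ts \<and> ts ! r = Node b us} \<and> r < m}
      = (if \<exists>r<m. ts ! r \<noteq> Leaf then {a} else {})"
    using assms unfolding ptree_neq_Leaf by (fastforce simp: less_Suc_eq split: if_splits)
  ultimately show ?thesis by simp
qed

lemma inner_nodes_subset: "inner_nodes m t \<subseteq> set (labels t)"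
  by (auto simp: inner_nodes_def dest: internal_edges_labels)

lemma mset_labels_Node: "mset (labels (Node a ts)) = add_mset a (\<Sum>r<length ts. mset (labels (ts ! r)))"
  by (simp add: mset_concat sum_list_sum_nth o_def atLeast0LessThan)

lemma set_labels_Node: "length ts = Suc m \<Longrightarrow> set (labels (Node a ts)) = insert a (\<Union>r\<le>m. set (labels (ts ! r)))"
  by (force simp: in_set_conv_nth less_Suc_eq_le)

lemma distinct_iff_mset: "distinct xs \<longleftrightarrow> (\<forall>x. count (mset xs) x \<le> 1)"
  by (metis count_greater_eq_one_iff count_mset_0_iff distinct_count_atmost_1 nle_le set_mset_mset count_eq_zero_iff)

lemma distinct_labels_child:
  assumes "distinct (labels (Node a ts))" "r < length ts"
  shows "distinct (labels (ts ! r))" "a \<notin> set (labels (ts ! r))"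
  using assms by (auto simp: distinct_concat_iff)

lemma distinct_labels_children:
  assumes "distinct (labels (Node a ts))" "r < length ts" "s < length ts" "r \<noteq> s"
  shows "set (labels (ts ! r)) \<inter> set (labels (ts ! s)) = {}"
proof (rule ccontr)
  assume "\<not> ?thesis"
  then obtain x where x: "x \<in> set (labels (ts ! r))" "x \<in> set (labels (ts ! s))" by auto
  have "(\<Sum>i\<in>{r, s}. count (mset (labels (ts ! i))) x) \<le> (\<Sum>i<length ts. count (mset (labels (ts ! i))) x)"
    using assms by (intro sum_mono2) auto
  also have "\<dots> \<le> count (mset (labels (Node a ts))) x"
    unfolding mset_labels_Node by (simp add: count_sum)
  also have "\<dots> \<le> 1" using assms(1) unfolding distinct_iff_mset by blast
  finally have "count (mset (labels (ts ! r))) x + count (mset (labels (ts ! s))) x \<le> 1"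
    using assms(4) by simp
  moreover have "count (mset (labels (ts ! r))) x \<ge> 1" "count (mset (labels (ts ! s))) x \<ge> 1"
    using x by (auto simp: Suc_le_eq)
  ultimately show False by linarith
qed

text \<open>A slot is the place of a maximal chain of edges of rank \<open>m\<close>: \<open>None\<close> for the chain of the root and
  \<open>Some (b, r)\<close> with \<open>r < m\<close> for the chain starting at the child of rank \<open>r\<close> of \<open>b\<close>. The labels along
  a chain decrease, so a chain is determined by its set of labels, and a new label has a unique
  place in it.\<close>

type_synonym slot = "(nat \<times> nat) option"

text \<open>The last argument is the slot of the chain through the root, which the child of rank
  \<open>m\<close> continues. The resulting table records an insertion as one new pair, so the slot
  used can be read off again.\<close>

primrec slots_of :: "nat \<Rightarrow> nat ptree \<Rightarrow> slot \<Rightarrow> (nat \<times> slot) set" where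
  "slots_of m Leaf = (\<lambda>\<sigma>. {})"
| "slots_of m (Node b ts) =
     (\<lambda>\<sigma>. insert (b, \<sigma>) (\<Union>r<length ts. (map (slots_of m) ts ! r) (if r = m then \<sigma> else Some (b, r))))"

lemma slots_of_Node:
  assumes "length ts = Suc m"
  shows "slots_of m (Node b ts) \<sigma> =
    insert (b, \<sigma>) (slots_of m (ts ! m) \<sigma> \<union> (\<Union>r<m. slots_of m (ts ! r) (Some (b, r))))"
  using assms by (auto simp: lessThan_Suc)

declare slots_of.simps(2) [simp del]

lemma slots_of_labels: "(v, \<tau>) \<in> slots_of m t \<sigma> \<Longrightarrow> v \<in> set (labels t)"
proof (induction t arbitrary: \<sigma>)
  case (Node b ts)
  from Node.prems consider "v = b"
    | r where "r < length ts" "(v, \<tau>) \<in> slots_of m (ts ! r) (if r = m then \<sigma> else Some (b, r))"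
    by (auto simp: slots_of.simps(2))
  then show ?case
  proof cases
    case 2
    then have "v \<in> set (labels (ts ! r))" using Node.IH nth_mem by blast
    then show ?thesis using 2(1) nth_mem by fastforce
  qed simp
qed simp

text \<open>A slot \<open>Some (b, r)\<close> is occupied iff \<open>b\<close> has a node child of
  rank \<open>r\<close>, so the owners of the occupied slots of a tree are its inner nodes. The
  effect of an insertion on the inner nodes is thereby reduced to one new pair.\<close>

definition owners :: "(nat \<times> slot) set \<Rightarrow> nat set" where
  "owners S = {b. \<exists>v r. (v, Some (b, r)) \<in> S}"

lemma owners_simps:
  "owners {} = {}"
  "owners (insert (v, \<sigma>) S) = fst ` set_option \<sigma> \<union> owners S"
  "owners (S \<union> S') = owners S \<union> owners S'"
  "owners (\<Union>r\<in>R. F r) = (\<Union>r\<in>R. owners (F r))"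
  unfolding owners_def by (cases \<sigma>; auto simp: ex_disj_distrib)+

lemma owners_slots_of:
  assumes "descending m t"
  shows "owners (slots_of m t \<sigma>) = inner_nodes m t \<union> (if t = Leaf then {} else fst ` set_option \<sigma>)"
  using assms
proof (induction t arbitrary: \<sigma>)
  case (Node a ts)
  have len: "length ts = Suc m" using Node.prems by simp
  have IH: "owners (slots_of m (ts ! r) \<sigma>) = inner_nodes m (ts ! r) \<union> (if ts ! r = Leaf then {} else fst ` set_option \<sigma>)"
    if "r \<le> m" for r \<sigma>
    using Node that len by simp
  have le: "(\<Union>r\<le>m. inner_nodes m (ts ! r)) = inner_nodes m (ts ! m) \<union> (\<Union>r<m. inner_nodes m (ts ! r))"
    by (auto simp: le_less)
  have root: "(\<Union>r<m. if ts ! r = Leaf then {} else {a}) = (if \<exists>r<m. ts ! r \<noteq> Leaf then {a} else {})"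
    by auto
  have "owners (slots_of m (Node a ts) \<sigma>) = fst ` set_option \<sigma> \<union> (owners (slots_of m (ts ! m) \<sigma>) \<union>
      (\<Union>r<m. owners (slots_of m (ts ! r) (Some (a, r)))))"
    unfolding slots_of_Node[OF len] owners_simps ..
  also have "(\<Union>r<m. owners (slots_of m (ts ! r) (Some (a, r)))) =
      (\<Union>r<m. inner_nodes m (ts ! r)) \<union> (\<Union>r<m. if ts ! r = Leaf then {} else {a})"
    unfolding UN_Un_distrib[symmetric] by (intro SUP_cong refl) (simp add: IH)
  also have "fst ` set_option \<sigma> \<union> (owners (slots_of m (ts ! m) \<sigma>) \<union> \<dots>) = inner_nodes m (Node a ts) \<union> fst ` set_option \<sigma>"
    unfolding inner_nodes_Node[OF len] le root IH[OF order_refl] by auto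
  finally show ?case by simp
qed (simp add: owners_simps)

text \<open>The new node goes above the first smaller label on the chain and takes it as its child
  of rank \<open>m\<close>; its other children are leaves. So the labels along the chain keep
  decreasing.\<close>

primrec chain_insert :: "nat \<Rightarrow> nat \<Rightarrow> nat ptree \<Rightarrow> nat ptree" where
  "chain_insert m a Leaf = Node a (replicate (Suc m) Leaf)"
| "chain_insert m a (Node b ts) = (if b < a then Node a (replicate m Leaf @ [Node b ts])
     else Node b (ts[m := map (chain_insert m a) ts ! m]))"

primrec node_insert :: "nat \<Rightarrow> nat \<Rightarrow> nat \<Rightarrow> nat \<Rightarrow> nat ptree \<Rightarrow> nat ptree" where
  "node_insert m a b r Leaf = Leaf"
| "node_insert m a b r (Node c ts) = (if c = b then Node c (ts[r := chain_insert m a (ts ! r)])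
     else Node c (map (node_insert m a b r) ts))"

definition slot_insert :: "nat \<Rightarrow> nat \<Rightarrow> slot \<Rightarrow> nat ptree \<Rightarrow> nat ptree" where
  "slot_insert m a \<sigma> t = (case \<sigma> of None \<Rightarrow> chain_insert m a t | Some (b, r) \<Rightarrow> node_insert m a b r t)"

text \<open>An inserted node has only leaves at ranks below \<open>m\<close>, so replacing it by its
  child of rank \<open>m\<close> undoes the insertion.\<close>

primrec splice_out :: "nat \<Rightarrow> nat \<Rightarrow> nat ptree \<Rightarrow> nat ptree" where
  "splice_out m a Leaf = Leaf"
| "splice_out m a (Node b ts) = (if b = a then ts ! m else Node b (map (splice_out m a) ts))"

definition slot_at :: "nat \<Rightarrow> nat ptree \<Rightarrow> slot \<Rightarrow> bool" where
  "slot_at m t \<sigma> \<longleftrightarrow> (\<forall>b r. \<sigma> = Some (b, r) \<longrightarrow> b \<in> set (labels t) \<and> r < m)"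

lemma node_insert_id: "b \<notin> set (labels t) \<Longrightarrow> node_insert m a b r t = t"
  by (induction t) (auto intro: map_idI)

lemma splice_out_id: "a \<notin> set (labels t) \<Longrightarrow> splice_out m a t = t"
  by (induction t) (auto intro: map_idI)

text \<open>The root after insertion is the larger of \<open>a\<close> and the old root, and a leaf
  imposes no bound. This decides whether a descent into the chain survives.\<close>

lemma root_chain_insert:
  "(\<forall>c us. chain_insert m a t = Node c us \<longrightarrow> c < b) \<longleftrightarrow> a < b \<and> (\<forall>c us. t = Node c us \<longrightarrow> c < b)"
  by (cases t) auto

lemma root_node_insert:
  "(\<forall>c us. node_insert m a b r t = Node c us \<longrightarrow> c < d) \<longleftrightarrow> (\<forall>c us. t = Node c us \<longrightarrow> c < d)"
  by (cases t) auto

lemma sum_list_update_mset: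
  fixes f :: "'a \<Rightarrow> 'b multiset"
  assumes "r < length ts" "f u = add_mset x (f (ts ! r))"
  shows "(\<Sum>i<length ts. f (ts[r := u] ! i)) = add_mset x (\<Sum>i<length ts. f (ts ! i))"
proof -
  have "(\<Sum>i<length ts. f (ts[r := u] ! i)) = f u + (\<Sum>i\<in>{..<length ts} - {r}. f (ts[r := u] ! i))"
    using assms(1) by (subst sum.remove[of _ r]) auto
  also have "(\<Sum>i\<in>{..<length ts} - {r}. f (ts[r := u] ! i)) = (\<Sum>i\<in>{..<length ts} - {r}. f (ts ! i))"
    by (intro sum.cong) auto
  finally show ?thesis
    using assms by (simp add: sum.remove[of "{..<length ts}" r])
qed

lemma mset_labels_update:
  assumes "r < length ts" "mset (labels u) = add_mset x (mset (labels (ts ! r)))"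
  shows "mset (labels (Node b (ts[r := u]))) = add_mset x (mset (labels (Node b ts)))"
  unfolding mset_labels_Node length_list_update
  by (subst sum_list_update_mset[where f = "\<lambda>t. mset (labels t)", OF assms]) simp

lemma chain_insert_props:
  assumes "descending m t"
  shows "mset (labels (chain_insert m a t)) = add_mset a (mset (labels t))"
    and "a \<notin> set (labels t) \<Longrightarrow> descending m (chain_insert m a t)"
    and "slots_of m (chain_insert m a t) \<sigma> = insert (a, \<sigma>) (slots_of m t \<sigma>)"
    and "a \<notin> set (labels t) \<Longrightarrow> splice_out m a (chain_insert m a t) = t"
proof -
  have "mset (labels (chain_insert m a t)) = add_mset a (mset (labels t)) \<and>
    (a \<notin> set (labels t) \<longrightarrow> descending m (chain_insert m a t)) \<and>
    slots_of m (chain_insert m a t) \<sigma> = insert (a, \<sigma>) (slots_of m t \<sigma>) \<and>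
    (a \<notin> set (labels t) \<longrightarrow> splice_out m a (chain_insert m a t) = t)"
    using assms
  proof (induction t)
    case Leaf
    have "labels (chain_insert m a Leaf) = [a]" by (simp add: concat_eq_Nil_conv del: replicate_Suc)
    then show ?case by (auto simp: slots_of_Node nth_append simp del: replicate_Suc labels.simps(2))
  next
    case (Node b ts)
    have len: "length ts = Suc m" and ch: "\<And>r. r \<le> m \<Longrightarrow> descending m (ts ! r)" using Node.prems by auto
    show ?case
    proof (cases "b < a")
      case True
      have "labels (chain_insert m a (Node b ts)) = a # labels (Node b ts)"
        using True by (simp add: concat_eq_Nil_conv)
      moreover have "slots_of m (chain_insert m a (Node b ts)) \<sigma> = insert (a, \<sigma>) (slots_of m (Node b ts) \<sigma>)"
        using True by (auto simp: slots_of_Node nth_append)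
      moreover have "descending m (chain_insert m a (Node b ts))"
        using True Node.prems by (auto simp: nth_append)
      ultimately show ?thesis using True by (simp add: nth_append)
    next
      case False
      let ?u = "chain_insert m a (ts ! m)"
      have eq: "chain_insert m a (Node b ts) = Node b (ts[m := ?u])" using False len by simp
      have IH: "mset (labels ?u) = add_mset a (mset (labels (ts ! m)))"
        "a \<notin> set (labels (ts ! m)) \<Longrightarrow> descending m ?u"
        "slots_of m ?u \<sigma> = insert (a, \<sigma>) (slots_of m (ts ! m) \<sigma>)"
        "a \<notin> set (labels (ts ! m)) \<Longrightarrow> splice_out m a ?u = ts ! m"
        using Node.IH[of "ts ! m"] ch len by auto
      have sub: "a \<notin> set (labels (Node b ts)) \<Longrightarrow> a \<noteq> b \<and> (\<forall>r\<le>m. a \<notin> set (labels (ts ! r)))"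
        using set_labels_Node[OF len] by auto
      have "mset (labels (Node b (ts[m := ?u]))) = add_mset a (mset (labels (Node b ts)))"
        using mset_labels_update[of m ts ?u a b] IH(1) len by simp
      moreover have "descending m (Node b (ts[m := ?u]))" if "a \<notin> set (labels (Node b ts))"
      proof -
        have "a < b" using False sub[OF that] by auto
        then have "\<forall>c us. ?u = Node c us \<longrightarrow> c < b"
          using Node.prems unfolding root_chain_insert by simp
        then show ?thesis using IH(2) sub[OF that] ch len by (simp add: nth_list_update)
      qed
      moreover have "slots_of m (Node b (ts[m := ?u])) \<sigma> = insert (a, \<sigma>) (slots_of m (Node b ts) \<sigma>)"
        using IH(3) len by (auto simp: slots_of_Node)
      moreover have "splice_out m a (Node b (ts[m := ?u])) = Node b ts" if "a \<notin> set (labels (Node b ts))"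
      proof -
        have "splice_out m a (ts[m := ?u] ! i) = ts ! i" if "i < length ts" for i
          using that IH(4) sub[OF \<open>a \<notin> set (labels (Node b ts))\<close>] len
          by (cases "i = m") (auto simp: splice_out_id less_Suc_eq)
        then have "map (splice_out m a) (ts[m := ?u]) = ts" by (intro nth_equalityI) auto
        then show ?thesis using sub[OF that] by simp
      qed
      ultimately show ?thesis unfolding eq by blast
    qed
  qed
  then show "mset (labels (chain_insert m a t)) = add_mset a (mset (labels t))"
    and "a \<notin> set (labels t) \<Longrightarrow> descending m (chain_insert m a t)"
    and "slots_of m (chain_insert m a t) \<sigma> = insert (a, \<sigma>) (slots_of m t \<sigma>)"
    and "a \<notin> set (labels t) \<Longrightarrow> splice_out m a (chain_insert m a t) = t" by blast+
qed

lemma node_insert_child: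
  assumes "distinct (labels (Node c ts))" "c \<noteq> b" "i < length ts" "b \<in> set (labels (ts ! i))"
  shows "node_insert m a b r (Node c ts) = Node c (ts[i := node_insert m a b r (ts ! i)])"
proof -
  have "b \<notin> set (labels (ts ! j))" if "j < length ts" "j \<noteq> i" for j
    using distinct_labels_children[OF assms(1) that(1) assms(3) that(2)] assms(4) by auto
  then have "map (node_insert m a b r) ts = ts[i := node_insert m a b r (ts ! i)]"
    using assms(3) by (intro nth_equalityI) (auto simp: nth_list_update node_insert_id)
  then show ?thesis using assms(2) by simp
qed

lemma node_insert_props:
  assumes "descending m t" "distinct (labels t)" "b \<in> set (labels t)" "r < m" "a \<notin> set (labels t)"
  shows "mset (labels (node_insert m a b r t)) = add_mset a (mset (labels t)) \<and>
    descending m (node_insert m a b r t) \<and>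
    slots_of m (node_insert m a b r t) \<sigma> = insert (a, Some (b, r)) (slots_of m t \<sigma>) \<and>
    splice_out m a (node_insert m a b r t) = t"
  using assms
proof (induction t arbitrary: \<sigma>)
  case (Node c ts)
  have len: "length ts = Suc m" and ch: "\<And>r. r \<le> m \<Longrightarrow> descending m (ts ! r)" using Node.prems(1) by auto
  have a: "a \<noteq> c" "\<And>i. i \<le> m \<Longrightarrow> a \<notin> set (labels (ts ! i))"
    using Node.prems(5) set_labels_Node[OF len] by auto
  \<comment> \<open>Both cases replace a single child \<open>i\<close> by \<open>u\<close>: at
    \<open>b\<close> itself the child of rank \<open>r\<close>, elsewhere the child whose subtree
    contains \<open>b\<close>. The four claims are then checked once for this replacement.\<close>
  obtain i u where i: "i \<le> m" and ins: "node_insert m a b r (Node c ts) = Node c (ts[i := u])"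
    and u: "mset (labels u) = add_mset a (mset (labels (ts ! i)))" "descending m u"
      "splice_out m a u = ts ! i"
    and root: "i = m \<Longrightarrow> \<forall>d us. u = Node d us \<longrightarrow> d < c"
    and sl: "slots_of m u (if i = m then \<sigma> else Some (c, i)) =
       insert (a, Some (b, r)) (slots_of m (ts ! i) (if i = m then \<sigma> else Some (c, i)))"
  proof (cases "c = b")
    case True
    have r: "r \<le> m" using Node.prems(4) by simp
    show ?thesis
      using chain_insert_props[OF ch[OF r], of a] a(2)[OF r] True Node.prems(4) len
      by (intro that[of r "chain_insert m a (ts ! r)"]) auto
  next
    case False
    then obtain i where i: "i \<le> m" "b \<in> set (labels (ts ! i))"
      using Node.prems(3) unfolding set_labels_Node[OF len] by blast
    have "mset (labels (node_insert m a b r (ts ! i))) = add_mset a (mset (labels (ts ! i))) \<and>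
      descending m (node_insert m a b r (ts ! i)) \<and>
      slots_of m (node_insert m a b r (ts ! i)) \<tau> = insert (a, Some (b, r)) (slots_of m (ts ! i) \<tau>) \<and>
      splice_out m a (node_insert m a b r (ts ! i)) = ts ! i" for \<tau>
      using i len a Node.prems(2,4) distinct_labels_child(1)[OF Node.prems(2)] ch
      by (intro Node.IH) auto
    moreover have "i = m \<Longrightarrow> \<forall>d us. node_insert m a b r (ts ! i) = Node d us \<longrightarrow> d < c"
      using Node.prems(1) unfolding root_node_insert by simp
    ultimately show ?thesis
      using node_insert_child[OF Node.prems(2) False _ i(2)] i len
      by (intro that[of i "node_insert m a b r (ts ! i)"]) auto
  qed
  have "mset (labels (Node c (ts[i := u]))) = add_mset a (mset (labels (Node c ts)))"
    using mset_labels_update[of i ts u a c] u(1) i len by simp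
  moreover have "descending m (Node c (ts[i := u]))"
    using Node.prems(1) i u(2) root len by (cases "i = m") (auto simp: nth_list_update)
  moreover have "slots_of m (Node c (ts[i := u])) \<sigma> = insert (a, Some (b, r)) (slots_of m (Node c ts) \<sigma>)"
  proof (cases "i = m")
    case True
    then show ?thesis using sl len by (auto simp: slots_of_Node)
  next
    case False
    then have im: "i < m" using i by simp
    have split: "(\<Union>r<m. f r) = f i \<union> (\<Union>r\<in>{..<m} - {i}. f r)" for f :: "nat \<Rightarrow> (nat \<times> slot) set"
      using im by auto
    have "(\<Union>r\<in>{..<m} - {i}. slots_of m (ts[i := u] ! r) (Some (c, r)))
        = (\<Union>r\<in>{..<m} - {i}. slots_of m (ts ! r) (Some (c, r)))"
      by (intro SUP_cong) auto
    then show ?thesis using sl len im False by (simp add: slots_of_Node split insert_commute)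
  qed
  moreover have "splice_out m a (Node c (ts[i := u])) = Node c ts"
  proof -
    have "splice_out m a (ts[i := u] ! j) = ts ! j" if "j < length ts" for j
      using that u(3) a(2) len by (cases "j = i") (auto simp: splice_out_id)
    then have "map (splice_out m a) (ts[i := u]) = ts" by (intro nth_equalityI) auto
    then show ?thesis using a(1) by simp
  qed
  ultimately show ?case unfolding ins by blast
qed simp

lemma slot_insert_props:
  assumes "descending m t" "distinct (labels t)" "slot_at m t \<sigma>" "a \<notin> set (labels t)"
  shows "mset (labels (slot_insert m a \<sigma> t)) = add_mset a (mset (labels t))"
    and "descending m (slot_insert m a \<sigma> t)"
    and "slots_of m (slot_insert m a \<sigma> t) None = insert (a, \<sigma>) (slots_of m t None)"
    and "splice_out m a (slot_insert m a \<sigma> t) = t"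
proof -
  have "mset (labels (slot_insert m a \<sigma> t)) = add_mset a (mset (labels t)) \<and>
    descending m (slot_insert m a \<sigma> t) \<and>
    slots_of m (slot_insert m a \<sigma> t) None = insert (a, \<sigma>) (slots_of m t None) \<and>
    splice_out m a (slot_insert m a \<sigma> t) = t"
  proof (cases \<sigma>)
    case None
    then show ?thesis using chain_insert_props[OF assms(1), of a] assms(4) by (simp add: slot_insert_def)
  next
    case (Some p)
    obtain b r where p: "p = (b, r)" by (cases p)
    then have "b \<in> set (labels t)" "r < m" using assms(3) Some by (auto simp: slot_at_def)
    from node_insert_props[OF assms(1,2) this assms(4), of None] show ?thesis
      using Some p by (simp add: slot_insert_def)
  qed
  then show "mset (labels (slot_insert m a \<sigma> t)) = add_mset a (mset (labels t))"
    and "descending m (slot_insert m a \<sigma> t)"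
    and "slots_of m (slot_insert m a \<sigma> t) None = insert (a, \<sigma>) (slots_of m t None)"
    and "splice_out m a (slot_insert m a \<sigma> t) = t" by blast+
qed

text \<open>A node that is not inner has at most its child of rank \<open>m\<close>, so it can be
  spliced out. On the way up, the slot \<open>None\<close> of the subtree of rank \<open>i\<close>
  becomes \<open>Some (b, i)\<close> if \<open>i < m\<close> and stays \<open>None\<close> if
  \<open>i = m\<close>, where the chain continues through the parent \<open>b\<close>.\<close>

lemma slot_insert_surj:
  assumes "descending m t" "distinct (labels t)" "a \<in> set (labels t)" "a \<notin> inner_nodes m t"
  shows "\<exists>t' \<sigma>. descending m t' \<and> slot_at m t' \<sigma> \<and> t = slot_insert m a \<sigma> t' \<and>
    mset (labels t) = add_mset a (mset (labels t'))"
  using assms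
proof (induction t)
  case (Node b ts)
  have len: "length ts = Suc m" and ch: "\<And>r. r \<le> m \<Longrightarrow> descending m (ts ! r)" using Node.prems(1) by auto
  show ?case
  proof (cases "b = a")
    case True
    have "ts ! r = Leaf" if "r < m" for r
      using Node.prems(4) True that unfolding inner_nodes_Node[OF len] by (auto split: if_splits)
    then have "ts = replicate m Leaf @ [ts ! m]"
      using len by (intro nth_equalityI) (auto simp: nth_append less_Suc_eq)
    then obtain u where ts: "ts = replicate m Leaf @ [u]" by blast
    then have "ts ! m = u" by (simp add: nth_append)
    moreover have "Node a ts = chain_insert m a u"
      using Node.prems(1) ts \<open>ts ! m = u\<close> True
      by (cases u) (auto simp: replicate_append_same[symmetric])
    moreover have "descending m u" using ch[of m] \<open>ts ! m = u\<close> by simp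
    ultimately show ?thesis
      using True chain_insert_props(1)[of m u a]
      by (intro exI[of _ u] exI[of _ None]) (auto simp: slot_insert_def slot_at_def)
  next
    case False
    then obtain i where i: "i \<le> m" "a \<in> set (labels (ts ! i))"
      using Node.prems(3) unfolding set_labels_Node[OF len] by blast
    have "a \<notin> inner_nodes m (ts ! i)"
      using Node.prems(4) i(1) unfolding inner_nodes_Node[OF len] by auto
    moreover have il: "i < length ts" using i len by simp
    ultimately obtain u \<sigma> where u: "descending m u" "slot_at m u \<sigma>" "ts ! i = slot_insert m a \<sigma> u"
      "mset (labels (ts ! i)) = add_mset a (mset (labels u))"
      using Node.IH[of "ts ! i"] ch i distinct_labels_child(1)[OF Node.prems(2) il] by auto
    let ?t = "Node b (ts[i := u])"
    have upd: "ts = (ts[i := u])[i := ts ! i]" by simp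
    have ms: "mset (labels (Node b ts)) = add_mset a (mset (labels ?t))"
      using mset_labels_update[of i "ts[i := u]" "ts ! i" a b] il u(4) by simp
    then have dist: "distinct (labels ?t)" and "a \<notin> set (labels ?t)"
      using Node.prems(2) by (metis distinct.simps(2) mset.simps(2) mset_eq_imp_distinct_iff)+
    \<comment> \<open>At rank \<open>m\<close> the descent from \<open>b\<close> must survive the
      removal; and if \<open>a\<close> came from the chain of \<open>b\<close> itself,
      \<open>a < b\<close> makes the insertion into that chain walk past \<open>b\<close>
      again.\<close>
    have root: "\<forall>c us. u = Node c us \<longrightarrow> c < b" "\<sigma> = None \<Longrightarrow> a < b" if "i = m"
    proof -
      have H: "\<forall>c us. slot_insert m a \<sigma> u = Node c us \<longrightarrow> c < b" using Node.prems(1) u(3) that by simp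
      have "(\<forall>c us. u = Node c us \<longrightarrow> c < b) \<and> (\<sigma> = None \<longrightarrow> a < b)"
      proof (cases \<sigma>)
        case None
        then show ?thesis using H unfolding None slot_insert_def option.case root_chain_insert by blast
      next
        case (Some p)
        then show ?thesis
          using H unfolding Some slot_insert_def option.case case_prod_beta root_node_insert by blast
      qed
      then show "\<forall>c us. u = Node c us \<longrightarrow> c < b" "\<sigma> = None \<Longrightarrow> a < b" by blast+
    qed
    have dt: "descending m ?t"
      using Node.prems(1) u(1) root(1) i len by (cases "i = m") (auto simp: nth_list_update)
    have "\<exists>\<tau>. slot_at m ?t \<tau> \<and> Node b ts = slot_insert m a \<tau> ?t"
    proof (cases \<sigma>)
      case None
      then have ui: "ts ! i = chain_insert m a u" using u(3) by (simp add: slot_insert_def)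
      show ?thesis
      proof (cases "i = m")
        case True
        then have "chain_insert m a ?t = Node b ts"
          using root(2) None ui il by (auto simp flip: ui)
        then show ?thesis by (intro exI[of _ None]) (auto simp: slot_at_def slot_insert_def)
      next
        case False
        then have "node_insert m a b i ?t = Node b ts" using ui il by (auto simp flip: ui)
        then show ?thesis using i False
          by (intro exI[of _ "Some (b, i)"]) (auto simp: slot_at_def slot_insert_def)
      qed
    next
      case (Some p)
      obtain c r where p: "p = (c, r)" by (cases p)
      have c: "c \<in> set (labels u)" "r < m" using u(2) Some p unfolding slot_at_def by auto
      have ui: "ts ! i = node_insert m a c r u" using u(3) Some p by (simp add: slot_insert_def)
      have "c \<noteq> b" using distinct_labels_child(2)[OF dist, of i] il c by auto
      moreover have "c \<in> set (labels (ts[i := u] ! i))" using c il by simp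
      ultimately have "node_insert m a c r ?t = Node b ts"
        using node_insert_child[OF dist, of c i] il ui by (metis upd length_list_update list_update_overwrite nth_list_update_eq)
      moreover have "c \<in> set (labels ?t)"
        using set_labels_Node[of "ts[i := u]" m b] len c i il by (auto simp: nth_list_update split: if_splits)
      ultimately show ?thesis using c
        by (intro exI[of _ "Some (c, r)"]) (auto simp: slot_at_def slot_insert_def)
    qed
    then show ?thesis using dt ms by blast
  qed
qed simp

text \<open>Moving on to a node child of rank less than \<open>m\<close> as long as there is one
  ends, by finiteness, at a node that is not inner.\<close>

lemma exists_not_inner:
  assumes "descending m t" "distinct (labels t)" "t \<noteq> Leaf"
  shows "\<exists>a\<in>set (labels t). a \<notin> inner_nodes m t"
  using assms
proof (induction t)
  case (Node a ts)
  have len: "length ts = Suc m" using Node.prems(1) by auto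
  show ?case
  proof (cases "\<exists>r<m. ts ! r \<noteq> Leaf")
    case False
    have "a \<notin> inner_nodes m (ts ! r)" if "r \<le> m" for r
      using distinct_labels_child(2)[OF Node.prems(2), of r] that len inner_nodes_subset[of m "ts ! r"] by auto
    then show ?thesis using False unfolding inner_nodes_Node[OF len] by auto
  next
    case True
    then obtain r where r: "r < m" "ts ! r \<noteq> Leaf" by blast
    have rl: "r < length ts" using r len by simp
    obtain x where x: "x \<in> set (labels (ts ! r))" "x \<notin> inner_nodes m (ts ! r)"
      using Node.IH[of "ts ! r"] r rl Node.prems(1) distinct_labels_child(1)[OF Node.prems(2) rl] by auto
    have "x \<notin> inner_nodes m (ts ! s)" if "s \<le> m" for s
      using distinct_labels_children[OF Node.prems(2) rl, of s] x that len inner_nodes_subset[of m "ts ! s"]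
      by (cases "s = r") auto
    moreover have "x \<noteq> a" using distinct_labels_child(2)[OF Node.prems(2) rl] x by auto
    ultimately show ?thesis
      using x r unfolding inner_nodes_Node[OF len] set_labels_Node[OF len]
      by (intro bexI[of _ x]) (auto intro!: exI[of _ r])
  qed
qed simp

section \<open>Counting descending trees with prescribed nodes that are not inner\<close>

definition descending_trees :: "nat \<Rightarrow> nat set \<Rightarrow> nat ptree set" where
  "descending_trees m N = {t. descending m t \<and> distinct (labels t) \<and> set (labels t) = N}"

definition slots :: "nat \<Rightarrow> nat set \<Rightarrow> slot set" where
  "slots m N = insert None (Some ` (N \<times> {..<m}))"

lemma card_slots: "finite N \<Longrightarrow> card (slots m N) = m * card N + 1"
  unfolding slots_def
  by (subst card_insert_disjoint) (auto simp: card_image card_cartesian_product)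

lemma finite_slots: "finite N \<Longrightarrow> finite (slots m N)"
  unfolding slots_def by simp

lemma slot_at_iff: "slot_at m t \<sigma> \<longleftrightarrow> \<sigma> \<in> slots m (set (labels t))"
  unfolding slot_at_def slots_def by (cases \<sigma>) auto

lemma inner_nodes_slots_of: "descending m t \<Longrightarrow> inner_nodes m t = owners (slots_of m t None)"
  using owners_slots_of[of m t None] by (cases "t = Leaf") auto

lemma slot_insert_in_trees:
  assumes "t \<in> descending_trees m N" "a \<notin> N" "\<sigma> \<in> slots m N"
  shows "slot_insert m a \<sigma> t \<in> descending_trees m (insert a N)"
    and "inner_nodes m (slot_insert m a \<sigma> t) = inner_nodes m t \<union> fst ` set_option \<sigma>"
proof -
  have t: "descending m t" "distinct (labels t)" "set (labels t) = N" "slot_at m t \<sigma>"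
    using assms unfolding descending_trees_def slot_at_iff by auto
  note p = slot_insert_props[OF t(1,2,4), of a]
  have "mset (labels (slot_insert m a \<sigma> t)) = mset (a # labels t)" using p(1) assms(2) t(3) by simp
  then show "slot_insert m a \<sigma> t \<in> descending_trees m (insert a N)"
    using p(2) t assms(2) mset_eq_setD[of _ "a # labels t"] mset_eq_imp_distinct_iff[of _ "a # labels t"]
    unfolding descending_trees_def by auto
  show "inner_nodes m (slot_insert m a \<sigma> t) = inner_nodes m t \<union> fst ` set_option \<sigma>"
    using p(2,3) t assms(2) by (auto simp: inner_nodes_slots_of owners_simps)
qed

lemma slot_insert_obtain:
  assumes "t \<in> descending_trees m N" "a \<in> N" "a \<notin> inner_nodes m t"
  obtains t' \<sigma> where "t' \<in> descending_trees m (N - {a})" "\<sigma> \<in> slots m (N - {a})" "t = slot_insert m a \<sigma> t'"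
proof -
  obtain t' \<sigma> where t': "descending m t'" "slot_at m t' \<sigma>" "t = slot_insert m a \<sigma> t'"
    and ms: "mset (labels t) = mset (a # labels t')"
    using slot_insert_surj[of m t a] assms unfolding descending_trees_def by auto
  then have "distinct (a # labels t')" "set (a # labels t') = N"
    using assms(1) mset_eq_setD[OF ms] mset_eq_imp_distinct_iff[OF ms] unfolding descending_trees_def by auto
  then have "t' \<in> descending_trees m (N - {a})" "\<sigma> \<in> slots m (N - {a})"
    using t' unfolding descending_trees_def slot_at_iff by auto
  then show ?thesis using t'(3) that by blast
qed

lemma descending_trees_empty: "descending_trees m {} = {Leaf}"
  unfolding descending_trees_def by (auto simp: labels_eq_Nil_iff)

lemma descending_trees_not_inner:
  assumes "t \<in> descending_trees m N" "N \<noteq> {}"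
  shows "\<exists>a\<in>N. a \<notin> inner_nodes m t"
  using exists_not_inner[of m t] assms unfolding descending_trees_def by (cases "t = Leaf") auto

lemma finite_descending_trees: "finite N \<Longrightarrow> finite (descending_trees m N)"
proof (induction "card N" arbitrary: N)
  case 0
  then show ?case by (simp add: descending_trees_empty)
next
  case (Suc n)
  have "descending_trees m N \<subseteq>
      (\<Union>a\<in>N. (\<lambda>(t, \<sigma>). slot_insert m a \<sigma> t) ` (descending_trees m (N - {a}) \<times> slots m (N - {a})))"
  proof
    fix t assume t: "t \<in> descending_trees m N"
    have "N \<noteq> {}" using Suc.hyps(2) by auto
    then obtain a where a: "a \<in> N" "a \<notin> inner_nodes m t" using descending_trees_not_inner[OF t] by blast
    obtain t' \<sigma> where "t' \<in> descending_trees m (N - {a})" "\<sigma> \<in> slots m (N - {a})" "t = slot_insert m a \<sigma> t'"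
      using slot_insert_obtain[OF t a] .
    then show "t \<in> (\<Union>a\<in>N. (\<lambda>(t, \<sigma>). slot_insert m a \<sigma> t) ` (descending_trees m (N - {a}) \<times> slots m (N - {a})))"
      by (intro UN_I[OF a(1)] image_eqI[of _ _ "(t', \<sigma>)"]) auto
  qed
  moreover have "finite (descending_trees m (N - {a}) \<times> slots m (N - {a}))" if "a \<in> N" for a
    using Suc that by (intro finite_cartesian_product finite_slots Suc.hyps(1)) auto
  ultimately show ?case using Suc.prems by (meson finite_UN_I finite_imageI finite_subset)
qed

text \<open>Inserting \<open>a\<close> makes the owner of its slot inner and affects no other node,
  so exactly the slots with no owner in \<open>L\<close> are allowed. \<open>splice_out\<close>
  recovers the tree, and \<open>slots_of\<close> recovers the slot because \<open>a\<close> did not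
  occur before.\<close>

lemma card_descending_trees_leaf:
  assumes N: "finite N" and L: "L \<subseteq> N" "a \<in> L"
  shows "card {t\<in>descending_trees m N. inner_nodes m t \<inter> L = {}} = (m * (card N - card L) + 1) *
    card {t\<in>descending_trees m (N - {a}). inner_nodes m t \<inter> (L - {a}) = {}}"
proof -
  define Y where "Y = {t\<in>descending_trees m (N - {a}). inner_nodes m t \<inter> (L - {a}) = {}}"
  define Z where "Z = {t\<in>descending_trees m N. inner_nodes m t \<inter> L = {}}"
  define \<phi> where "\<phi> = (\<lambda>(t, \<sigma>). slot_insert m a \<sigma> t)"
  have aN: "a \<in> N" "insert a (N - {a}) = N" using L by auto
  have sl: "slots m (N - L) \<subseteq> slots m (N - {a})" using L unfolding slots_def by auto
  have props: "splice_out m a (slot_insert m a \<sigma> t) = t"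
    "slots_of m (slot_insert m a \<sigma> t) None = insert (a, \<sigma>) (slots_of m t None)"
    "(a, \<tau>) \<notin> slots_of m t None"
    if "t \<in> Y" "\<sigma> \<in> slots m (N - L)" for t \<sigma> \<tau>
  proof -
    have t: "descending m t" "distinct (labels t)" "set (labels t) = N - {a}" "slot_at m t \<sigma>"
      using that sl unfolding Y_def descending_trees_def slot_at_iff by auto
    then show "splice_out m a (slot_insert m a \<sigma> t) = t"
      "slots_of m (slot_insert m a \<sigma> t) None = insert (a, \<sigma>) (slots_of m t None)"
      using slot_insert_props[OF t(1,2,4), of a] by auto
    show "(a, \<tau>) \<notin> slots_of m t None" using slots_of_labels[of a \<tau> m t None] t by auto
  qed
  have "inj_on \<phi> (Y \<times> slots m (N - L))"
  proof (rule inj_onI)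
    fix x x' assume A: "x \<in> Y \<times> slots m (N - L)" "x' \<in> Y \<times> slots m (N - L)" "\<phi> x = \<phi> x'"
    obtain t \<sigma> t' \<sigma>' where x: "x = (t, \<sigma>)" "x' = (t', \<sigma>')" by (cases x; cases x')
    have t: "t = t'" using A props(1) unfolding x \<phi>_def by auto metis
    have "insert (a, \<sigma>) (slots_of m t None) = insert (a, \<sigma>') (slots_of m t None)"
      using A props(2)[of t \<sigma>] props(2)[of t' \<sigma>'] t unfolding x \<phi>_def by auto
    then have "\<sigma> = \<sigma>'" using props(3)[of t \<sigma>] A unfolding x by (metis Pair_inject insertE insertI1 mem_Sigma_iff)
    then show "x = x'" using t x by simp
  qed
  moreover have "\<phi> ` (Y \<times> slots m (N - L)) = Z"
  proof
    show "\<phi> ` (Y \<times> slots m (N - L)) \<subseteq> Z"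
    proof
      fix x assume "x \<in> \<phi> ` (Y \<times> slots m (N - L))"
      then obtain t \<sigma> where A: "t \<in> Y" "\<sigma> \<in> slots m (N - L)" and x: "x = slot_insert m a \<sigma> t"
        unfolding \<phi>_def by auto
      have t: "t \<in> descending_trees m (N - {a})" "inner_nodes m t \<inter> (L - {a}) = {}"
        using A unfolding Y_def by auto
      have \<sigma>: "\<sigma> \<in> slots m (N - {a})" using A sl by auto
      note p = slot_insert_in_trees[OF t(1) _ \<sigma>, of a]
      have "inner_nodes m t \<subseteq> N - {a}" using inner_nodes_subset[of m t] t unfolding descending_trees_def by auto
      moreover have "fst ` set_option \<sigma> \<inter> L = {}" using A(2) unfolding slots_def by auto
      ultimately show "x \<in> Z" using p t(2) aN unfolding Z_def x by auto
    qed
    show "Z \<subseteq> \<phi> ` (Y \<times> slots m (N - L))"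
    proof
      fix t assume "t \<in> Z"
      then have t: "t \<in> descending_trees m N" "inner_nodes m t \<inter> L = {}" unfolding Z_def by auto
      then obtain t' \<sigma> where t': "t' \<in> descending_trees m (N - {a})" "\<sigma> \<in> slots m (N - {a})" "t = slot_insert m a \<sigma> t'"
        using slot_insert_obtain[OF t(1) aN(1)] L by blast
      then have "inner_nodes m t = inner_nodes m t' \<union> fst ` set_option \<sigma>"
        using slot_insert_in_trees(2)[OF t'(1) _ t'(2), of a] by auto
      then have "t' \<in> Y" "\<sigma> \<in> slots m (N - L)"
        using t t' unfolding Y_def slots_def by auto
      then show "t \<in> \<phi> ` (Y \<times> slots m (N - L))" using t'(3) unfolding \<phi>_def by force
    qed
  qed
  ultimately have "card Z = card (Y \<times> slots m (N - L))" by (metis card_image)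
  moreover have "card (slots m (N - L)) = m * (card N - card L) + 1"
    using card_slots[of "N - L" m] N L finite_subset[OF L(1)] by (simp add: card_Diff_subset)
  ultimately show ?thesis unfolding Y_def Z_def by (simp add: card_cartesian_product mult.commute)
qed

lemma card_U_set:
  assumes "k \<le> n"
  shows "finite (U_set m n k)" "int (card (U_set m n k)) = face_number m n k"
proof -
  let ?N = "{1..n}" and ?X = "descending_trees m" and ?I = "inner_nodes m"
  have U: "U_set m n k = {(x, S). x \<in> ?X ?N \<and> S \<subseteq> ?N \<and> card S = n - k \<and> S \<subseteq> ?I x}"
    unfolding U_set_def descending_trees_def descending_iff inner_nodes_def by blast
  have fX: "finite (?X ?N)" by (rule finite_descending_trees) auto
  then have "finite (?X ?N \<times> Pow ?N)" by auto
  then show "finite (U_set m n k)" by (rule rev_finite_subset) (auto simp: U)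
  show "int (card (U_set m n k)) = face_number m n k"
    unfolding U
  proof (rule card_marked[OF fX])
    fix L assume L: "L \<subseteq> ?N"
    have "card {x\<in>?X ?N. ?I x \<inter> L = {}} = (m * (card ?N - card L) + 1) ^ (card ?N - 1)"
    proof (rule card_prescribed_leaves[where A = ?N])
      fix N x assume "N \<subseteq> ?N" "N \<noteq> {}" "x \<in> ?X N"
      then show "\<not> N \<subseteq> ?I x" using descending_trees_not_inner by blast
    next
      fix N M a assume "N \<subseteq> ?N" "M \<subseteq> N" "a \<in> M"
      moreover have "finite N" using \<open>N \<subseteq> ?N\<close> finite_subset by fastforce
      ultimately show "card {x\<in>?X N. ?I x \<inter> M = {}} =
          (m * (card N - card M) + 1) * card {x\<in>?X (N - {a}). ?I x \<inter> (M - {a}) = {}}"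
        by (intro card_descending_trees_leaf)
    qed (use L finite_subset in \<open>auto simp: descending_trees_empty intro!: finite_descending_trees\<close>)
    then show "card {x\<in>?X ?N. ?I x \<inter> L = {}} = (m * (n - card L) + 1) ^ (n - 1)" by simp
  qed (use assms in auto)
qed

section \<open>Decorated trees\<close>

lemma internal_edges_root_iff:
  assumes "distinct (labels (Node a ts))"
  shows "(a, r, b) \<in> internal_edges (Node a ts) \<longleftrightarrow> r < length ts \<and> (\<exists>us. ts ! r = Node b us)"
proof -
  have "(a, r, b) \<notin> internal_edges t" if "t \<in> set ts" for t
  proof
    assume "(a, r, b) \<in> internal_edges t"
    then have "a \<in> set (labels t)" using internal_edges_labels by fast
    then show False using assms that by auto
  qed
  then show ?thesis by (auto simp: internal_edges_Node)
qed

lemma internal_edges_child_iff: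
  assumes "distinct (labels (Node a ts))" "i < length ts" "x \<in> set (labels (ts ! i))"
  shows "(x, r, b) \<in> internal_edges (Node a ts) \<longleftrightarrow> (x, r, b) \<in> internal_edges (ts ! i)"
proof
  assume "(x, r, b) \<in> internal_edges (Node a ts)"
  moreover have "x \<noteq> a" using distinct_labels_child(2)[OF assms(1,2)] assms(3) by auto
  ultimately obtain j where j: "j < length ts" "(x, r, b) \<in> internal_edges (ts ! j)"
    by (auto simp: internal_edges_Node in_set_conv_nth)
  then have "x \<in> set (labels (ts ! j))" using internal_edges_labels by fast
  then have "j = i" using distinct_labels_children[OF assms(1) j(1) assms(2)] assms(3) by auto
  then show "(x, r, b) \<in> internal_edges (ts ! i)" using j by simp
next
  assume "(x, r, b) \<in> internal_edges (ts ! i)"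
  then show "(x, r, b) \<in> internal_edges (Node a ts)" using assms(2) nth_mem by (fastforce simp: internal_edges_Node)
qed

lemma internal_edges_unique_child:
  assumes "distinct (labels t)" "(a, r, b) \<in> internal_edges t" "(a, r, c) \<in> internal_edges t"
  shows "b = c"
  using assms
proof (induction t)
  case (Node d ts)
  show ?case
  proof (cases "a = d")
    case True
    then show ?thesis using Node.prems internal_edges_root_iff[OF Node.prems(1)] by auto
  next
    case False
    then obtain t where "t \<in> set ts" "a \<in> set (labels t)"
      using internal_edges_labels[OF Node.prems(2)] by auto
    then obtain i where i: "i < length ts" "a \<in> set (labels (ts ! i))" by (metis in_set_conv_nth)
    then show ?thesis
      using Node.IH[of "ts ! i"] Node.prems internal_edges_child_iff[OF Node.prems(1) i]
        distinct_labels_child(1)[OF Node.prems(1) i(1)] by auto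
  qed
qed simp

lemma internal_edges_child_in_children:
  assumes "(x, r, b) \<in> internal_edges (Node a ts)"
  obtains i where "i < length ts" "b \<in> set (labels (ts ! i))"
    "(x, r, b) \<in> internal_edges (ts ! i) \<or> (x = a \<and> i = r \<and> (\<exists>us. ts ! r = Node b us))"
proof -
  consider us where "x = a" "r < length ts" "ts ! r = Node b us"
    | i where "i < length ts" "(x, r, b) \<in> internal_edges (ts ! i)"
    using assms by (auto simp: internal_edges_Node in_set_conv_nth)
  then show ?thesis
  proof cases
    case 1
    then show ?thesis using that[of r] by auto
  next
    case 2
    then show ?thesis using that[of i] internal_edges_labels[OF 2(2)] by blast
  qed
qed

lemma internal_edges_unique_parent:
  assumes "distinct (labels t)" "(a, r, b) \<in> internal_edges t" "(c, s, b) \<in> internal_edges t"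
  shows "a = c \<and> r = s"
  using assms
proof (induction t)
  case (Node d ts)
  obtain i where i: "i < length ts" "b \<in> set (labels (ts ! i))"
    "(a, r, b) \<in> internal_edges (ts ! i) \<or> (a = d \<and> i = r \<and> (\<exists>us. ts ! r = Node b us))"
    using internal_edges_child_in_children[OF Node.prems(2)] .
  obtain j where j: "j < length ts" "b \<in> set (labels (ts ! j))"
    "(c, s, b) \<in> internal_edges (ts ! j) \<or> (c = d \<and> j = s \<and> (\<exists>us. ts ! s = Node b us))"
    using internal_edges_child_in_children[OF Node.prems(3)] .
  have ij: "i = j" using distinct_labels_children[OF Node.prems(1) i(1) j(1)] i(2) j(2) by auto
  have dist: "distinct (labels (ts ! i))" using distinct_labels_child(1)[OF Node.prems(1) i(1)] .
  have no: "(x, q, b) \<notin> internal_edges (ts ! i)" if "ts ! i = Node b us" for x q us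
  proof
    assume "(x, q, b) \<in> internal_edges (ts ! i)"
    then obtain l where "l < length us" "b \<in> set (labels (us ! l))"
      using internal_edges_child_in_children[of x q b b us] unfolding \<open>ts ! i = Node b us\<close> by blast
    then show False using distinct_labels_child(2)[of b us l] dist that by auto
  qed
  show ?case
    using i(3) j(3) Node.IH[of "ts ! i"] dist no i(1) unfolding ij by (metis nth_mem)
qed simp

text \<open>One recursion for both families: \<open>P\<close> says which ranks may justify a mark
  (positive ranks, where cadets live, for \<open>T_set\<close>; ranks below \<open>m\<close> for
  \<open>U_set\<close>), \<open>Q\<close> is the descent condition at rank \<open>m\<close>, and
  \<open>M\<close> is the set of marked nodes.\<close>

fun good_tree :: "nat \<Rightarrow> (nat \<Rightarrow> bool) \<Rightarrow> ('a \<Rightarrow> 'a \<Rightarrow> bool) \<Rightarrow> 'a set \<Rightarrow> 'a ptree \<Rightarrow> bool" where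
  "good_tree m P Q M Leaf \<longleftrightarrow> True"
| "good_tree m P Q M (Node a ts) \<longleftrightarrow> length ts = Suc m \<and> (\<forall>t\<in>set ts. good_tree m P Q M t) \<and>
     (\<forall>b us. ts ! m = Node b us \<longrightarrow> Q a b) \<and> (a \<in> M \<longrightarrow> (\<exists>r\<le>m. P r \<and> ts ! r \<noteq> Leaf))"

lemma good_tree_iff:
  assumes "distinct (labels t)"
  shows "good_tree m P Q M t \<longleftrightarrow> ary (m + 1) t \<and> (\<forall>(a, r, b)\<in>internal_edges t. r = m \<longrightarrow> Q a b) \<and>
    (\<forall>a\<in>M \<inter> set (labels t). \<exists>r b. (a, r, b) \<in> internal_edges t \<and> P r)"
  using assms
proof (induction t)
  case (Node a ts)
  show ?case
  proof (cases "length ts = Suc m")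
    case True
    have IH: "good_tree m P Q M t \<longleftrightarrow> ary (m + 1) t \<and> (\<forall>(a, r, b)\<in>internal_edges t. r = m \<longrightarrow> Q a b) \<and>
        (\<forall>a\<in>M \<inter> set (labels t). \<exists>r b. (a, r, b) \<in> internal_edges t \<and> P r)" if "t \<in> set ts" for t
      using Node.IH[OF that] Node.prems that by (auto simp: distinct_concat_iff)
    have "(\<forall>(a', r, b)\<in>{(a, r, b) |r b us. r < length ts \<and> ts ! r = Node b us}. r = m \<longrightarrow> Q a' b) \<longleftrightarrow>
        (\<forall>b us. ts ! m = Node b us \<longrightarrow> Q a b)"
      using True by fastforce
    then have Q: "(\<forall>(a', r, b)\<in>internal_edges (Node a ts). r = m \<longrightarrow> Q a' b) \<longleftrightarrow>
        (\<forall>b us. ts ! m = Node b us \<longrightarrow> Q a b) \<and> (\<forall>t\<in>set ts. \<forall>(a, r, b)\<in>internal_edges t. r = m \<longrightarrow> Q a b)"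
      unfolding internal_edges_Node ball_Un ball_UN by simp
    have root: "(\<exists>r b. (a, r, b) \<in> internal_edges (Node a ts) \<and> P r) \<longleftrightarrow> (\<exists>r\<le>m. P r \<and> ts ! r \<noteq> Leaf)"
      unfolding internal_edges_root_iff[OF Node.prems] ptree_neq_Leaf True by (auto simp: less_Suc_eq_le)
    have child: "(\<exists>r b. (x, r, b) \<in> internal_edges (Node a ts) \<and> P r) \<longleftrightarrow>
        (\<exists>r b. (x, r, b) \<in> internal_edges t \<and> P r)" if t: "t \<in> set ts" "x \<in> set (labels t)" for x t
    proof -
      obtain i where "i < length ts" "ts ! i = t" using t(1) by (auto simp: in_set_conv_nth)
      then show ?thesis using internal_edges_child_iff[OF Node.prems, of i x] t(2) by auto
    qed
    have "(\<forall>x\<in>M \<inter> set (labels (Node a ts)). \<exists>r b. (x, r, b) \<in> internal_edges (Node a ts) \<and> P r) \<longleftrightarrow>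
        (a \<in> M \<longrightarrow> (\<exists>r b. (a, r, b) \<in> internal_edges (Node a ts) \<and> P r)) \<and>
        (\<forall>t\<in>set ts. \<forall>x\<in>M \<inter> set (labels t). \<exists>r b. (x, r, b) \<in> internal_edges (Node a ts) \<and> P r)"
      by auto
    also have "\<dots> \<longleftrightarrow> (a \<in> M \<longrightarrow> (\<exists>r\<le>m. P r \<and> ts ! r \<noteq> Leaf)) \<and>
        (\<forall>t\<in>set ts. \<forall>x\<in>M \<inter> set (labels t). \<exists>r b. (x, r, b) \<in> internal_edges t \<and> P r)"
      unfolding root by (intro arg_cong2[where f = "(\<and>)"] refl ball_cong child) auto
    finally show ?thesis
      unfolding good_tree.simps Q ary.simps using IH True by auto
  qed simp
qed simp

lemma cadet_edges_iff:
  assumes "ary (m + 1) t"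
  shows "(\<exists>r b. (a, r, b) \<in> cadet_edges t) \<longleftrightarrow> (\<exists>r b. (a, r, b) \<in> internal_edges t \<and> 0 < r)"
proof
  assume "\<exists>r b. (a, r, b) \<in> internal_edges t \<and> 0 < r"
  then obtain r0 where r0: "\<exists>b. (a, r0, b) \<in> internal_edges t" "0 < r0" by blast
  have "r \<le> m" if "(a, r, b) \<in> internal_edges t" for a r b
    using that assms
  proof (induction t)
    case (Node c ts)
    then show ?case by (auto simp: internal_edges_Node less_Suc_eq_le)
  qed simp
  then obtain r where r: "\<exists>b. (a, r, b) \<in> internal_edges t" "\<And>s. \<exists>b. (a, s, b) \<in> internal_edges t \<Longrightarrow> s \<le> r"
    using ex_has_greatest_nat[of "\<lambda>r. \<exists>b. (a, r, b) \<in> internal_edges t" r0 id "Suc m"] r0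
    by (metis id_apply le_imp_less_Suc)
  have "r > 0" using r(2)[of r0] r0 by auto
  then show "\<exists>r b. (a, r, b) \<in> cadet_edges t" using r unfolding cadet_edges_def by blast
qed (auto simp: cadet_edges_def)

text \<open>A node has at most one cadet edge, so a set of dashed edges amounts to the set
  \<open>M\<close> of their parents. The marks then sit on parents as in \<open>U_set\<close>, and
  free nodes are counted by unmarked ones.\<close>

definition T_marked :: "nat \<Rightarrow> nat \<Rightarrow> nat \<Rightarrow> (nat set ptree \<times> nat set set) set" where
  "T_marked m n k = {(t, M). good_tree m (\<lambda>r. 0 < r) (\<lambda>A B. Max A > Min B) M t \<and> distinct (labels t) \<and>
     partition_on {1..n} (set (labels t)) \<and> M \<subseteq> set (labels t) \<and> card (set (labels t) - M) = k}"

lemma cadet_edges_unique: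
  assumes "distinct (labels t)" "e \<in> cadet_edges t" "e' \<in> cadet_edges t" "fst e = fst e'"
  shows "e = e'"
proof -
  obtain a r b r' b' where e: "e = (a, r, b)" "e' = (a, r', b')"
    using assms(4) by (metis prod.collapse)
  have E: "(a, r, b) \<in> internal_edges t" "(a, r', b') \<in> internal_edges t"
    and max: "\<And>s c. (a, s, c) \<in> internal_edges t \<Longrightarrow> s \<le> r" "\<And>s c. (a, s, c) \<in> internal_edges t \<Longrightarrow> s \<le> r'"
    using assms(2,3) unfolding e cadet_edges_def by blast+
  have "r = r'" using max(1)[OF E(2)] max(2)[OF E(1)] by simp
  then show ?thesis using internal_edges_unique_child[OF assms(1)] E unfolding e by blast
qed

text \<open>A dashed edge is determined by its child, since parents are unique, and by its parent,
  since cadets are unique; so there are as many captive nodes as parents of dashed edges.\<close>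

lemma card_free_nodes:
  assumes "distinct (labels t)" "D \<subseteq> cadet_edges t"
  shows "card (free_nodes t D) = card (set (labels t) - fst ` D)"
proof -
  have DE: "D \<subseteq> internal_edges t" using assms(2) unfolding cadet_edges_def by auto
  have cap: "captive_nodes D = (\<lambda>e. snd (snd e)) ` D"
    unfolding captive_nodes_def by force
  have sub1: "captive_nodes D \<subseteq> set (labels t)" and sub2: "fst ` D \<subseteq> set (labels t)"
    using DE internal_edges_labels unfolding captive_nodes_def by fastforce+
  have "inj_on (\<lambda>e. snd (snd e)) D"
  proof (rule inj_onI)
    fix e e' assume "e \<in> D" "e' \<in> D" "snd (snd e) = snd (snd e')"
    then show "e = e'"
      using DE internal_edges_unique_parent[OF assms(1), of "fst e" "fst (snd e)" "snd (snd e)" "fst e'" "fst (snd e')"]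
      by (metis prod.collapse subsetD)
  qed
  then have "card (captive_nodes D) = card D" unfolding cap by (rule card_image)
  moreover have "card (fst ` D) = card D"
    by (intro card_image inj_onI) (meson assms cadet_edges_unique subsetD)
  ultimately show ?thesis
    using sub1 sub2 unfolding free_nodes_def by (simp add: card_Diff_subset finite_subset)
qed

lemma T_set_eqpoll_T_marked: "T_set m n k \<approx> T_marked m n k"
proof -
  define \<phi> :: "nat set ptree \<times> (nat set \<times> nat \<times> nat set) set \<Rightarrow> nat set ptree \<times> nat set set"
    where "\<phi> = (\<lambda>(t, D). (t, fst ` D))"
  define \<psi> where "\<psi> = (\<lambda>(t :: nat set ptree, M). (t, {e\<in>cadet_edges t. fst e \<in> M}))"
  have "bij_betw \<phi> (T_set m n k) (T_marked m n k)"
  proof (rule bij_betw_byWitness[where f' = \<psi>])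
    show "\<forall>x\<in>T_set m n k. \<psi> (\<phi> x) = x"
    proof
      fix x assume x: "x \<in> T_set m n k"
      obtain t D where tD: "x = (t, D)" by (cases x)
      have t: "distinct (labels t)" "D \<subseteq> cadet_edges t"
        using x unfolding tD T_set_def decorated_trees_def by auto
      have "e \<in> D" if e: "e \<in> cadet_edges t" "fst e \<in> fst ` D" for e
      proof -
        obtain e' where "e' \<in> D" "fst e = fst e'" using e(2) by auto
        then show ?thesis using cadet_edges_unique[OF t(1) e(1), of e'] t(2) by auto
      qed
      then have "{e\<in>cadet_edges t. fst e \<in> fst ` D} = D" using t(2) by auto
      then show "\<psi> (\<phi> x) = x" unfolding tD \<phi>_def \<psi>_def by simp
    qed
    have fst\<psi>: "fst ` {e\<in>cadet_edges t. fst e \<in> M} = M" if "(t, M) \<in> T_marked m n k" for t M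
    proof -
      have "\<exists>r B. (A, r, B) \<in> cadet_edges t" if "A \<in> M" for A
        using \<open>(t, M) \<in> T_marked m n k\<close> that good_tree_iff[of t m "\<lambda>r. 0 < r" "\<lambda>A B. Max A > Min B" M]
          cadet_edges_iff[of m t A] unfolding T_marked_def by blast
      then show ?thesis by force
    qed
    then show "\<forall>y\<in>T_marked m n k. \<phi> (\<psi> y) = y" unfolding \<phi>_def \<psi>_def by auto
    show "\<phi> ` T_set m n k \<subseteq> T_marked m n k"
    proof
      fix y assume "y \<in> \<phi> ` T_set m n k"
      then obtain t D where y: "y = (t, fst ` D)" and tD: "(t, D) \<in> T_set m n k" unfolding \<phi>_def by auto
      have t: "ary (m + 1) t" "distinct (labels t)" "partition_on {1..n} (set (labels t))" "D \<subseteq> cadet_edges t"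
        "\<forall>(A, r, B)\<in>internal_edges t. r = m \<longrightarrow> Max A > Min B" "card (free_nodes t D) = k"
        using tD unfolding T_set_def decorated_trees_def by auto
      have "\<forall>A\<in>fst ` D. \<exists>r B. (A, r, B) \<in> internal_edges t \<and> 0 < r"
        using t(4) unfolding cadet_edges_def by fastforce
      moreover have "fst ` D \<subseteq> set (labels t)"
        using t(4) internal_edges_labels unfolding cadet_edges_def by fastforce
      ultimately show "y \<in> T_marked m n k"
        using t card_free_nodes[OF t(2,4)] unfolding y T_marked_def by (auto simp: good_tree_iff[OF t(2)])
    qed
    show "\<psi> ` T_marked m n k \<subseteq> T_set m n k"
    proof
      fix y assume "y \<in> \<psi> ` T_marked m n k"
      then obtain t M where tM: "(t, M) \<in> T_marked m n k" and y: "y = (t, {e\<in>cadet_edges t. fst e \<in> M})"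
        unfolding \<psi>_def by auto
      have t: "distinct (labels t)" and g: "good_tree m (\<lambda>r. 0 < r) (\<lambda>A B. Max A > Min B) M t"
        using tM unfolding T_marked_def by auto
      have "card (free_nodes t {e\<in>cadet_edges t. fst e \<in> M}) = card (set (labels t) - M)"
        using card_free_nodes[OF t, of "{e\<in>cadet_edges t. fst e \<in> M}"] fst\<psi>[OF tM] by simp
      then show "y \<in> T_set m n k"
        using tM g unfolding y T_set_def decorated_trees_def T_marked_def good_tree_iff[OF t] by auto
    qed
  qed
  then show ?thesis unfolding eqpoll_def by blast
qed


text \<open>A block \<open>a\<^sub>1 < \<dots> < a\<^sub>p\<close> is unfolded to a path of edges of rank 0 in which all nodes but
  the last one are marked; the last one takes over the children of the block and is marked iff
  the cadet edge is dashed. Only if the cadet is then the only child and has rank \<open>m\<close>, the mark has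
  no witness among the children of rank less than \<open>m\<close>; the child is then moved to rank 0. It can be
  moved back: inside a block the child of rank 0 carries a larger label than its parent, whereas
  an edge of rank \<open>m\<close> is a descent.\<close>

primrec rank0_path :: "nat \<Rightarrow> 'a list \<Rightarrow> 'a ptree list \<Rightarrow> 'a ptree" where
  "rank0_path m [] us = Leaf"
| "rank0_path m (a # xs) us = Node a (if xs = [] then us else rank0_path m xs us # replicate m Leaf)"

definition move_last :: "nat \<Rightarrow> bool \<Rightarrow> 'a ptree list \<Rightarrow> 'a ptree list" where
  "move_last m d us = (if d \<and> (\<forall>r<m. us ! r = Leaf) then us ! m # replicate m Leaf else us)"

primrec unfold_blocks :: "nat \<Rightarrow> nat set set \<Rightarrow> nat set ptree \<Rightarrow> nat ptree" where
  "unfold_blocks m M Leaf = Leaf"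
| "unfold_blocks m M (Node A ts) =
     rank0_path m (sorted_list_of_set A) (move_last m (A \<in> M) (map (unfold_blocks m M) ts))"

text \<open>At this point the child of rank 0 is already a merged block \<open>B\<close>, whose
  minimum was the label of that child in the unfolded tree; this is the label to compare with
  \<open>a\<close>.\<close>

definition merge_root :: "nat \<Rightarrow> nat set \<Rightarrow> nat \<Rightarrow> nat set ptree list \<Rightarrow> nat set ptree" where
  "merge_root m M a us = (if a \<in> M \<and> (\<forall>r\<in>{1..m}. us ! r = Leaf)
     then case us ! 0 of Leaf \<Rightarrow> Node {a} us
       | Node B vs \<Rightarrow> if a < Min B then Node (insert a B) vs else Node {a} (replicate m Leaf @ [us ! 0])
     else Node {a} us)"

primrec merge_blocks :: "nat \<Rightarrow> nat set \<Rightarrow> nat ptree \<Rightarrow> nat set ptree" where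
  "merge_blocks m M Leaf = Leaf"
| "merge_blocks m M (Node a ts) = merge_root m M a (map (merge_blocks m M) ts)"

text \<open>A multiset, since its equality with \<open>mset (labels s)\<close> translates
  distinctness of single labels into distinctness and disjointness of blocks; see
  \<open>distinct_blocks_iff\<close>.\<close>

definition block_elements :: "nat set ptree \<Rightarrow> nat multiset" where
  "block_elements t = (\<Sum>A\<in>#mset (labels t). mset_set A)"

lemma block_elements_Leaf [simp]: "block_elements Leaf = {#}"
  by (simp add: block_elements_def)

lemma block_elements_Node:
  "block_elements (Node A ts) = mset_set A + (\<Sum>r<length ts. block_elements (ts ! r))"
proof -
  have "(\<Sum>B\<in>#(\<Sum>r<n. f r). mset_set B) = (\<Sum>r<n. \<Sum>B\<in>#f r. mset_set B)"
    for n :: nat and f :: "nat \<Rightarrow> nat set multiset"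
    by (induction n) auto
  then show ?thesis unfolding block_elements_def mset_labels_Node by simp
qed

abbreviation good_T :: "nat \<Rightarrow> nat set set \<Rightarrow> nat set ptree \<Rightarrow> bool" where
  "good_T m \<equiv> good_tree m (\<lambda>r. 0 < r) (\<lambda>A B. Max A > Min B)"

abbreviation good_U :: "nat \<Rightarrow> nat set \<Rightarrow> nat ptree \<Rightarrow> bool" where
  "good_U m \<equiv> good_tree m (\<lambda>r. r < m) (\<lambda>a b. a > b)"

lemma good_treeI:
  assumes "length ts = Suc m" "\<And>r. r \<le> m \<Longrightarrow> good_tree m P Q M (ts ! r)"
    "\<And>b us. ts ! m = Node b us \<Longrightarrow> Q a b" "a \<in> M \<Longrightarrow> \<exists>r\<le>m. P r \<and> ts ! r \<noteq> Leaf"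
  shows "good_tree m P Q M (Node a ts)"
  using assms by (auto simp: in_set_conv_nth less_Suc_eq_le)

lemma sum_Leaf_first:
  assumes "m \<ge> 1" "f Leaf = {#}"
  shows "(\<Sum>r<Suc m. f ((u # replicate m Leaf) ! r)) = (f u :: 'b multiset)"
proof -
  have "(\<Sum>r<Suc m. f ((u # replicate m Leaf) ! r)) = f u + (\<Sum>r<m. f (replicate m Leaf ! r))"
    by (subst sum.lessThan_Suc_shift) simp
  also have "(\<Sum>r<m. f (replicate m Leaf ! r)) = {#}" using assms(2) by (intro sum.neutral) auto
  finally show ?thesis by simp
qed

lemma sum_Leaf_last:
  assumes "f Leaf = {#}" "\<And>r. r < m \<Longrightarrow> us ! r = Leaf"
  shows "(\<Sum>r<Suc m. f (us ! r)) = (f (us ! m) :: 'b multiset)"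
  using assms by simp

lemma sum_move_last:
  assumes "m \<ge> 1" "f Leaf = {#}" "length us = Suc m"
  shows "(\<Sum>r<Suc m. f (move_last m d us ! r)) = (\<Sum>r<Suc m. (f (us ! r) :: 'b multiset))"
proof (cases "d \<and> (\<forall>r<m. us ! r = Leaf)")
  case True
  then show ?thesis
    using sum_Leaf_first[of m f "us ! m", OF assms(1,2)] sum_Leaf_last[of f m us, OF assms(2)]
    by (simp add: move_last_def)
next
  case False
  then have "move_last m d us = us" by (auto simp: move_last_def)
  then show ?thesis by simp
qed

lemma sorted_hd_last:
  assumes "sorted xs" "xs \<noteq> []"
  shows "hd xs = Min (set xs)" "last xs = Max (set xs)"
proof -
  have "hd xs \<le> x" if "x \<in> set xs" for x using assms that by (cases xs) auto
  then show "hd xs = Min (set xs)" using assms(2) by (intro Min_eqI[symmetric]) auto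
  have "x \<le> last xs" if "x \<in> set xs" for x
    using assms that by (auto simp: in_set_conv_nth last_conv_nth intro: sorted_nth_mono)
  then show "last xs = Max (set xs)" using assms(2) by (intro Max_eqI[symmetric]) auto
qed

text \<open>A mark on a path node other than the last is justified by its child of rank 0, which is
  below \<open>m\<close> as \<open>m \<ge> 1\<close>; its child of rank \<open>m\<close> is a leaf.
  So the conditions on \<open>us\<close> concern only the last label.\<close>

lemma rank0_path_props:
  assumes "m \<ge> 1" "xs \<noteq> []" "length us = Suc m"
    and "\<And>r. r \<le> m \<Longrightarrow> good_U m M (us ! r)" "\<And>b vs. us ! m = Node b vs \<Longrightarrow> b < last xs"
    and "last xs \<in> M \<Longrightarrow> \<exists>r<m. us ! r \<noteq> Leaf"
  shows "good_U m M (rank0_path m xs us)"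
    and "mset (labels (rank0_path m xs us)) = mset xs + (\<Sum>r<Suc m. mset (labels (us ! r)))"
    and "\<exists>vs. rank0_path m xs us = Node (hd xs) vs"
proof -
  have "good_U m M (rank0_path m xs us) \<and>
    mset (labels (rank0_path m xs us)) = mset xs + (\<Sum>r<Suc m. mset (labels (us ! r))) \<and>
    (\<exists>vs. rank0_path m xs us = Node (hd xs) vs)"
    using assms(2,5,6)
  proof (induction xs)
    case (Cons a xs)
    show ?case
    proof (cases "xs = []")
      case True
      have "good_U m M (Node a us)"
        using Cons.prems True assms(3,4) by (intro good_treeI) (auto intro: less_imp_le)
      moreover have "mset (labels (Node a us)) = mset [a] + (\<Sum>r<Suc m. mset (labels (us ! r)))"
        unfolding mset_labels_Node assms(3) by simp
      ultimately show ?thesis using True by simp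
    next
      case False
      let ?p = "rank0_path m xs us"
      have IH: "good_U m M ?p" "mset (labels ?p) = mset xs + (\<Sum>r<Suc m. mset (labels (us ! r)))" "?p \<noteq> Leaf"
        using Cons.IH[OF False] Cons.prems False by auto
      have "good_U m M (Node a (?p # replicate m Leaf))"
        using IH(1,3) assms(1) by (intro good_treeI) (auto simp: nth_Cons' intro!: exI[of _ 0])
      moreover have "mset (labels (Node a (?p # replicate m Leaf))) = mset (a # xs) + (\<Sum>r<Suc m. mset (labels (us ! r)))"
        unfolding mset_labels_Node
        using sum_Leaf_first[OF assms(1), of "\<lambda>t. mset (labels t)" ?p] IH(2) by simp
      ultimately show ?thesis using False by simp
    qed
  qed simp
  then show "good_U m M (rank0_path m xs us)"
    and "mset (labels (rank0_path m xs us)) = mset xs + (\<Sum>r<Suc m. mset (labels (us ! r)))"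
    and "\<exists>vs. rank0_path m xs us = Node (hd xs) vs" by blast+
qed

lemma merge_rank0_path:
  assumes "m \<ge> 1" "xs \<noteq> []" "sorted_wrt (<) xs" "\<And>x. x \<in> set (butlast xs) \<Longrightarrow> x \<in> M"
    and "merge_blocks m M (Node (last xs) us) = Node {last xs} ts"
  shows "merge_blocks m M (rank0_path m xs us) = Node (set xs) ts"
  using assms(2-)
proof (induction xs)
  case (Cons a xs)
  show ?case
  proof (cases "xs = []")
    case False
    let ?p = "rank0_path m xs us"
    have IH: "merge_blocks m M ?p = Node (set xs) ts" using Cons False by simp
    have "a \<in> M" using Cons.prems(3)[of a] False by simp
    moreover have "a < Min (set xs)" using Cons.prems(2) False by (subst Min_gr_iff) auto
    moreover have "(Node (set xs) ts # replicate m Leaf) ! r = Leaf" if "r \<in> {1..m}" for r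
      using that by (auto simp: nth_Cons')
    ultimately show ?thesis
      using False IH by (simp add: merge_root_def)
  qed (use Cons in auto)
qed simp

text \<open>The path of \<open>A\<close> is entered at \<open>Min A\<close> and left from
  \<open>Max A\<close>, so the condition \<open>Max A > Min B\<close> on an edge of rank
  \<open>m\<close> becomes a descent between single labels.\<close>

lemma unfold_blocks_props:
  assumes "m \<ge> 1" "good_T m M t" "\<And>A. A \<in> set (labels t) \<Longrightarrow> finite A \<and> A \<noteq> {}"
    and "\<And>A a. A \<in> set (labels t) \<Longrightarrow> a \<in> A \<Longrightarrow> a \<in> M' \<longleftrightarrow> a \<noteq> Max A \<or> A \<in> M"
  shows "good_U m M' (unfold_blocks m M t) \<and> mset (labels (unfold_blocks m M t)) = block_elements t \<and>
    (t = Leaf \<longleftrightarrow> unfold_blocks m M t = Leaf) \<and>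
    (\<forall>A ts. t = Node A ts \<longrightarrow> (\<exists>us. unfold_blocks m M t = Node (Min A) us)) \<and>
    merge_blocks m M' (unfold_blocks m M t) = t"
  using assms(2-)
proof (induction t)
  case (Node A ts)
  let ?g = "unfold_blocks m M" and ?h = "merge_blocks m M'"
  let ?xs = "sorted_list_of_set A"
  have len: "length ts = Suc m" using Node.prems(1) by simp
  have IH: "good_U m M' (?g (ts ! r))" "mset (labels (?g (ts ! r))) = block_elements (ts ! r)"
    "?g (ts ! r) = Leaf \<longleftrightarrow> ts ! r = Leaf"
    "\<And>B vs. ts ! r = Node B vs \<Longrightarrow> \<exists>us. ?g (ts ! r) = Node (Min B) us"
    "?h (?g (ts ! r)) = ts ! r" if "r \<le> m" for r
  proof -
    have "ts ! r \<in> set ts" using that len by simp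
    moreover have "set (labels (ts ! r)) \<subseteq> set (labels (Node A ts))" using calculation by auto
    ultimately have *: "good_U m M' (?g (ts ! r)) \<and> mset (labels (?g (ts ! r))) = block_elements (ts ! r) \<and>
      (ts ! r = Leaf \<longleftrightarrow> ?g (ts ! r) = Leaf) \<and>
      (\<forall>A us. ts ! r = Node A us \<longrightarrow> (\<exists>vs. ?g (ts ! r) = Node (Min A) vs)) \<and> ?h (?g (ts ! r)) = ts ! r"
      using Node.prems(1) by (intro Node.IH Node.prems(2,3)) auto
    then show "good_U m M' (?g (ts ! r))" "mset (labels (?g (ts ! r))) = block_elements (ts ! r)"
      "?g (ts ! r) = Leaf \<longleftrightarrow> ts ! r = Leaf"
      "\<And>B vs. ts ! r = Node B vs \<Longrightarrow> \<exists>us. ?g (ts ! r) = Node (Min B) us"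
      "?h (?g (ts ! r)) = ts ! r" by blast+
  qed
  have A: "finite A" "A \<noteq> {}" using Node.prems(2)[of A] by auto
  have xs: "?xs \<noteq> []" "set ?xs = A" "mset ?xs = mset_set A" "sorted_wrt (<) ?xs"
    using A by (auto simp: sorted_list_of_set.strict_sorted_key_list_of_set)
      (metis mset_sorted_list_of_multiset sorted_list_of_mset_set)
  have last: "last ?xs = Max A"
    using sorted_hd_last(2)[of ?xs] xs by simp
  have hd: "hd ?xs = Min A"
    using sorted_hd_last(1)[of ?xs] xs by simp
  define us where "us = map ?g ts"
  have us: "length us = Suc m" "\<And>r. r \<le> m \<Longrightarrow> us ! r = ?g (ts ! r)" using len by (auto simp: us_def)
  define d where "d \<longleftrightarrow> A \<in> M"
  have d: "d \<Longrightarrow> \<exists>r\<le>m. 0 < r \<and> us ! r \<noteq> Leaf"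
    using Node.prems(1) us(2) IH(3) unfolding d_def by auto
  have dM: "Max A \<in> M' \<longleftrightarrow> d" using Node.prems(3)[of A "Max A"] A unfolding d_def by auto
  have descent: "b < Max A" if u: "us ! m = Node b vs" for b vs
  proof -
    obtain B ws where B: "ts ! m = Node B ws" using u us(2)[of m] IH(3)[of m] by (cases "ts ! m") auto
    then have "b = Min B" using IH(4)[of m B ws] us(2)[of m] u by auto
    then show ?thesis using Node.prems(1) B by auto
  qed
  let ?vs = "move_last m d us"
  have vs: "length ?vs = Suc m" using us(1) by (simp add: move_last_def)
  have "good_U m M' (?vs ! r)" if "r \<le> m" for r
    using that us IH(1) by (auto simp: move_last_def nth_Cons')
  moreover have "b < Max A" if "?vs ! m = Node b ws" for b ws
    using that descent assms(1) by (auto simp: move_last_def nth_Cons' split: if_splits)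
  \<comment> \<open>If all ranks below \<open>m\<close> hold leaves, the witness for the dashed edge
    sits at rank \<open>m\<close>, and \<open>move_last\<close> has brought it to rank 0.\<close>
  moreover have "\<exists>r<m. ?vs ! r \<noteq> Leaf" if "Max A \<in> M'"
  proof (cases "\<forall>r<m. us ! r = Leaf")
    case True
    moreover obtain r where "r \<le> m" "us ! r \<noteq> Leaf" using d dM \<open>Max A \<in> M'\<close> by auto
    ultimately have "us ! m \<noteq> Leaf" by (cases "r = m") auto
    then show ?thesis using True assms(1) dM that by (intro exI[of _ 0]) (auto simp: move_last_def)
  next
    case False
    then have "?vs = us" unfolding move_last_def by (intro if_not_P) blast
    then show ?thesis using False by simp
  qed
  ultimately have p: "good_U m M' (rank0_path m ?xs ?vs)"
    "mset (labels (rank0_path m ?xs ?vs)) = mset ?xs + (\<Sum>r<Suc m. mset (labels (?vs ! r)))"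
    "\<exists>ws. rank0_path m ?xs ?vs = Node (hd ?xs) ws"
    using rank0_path_props[OF assms(1) xs(1) vs, of M'] unfolding last by blast+
  have "(\<Sum>r<Suc m. mset (labels (?vs ! r))) = (\<Sum>r<Suc m. mset (labels (us ! r)))"
    using sum_move_last[OF assms(1) _ us(1), of "\<lambda>t. mset (labels t)"] by simp
  also have "\<dots> = (\<Sum>r<Suc m. block_elements (ts ! r))"
    using IH(2) us(2) by (intro sum.cong) auto
  finally have ms: "mset (labels (rank0_path m ?xs ?vs)) = block_elements (Node A ts)"
    using p(2) xs(3) by (simp add: block_elements_Node len)
  have map_h: "map ?h us = ts"
    using len us IH(5) by (intro nth_equalityI) (auto simp: less_Suc_eq_le)
  \<comment> \<open>The last path node must become the singleton \<open>{Max A}\<close> with the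
    original children. If its cadet was moved, \<open>Min B < Max A\<close> prevents absorption of
    \<open>B\<close>; otherwise a mark comes with a node child of positive rank, and
    \<open>merge_root\<close> changes nothing.\<close>
  have "?h (Node (Max A) ?vs) = Node {Max A} ts"
  proof (cases "d \<and> (\<forall>r<m. us ! r = Leaf)")
    case True
    then have mv: "?vs = us ! m # replicate m Leaf" by (simp add: move_last_def)
    have "ts ! r = Leaf" if "r < m" for r using True that us(2) IH(3)[of r] by auto
    then have ts: "replicate m Leaf @ [ts ! m] = ts"
      using len by (intro nth_equalityI) (auto simp: nth_append less_Suc_eq)
    obtain r where "r \<le> m" "us ! r \<noteq> Leaf" using d True by auto
    then have "us ! m \<noteq> Leaf" using True by (cases "r = m") auto
    then obtain B ws where B: "ts ! m = Node B ws" using us(2)[of m] IH(3)[of m] by (cases "ts ! m") auto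
    have "\<not> Max A < Min B" using Node.prems(1) B by auto
    moreover have "?h (us ! m) = Node B ws" using us(2)[OF order_refl] IH(5)[OF order_refl] B by metis
    moreover have "map ?h ?vs ! r = Leaf" if "r \<in> {1..m}" for r
      using that unfolding mv by (auto simp: nth_Cons')
    ultimately show ?thesis
      using True dM ts B unfolding merge_blocks.simps merge_root_def mv by (simp add: nth_Cons')
  next
    case False
    then have mv: "?vs = us" by (auto simp: move_last_def)
    have "\<not> (Max A \<in> M' \<and> (\<forall>r\<in>{1..m}. ts ! r = Leaf))"
    proof
      assume *: "Max A \<in> M' \<and> (\<forall>r\<in>{1..m}. ts ! r = Leaf)"
      then obtain r where r: "r \<le> m" "0 < r" "us ! r \<noteq> Leaf" using dM d by auto
      then show False using * us(2) IH(3)[of r] by auto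
    qed
    then show ?thesis by (simp only: merge_blocks.simps merge_root_def mv map_h if_False)
  qed
  moreover have "x \<in> M'" if "x \<in> set (butlast ?xs)" for x
  proof -
    have "x \<in> A" using that xs(2) in_set_butlastD by fastforce
    moreover have "x \<noteq> Max A"
      using that last xs(1) distinct_sorted_list_of_set[of A]
      by (metis append_butlast_last_id distinct_butlast not_distinct_conv_prefix)
    ultimately show ?thesis using Node.prems(3)[of A x] by simp
  qed
  ultimately have "?h (rank0_path m ?xs ?vs) = Node (set ?xs) ts"
    using assms(1) xs last by (intro merge_rank0_path) auto
  moreover have "?g (Node A ts) = rank0_path m ?xs ?vs" by (simp add: us_def d_def)
  ultimately show ?case using p ms hd xs(2) by auto
qed simp


text \<open>In \<open>unfold_blocks\<close> the last path node inherits the mark of its block and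
  the earlier ones are always marked. So the marked blocks to recover are those whose maximum is
  marked.\<close>

lemma merge_blocks_props:
  assumes "m \<ge> 1" "good_U m M' s" "distinct (labels s)"
  shows "good_T m {A. Max A \<in> M'} (merge_blocks m M' s) \<and>
    block_elements (merge_blocks m M' s) = mset (labels s) \<and>
    (s = Leaf \<longleftrightarrow> merge_blocks m M' s = Leaf) \<and>
    (\<forall>a ts. s = Node a ts \<longrightarrow> (\<exists>B us. merge_blocks m M' s = Node B us \<and> Min B = a)) \<and>
    (\<forall>A\<in>set (labels (merge_blocks m M' s)). finite A \<and> A \<noteq> {} \<and> (\<forall>a\<in>A. a \<noteq> Max A \<longrightarrow> a \<in> M')) \<and>
    unfold_blocks m {A. Max A \<in> M'} (merge_blocks m M' s) = s"
  using assms(2-)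
proof (induction s)
  case (Node a ts)
  let ?M = "{A. Max A \<in> M'}"
  let ?g = "unfold_blocks m ?M" and ?h = "merge_blocks m M'"
  let ?ok = "\<lambda>t. \<forall>A\<in>set (labels t). finite A \<and> A \<noteq> {} \<and> (\<forall>a\<in>A. a \<noteq> Max A \<longrightarrow> a \<in> M')"
  have len: "length ts = Suc m" using Node.prems(1) by simp
  define us where "us = map ?h ts"
  have us: "length us = Suc m" "\<And>r. r \<le> m \<Longrightarrow> us ! r = ?h (ts ! r)" using len by (auto simp: us_def)
  have IH: "good_T m ?M (us ! r)" "block_elements (us ! r) = mset (labels (ts ! r))"
    "us ! r = Leaf \<longleftrightarrow> ts ! r = Leaf"
    "\<And>b vs. ts ! r = Node b vs \<Longrightarrow> \<exists>B ws. us ! r = Node B ws \<and> Min B = b"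
    "?ok (us ! r)" "?g (us ! r) = ts ! r" if "r \<le> m" for r
  proof -
    have "ts ! r \<in> set ts" using that len by simp
    moreover have "distinct (labels (ts ! r))"
      using distinct_labels_child(1)[OF Node.prems(2), of r] that len by simp
    ultimately have "good_T m ?M (us ! r) \<and> block_elements (us ! r) = mset (labels (ts ! r)) \<and>
      (ts ! r = Leaf \<longleftrightarrow> us ! r = Leaf) \<and>
      (\<forall>b vs. ts ! r = Node b vs \<longrightarrow> (\<exists>B ws. us ! r = Node B ws \<and> Min B = b)) \<and>
      ?ok (us ! r) \<and> ?g (us ! r) = ts ! r"
      unfolding us(2)[OF that] using Node.prems(1) by (intro Node.IH) auto
    then show "good_T m ?M (us ! r)" "block_elements (us ! r) = mset (labels (ts ! r))"
      "us ! r = Leaf \<longleftrightarrow> ts ! r = Leaf"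
      "\<And>b vs. ts ! r = Node b vs \<Longrightarrow> \<exists>B ws. us ! r = Node B ws \<and> Min B = b"
      "?ok (us ! r)" "?g (us ! r) = ts ! r" by blast+
  qed
  have h: "?h (Node a ts) = merge_root m M' a us" by (simp add: us_def)
  have mark: "a \<in> M' \<Longrightarrow> \<exists>r<m. ts ! r \<noteq> Leaf" using Node.prems(1) by auto
  have single: "Max {a} = a" "Min {a} = a" "sorted_list_of_set {a} = [a]" by auto
  show ?case
  proof (cases "a \<in> M' \<and> (\<forall>r\<in>{1..m}. us ! r = Leaf)")
    case True
    then have leaf: "ts ! r = Leaf" if "0 < r" "r \<le> m" for r using IH(3)[of r] that by auto
    \<comment> \<open>The mark needs a witness of rank below \<open>m\<close>, and all positive
      ranks hold leaves, so it is the child of rank 0.\<close>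
    obtain r where r: "r < m" "ts ! r \<noteq> Leaf" using mark True by blast
    have "r = 0" using leaf[of r] r by auto
    then obtain b vs where b: "ts ! 0 = Node b vs" using r by (cases "ts ! 0") auto
    obtain B ws where B: "us ! 0 = Node B ws" "Min B = b" using IH(4)[OF _ b] by auto
    have ts: "ts = ts ! 0 # replicate m Leaf"
      using len leaf by (intro nth_equalityI) (auto simp: nth_Cons' less_Suc_eq_le)
    have "a \<notin> set (labels (ts ! 0))" using distinct_labels_child(2)[OF Node.prems(2), of 0] len by simp
    then have ab: "a \<noteq> b" and aB: "a \<notin># block_elements (us ! 0)" using b IH(2)[of 0] by auto
    have Bok: "finite B" "B \<noteq> {}" using IH(5)[of 0] B(1) by auto
    have "(\<Sum>r<Suc m. mset (labels ((ts ! 0 # replicate m Leaf) ! r))) = mset (labels (ts ! 0))"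
      using sum_Leaf_first[OF assms(1), of "\<lambda>t. mset (labels t)" "ts ! 0"] by simp
    then have ms: "mset (labels (Node a ts)) = add_mset a (block_elements (us ! 0))"
      unfolding mset_labels_Node len using ts IH(2)[of 0] by simp
    show ?thesis
    proof (cases "a < b")
      \<comment> \<open>A larger child label continues the block: \<open>a\<close> becomes the new
        minimum, while the maximum, and with it the mark of the block, is unchanged.\<close>
      case less: True
      have hN: "?h (Node a ts) = Node (insert a B) ws" using h True B less by (simp add: merge_root_def)
      have Max: "Max (insert a B) = Max B"
      proof -
        have "Min B \<le> Max B" using Bok by simp
        then show ?thesis using Bok less B(2) by (simp add: max_def)
      qed
      have lt: "\<forall>x\<in>B. a < x" using less B(2) Bok by (meson Min_le less_le_trans)
      then have "a \<notin> B" by auto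
      then have srt: "sorted_list_of_set (insert a B) = a # sorted_list_of_set B"
        using sorted_list_of_set.idem_if_sorted_distinct[of "a # sorted_list_of_set B"] Bok lt
        by (simp add: less_imp_le)
      have "good_T m ?M (Node (insert a B) ws)"
        using IH(1)[of 0] B(1) Max by simp
      moreover have "block_elements (Node (insert a B) ws) = mset (labels (Node a ts))"
        unfolding ms B(1) block_elements_Node using Bok \<open>a \<notin> B\<close> by simp
      moreover have "Min (insert a B) = a" using Bok less B(2) by (simp add: min_def)
      moreover have "?ok (Node (insert a B) ws)"
        using IH(5)[of 0] B(1) True Bok Max by auto
      moreover have "?g (Node (insert a B) ws) = Node a (?g (Node B ws) # replicate m Leaf)"
        using srt Bok Max by simp
      then have "?g (Node (insert a B) ws) = Node a ts" using IH(6)[of 0] B(1) ts by simp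
      ultimately show ?thesis unfolding hN by auto
    next
      case False
      \<comment> \<open>A smaller child label cannot continue a block. The child returns to rank
        \<open>m\<close>, where its edge is a descent and, \<open>m\<close> being positive,
        justifies the mark.\<close>
      then have less: "b < a" using ab by simp
      let ?vs = "replicate m Leaf @ [us ! 0]"
      have hN: "?h (Node a ts) = Node {a} ?vs" using h True B less by (simp add: merge_root_def)
      have vm: "?vs ! m = us ! 0" "\<And>r. r < m \<Longrightarrow> ?vs ! r = Leaf" by (auto simp: nth_append)
      have "good_T m ?M (Node {a} ?vs)"
      proof (rule good_treeI)
        show "good_T m ?M (?vs ! r)" if "r \<le> m" for r
          using that vm IH(1)[of 0] by (cases "r = m") auto
        show "Max {a} > Min C" if "?vs ! m = Node C xs" for C xs
          using that vm(1) B less by auto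
        show "\<exists>r\<le>m. 0 < r \<and> ?vs ! r \<noteq> Leaf" using vm(1) B(1) assms(1) by (intro exI[of _ m]) auto
      qed simp
      moreover have "block_elements (Node {a} ?vs) = mset (labels (Node a ts))"
        using sum_Leaf_last[of block_elements m ?vs] vm unfolding ms block_elements_Node by simp
      moreover have "?ok (Node {a} ?vs)" using IH(5)[of 0] by auto
      moreover have "?g (Node {a} ?vs) = Node a ts"
      proof -
        have "map ?g ?vs ! r = Leaf" if "r < m" for r using that by (simp add: nth_append)
        moreover have "map ?g ?vs ! m = ts ! 0" using IH(6)[of 0] by (simp add: nth_append)
        ultimately have "move_last m True (map ?g ?vs) = ts"
          unfolding move_last_def using ts by (simp del: map_append)
        then show ?thesis using True single by simp
      qed
      ultimately show ?thesis unfolding hN using single by auto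
    qed
  next
    case False
    have hN: "?h (Node a ts) = Node {a} us" unfolding h merge_root_def using False by (simp only: if_False)
    have "good_T m ?M (Node {a} us)"
    proof (rule good_treeI)
      show "Max {a} > Min C" if u: "us ! m = Node C xs" for C xs
      proof -
        obtain b vs where b: "ts ! m = Node b vs" using u IH(3)[of m] by (cases "ts ! m") auto
        then have "b = Min C" using IH(4)[OF _ b] u by auto
        then show ?thesis using Node.prems(1) b by auto
      qed
      show "\<exists>r\<le>m. 0 < r \<and> us ! r \<noteq> Leaf" if "{a} \<in> ?M" using False that by force
    qed (use us(1) IH(1) in auto)
    moreover have "block_elements (Node {a} us) = mset (labels (Node a ts))"
      unfolding block_elements_Node mset_labels_Node us(1) len using IH(2)
      by (auto intro!: sum.cong simp: less_Suc_eq_le)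
    moreover have "?ok (Node {a} us)"
    proof -
      have "?ok t" if t: "t \<in> set us" for t
      proof -
        obtain r where "r \<le> m" "t = us ! r" using t us(1) by (auto simp: in_set_conv_nth less_Suc_eq_le)
        then show ?thesis using IH(5) by blast
      qed
      then show ?thesis by auto
    qed
    moreover have "?g (Node {a} us) = Node a ts"
    proof -
      have "map ?g us = ts" using us(1) len IH(6) by (intro nth_equalityI) (auto simp: less_Suc_eq_le)
      moreover have "move_last m (a \<in> M') ts = ts" using mark by (auto simp: move_last_def)
      ultimately show ?thesis using single by simp
    qed
    ultimately show ?thesis unfolding hN using single by auto
  qed
qed simp

section \<open>From lists of blocks to set partitions\<close>

lemma count_block_elements:
  assumes "\<And>A. A \<in> set (labels t) \<Longrightarrow> finite A"
  shows "count (block_elements t) x = length (filter (\<lambda>A. x \<in> A) (labels t))"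
proof -
  have "count (\<Sum>A\<in>#mset ls. mset_set A) x = length (filter (\<lambda>A. x \<in> A) ls)"
    if "\<And>A. A \<in> set ls \<Longrightarrow> finite A" for ls :: "nat set list"
    using that by (induction ls) auto
  then show ?thesis unfolding block_elements_def using assms by blast
qed

text \<open>An element counted twice lies in a repeated block or in two different ones. Empty blocks
  are excluded, as their repetition would go unnoticed.\<close>

lemma filter_le_1_iff_disjoint:
  assumes "{} \<notin> set ls"
  shows "(\<forall>x. length (filter (\<lambda>A. x \<in> A) ls) \<le> 1) \<longleftrightarrow> distinct ls \<and> disjoint (set ls)"
  using assms
proof (induction ls)
  case (Cons A ls)
  have A: "A \<noteq> {}" using Cons.prems by auto
  have "(\<forall>x. length (filter (\<lambda>B. x \<in> B) (A # ls)) \<le> 1) \<longleftrightarrow>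
      (\<forall>x. length (filter (\<lambda>B. x \<in> B) ls) \<le> 1) \<and> (\<forall>x\<in>A. \<forall>B\<in>set ls. x \<notin> B)"
  proof -
    have *: "length (filter (\<lambda>B. x \<in> B) (A # ls)) \<le> 1 \<longleftrightarrow>
        length (filter (\<lambda>B. x \<in> B) ls) \<le> 1 \<and> (x \<in> A \<longrightarrow> (\<forall>B\<in>set ls. x \<notin> B))" for x
      by (auto simp: filter_empty_conv)
    show ?thesis unfolding * by blast
  qed
  also have "\<dots> \<longleftrightarrow> distinct (A # ls) \<and> disjoint (set (A # ls))"
  proof -
    have ne: "{} \<notin> set ls" using Cons.prems by simp
    have dj: "disjoint (set (A # ls)) \<longleftrightarrow> disjoint (set ls) \<and> (\<forall>B\<in>set ls. B \<noteq> A \<longrightarrow> A \<inter> B = {})"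
      unfolding disjoint_def list.set by blast
    have "(\<forall>x\<in>A. \<forall>B\<in>set ls. x \<notin> B) \<longleftrightarrow> A \<notin> set ls \<and> (\<forall>B\<in>set ls. B \<noteq> A \<longrightarrow> A \<inter> B = {})"
    proof
      assume H: "\<forall>x\<in>A. \<forall>B\<in>set ls. x \<notin> B"
      then show "A \<notin> set ls \<and> (\<forall>B\<in>set ls. B \<noteq> A \<longrightarrow> A \<inter> B = {})" using A by auto
    next
      assume H: "A \<notin> set ls \<and> (\<forall>B\<in>set ls. B \<noteq> A \<longrightarrow> A \<inter> B = {})"
      then show "\<forall>x\<in>A. \<forall>B\<in>set ls. x \<notin> B" by (metis disjoint_iff)
    qed
    then show ?thesis unfolding dj Cons.IH[OF ne] distinct.simps(2) by blast
  qed
  finally show ?case .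
qed (simp add: disjoint_def)

lemma distinct_blocks_iff:
  assumes "mset xs = block_elements t" "\<And>A. A \<in> set (labels t) \<Longrightarrow> finite A \<and> A \<noteq> {}"
  shows "distinct xs \<and> set xs = X \<longleftrightarrow> distinct (labels t) \<and> partition_on X (set (labels t))"
proof -
  have c: "count (mset xs) x = length (filter (\<lambda>A. x \<in> A) (labels t))" for x
    using assms by (simp add: count_block_elements)
  have "x \<in> set xs \<longleftrightarrow> x \<in> \<Union> (set (labels t))" for x
  proof -
    have "x \<in> set xs \<longleftrightarrow> count (mset xs) x \<noteq> 0" by simp
    then show ?thesis unfolding c by (auto simp: filter_empty_conv)
  qed
  then have "set xs = \<Union> (set (labels t))" by blast
  moreover have "{} \<notin> set (labels t)" using assms(2) by auto
  moreover have "distinct xs \<longleftrightarrow> (\<forall>x. length (filter (\<lambda>A. x \<in> A) (labels t)) \<le> 1)"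
    unfolding distinct_iff_mset c ..
  ultimately show ?thesis
    unfolding partition_on_def using filter_le_1_iff_disjoint[of "labels t"] by auto
qed

text \<open>Elements other than block maxima are always marked, so the unmarked elements are the
  maxima of the unmarked blocks, one for each.\<close>

lemma card_unmarked:
  fixes n :: nat
  assumes "partition_on {1..n} P" "\<And>A a. A \<in> P \<Longrightarrow> a \<in> A \<Longrightarrow> a \<in> M' \<longleftrightarrow> a \<noteq> Max A \<or> A \<in> M"
  shows "card ({1..n} - M') = card (P - M)"
proof -
  have un: "\<Union> P = {1..n}" and dj: "disjoint P" and ne: "{} \<notin> P"
    using assms(1) unfolding partition_on_def by auto
  have Max: "Max A \<in> A" if "A \<in> P" for A
  proof -
    have "A \<subseteq> {1..n}" using that un by auto
    then have "finite A" by (rule finite_subset) simp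
    moreover have "A \<noteq> {}" using that ne by blast
    ultimately show ?thesis by simp
  qed
  have "{1..n} - M' = Max ` (P - M)"
  proof
    show "{1..n} - M' \<subseteq> Max ` (P - M)"
    proof
      fix a assume a: "a \<in> {1..n} - M'"
      then have "a \<in> \<Union> P" using un by simp
      then obtain A where "A \<in> P" "a \<in> A" by blast
      then show "a \<in> Max ` (P - M)" using assms(2)[of A a] a by auto
    qed
    show "Max ` (P - M) \<subseteq> {1..n} - M'"
    proof
      fix a assume "a \<in> Max ` (P - M)"
      then obtain A where A: "A \<in> P" "A \<notin> M" "a = Max A" by auto
      then have "a \<in> A" using Max by simp
      then show "a \<in> {1..n} - M'" using assms(2)[of A a] A un by auto
    qed
  qed
  moreover have "inj_on Max (P - M)"
  proof (rule inj_onI)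
    fix A B assume "A \<in> P - M" "B \<in> P - M" "Max A = Max B"
    then have "A \<in> P" "B \<in> P" "Max A \<in> A \<inter> B" using Max[of A] Max[of B] by auto
    then show "A = B" using dj unfolding disjoint_def by blast
  qed
  ultimately show ?thesis by (simp add: card_image)
qed

lemma unfold_blocks_cong:
  "(\<And>A. A \<in> set (labels t) \<Longrightarrow> A \<in> M \<longleftrightarrow> A \<in> M2) \<Longrightarrow> unfold_blocks m M t = unfold_blocks m M2 t"
proof (induction t)
  case (Node A ts)
  then have "map (unfold_blocks m M) ts = map (unfold_blocks m M2) ts" by auto
  then show ?case using Node.prems[of A] by (simp del: map_eq_conv)
qed simp

lemma good_tree_cong:
  "(\<And>a. a \<in> set (labels t) \<Longrightarrow> a \<in> M \<longleftrightarrow> a \<in> M2) \<Longrightarrow> good_tree m P Q M t \<longleftrightarrow> good_tree m P Q M2 t"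
proof (induction t)
  case (Node a ts)
  then have "(\<forall>t\<in>set ts. good_tree m P Q M t) \<longleftrightarrow> (\<forall>t\<in>set ts. good_tree m P Q M2 t)" by auto
  then show ?case using Node.prems[of a] by simp
qed simp

lemma U_set_iff:
  "(s, M') \<in> U_set m n k \<longleftrightarrow> good_U m M' s \<and> distinct (labels s) \<and> set (labels s) = {1..n} \<and>
    M' \<subseteq> {1..n} \<and> card M' = n - k"
proof (cases "distinct (labels s) \<and> set (labels s) = {1..n} \<and> M' \<subseteq> {1..n}")
  case True
  then have "M' \<inter> set (labels s) = M'" by auto
  then show ?thesis using True by (auto simp: U_set_def good_tree_iff)
qed (auto simp: U_set_def)

lemma T_marked_eqpoll_U_set:
  assumes "m \<ge> 1" "k \<le> n"
  shows "T_marked m n k \<approx> U_set m n k"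
proof -
  define marks where "marks t M = {a\<in>{1..n}. \<exists>A\<in>set (labels t). a \<in> A \<and> (a \<noteq> Max A \<or> A \<in> M)}"
    for t :: "nat set ptree" and M
  define \<phi> where "\<phi> = (\<lambda>(t, M). (unfold_blocks m M t, marks t M))"
  define \<psi> where "\<psi> = (\<lambda>(s, M'). (merge_blocks m M' s, {A\<in>set (labels (merge_blocks m M' s)). Max A \<in> M'}))"
  have T: "\<phi> x \<in> U_set m n k \<and> \<psi> (\<phi> x) = x" if x: "x \<in> T_marked m n k" for x
  proof -
    obtain t M where tM: "x = (t, M)" by (cases x)
    have t: "good_T m M t" "distinct (labels t)" "partition_on {1..n} (set (labels t))"
      "M \<subseteq> set (labels t)" "card (set (labels t) - M) = k"
      using x unfolding tM T_marked_def by auto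
    have fin: "finite A \<and> A \<noteq> {}" if "A \<in> set (labels t)" for A
    proof -
      have "A \<subseteq> {1..n}" using that t(3) unfolding partition_on_def by auto
      then show ?thesis using that t(3) unfolding partition_on_def by (metis finite_atLeastAtMost finite_subset)
    qed
    have agree: "a \<in> marks t M \<longleftrightarrow> a \<noteq> Max A \<or> A \<in> M" if A: "A \<in> set (labels t)" "a \<in> A" for A a
    proof -
      have "A' = A" if "A' \<in> set (labels t)" "a \<in> A'" for A'
        using that A t(3) unfolding partition_on_def disjoint_def by blast
      moreover have "a \<in> {1..n}" using A t(3) unfolding partition_on_def by blast
      ultimately show ?thesis using A unfolding marks_def by blast
    qed
    note p = unfold_blocks_props[OF assms(1) t(1) fin agree]
    have "distinct (labels (unfold_blocks m M t)) \<and> set (labels (unfold_blocks m M t)) = {1..n}"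
      using distinct_blocks_iff[of "labels (unfold_blocks m M t)" t "{1..n}"] p fin t(2,3) by blast
    moreover have "marks t M \<subseteq> {1..n}" unfolding marks_def by auto
    moreover have "card (marks t M) = n - k"
    proof -
      have "card ({1..n} - marks t M) = k" using card_unmarked[OF t(3) agree] t(5) by simp
      moreover have "card ({1..n} - marks t M) = n - card (marks t M)" "card (marks t M) \<le> n"
        using card_Diff_subset[of "marks t M" "{1..n}"] card_mono[of "{1..n}" "marks t M"]
          \<open>marks t M \<subseteq> {1..n}\<close> finite_subset[OF \<open>marks t M \<subseteq> {1..n}\<close>] by auto
      ultimately show ?thesis by simp
    qed
    ultimately have "(unfold_blocks m M t, marks t M) \<in> U_set m n k" using p U_set_iff by blast
    moreover have "{A\<in>set (labels t). Max A \<in> marks t M} = M"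
      using agree fin t(4) by (auto simp: Max_in)
    ultimately show ?thesis using p unfolding tM \<phi>_def \<psi>_def by simp
  qed
  have U: "\<psi> y \<in> T_marked m n k \<and> \<phi> (\<psi> y) = y" if y: "y \<in> U_set m n k" for y
  proof -
    obtain s M' where sM: "y = (s, M')" by (cases y)
    have s: "good_U m M' s" "distinct (labels s)" "set (labels s) = {1..n}" "M' \<subseteq> {1..n}" "card M' = n - k"
      using y unfolding sM U_set_iff by auto
    define t where "t = merge_blocks m M' s"
    define M where "M = {A\<in>set (labels t). Max A \<in> M'}"
    have p: "good_T m {A. Max A \<in> M'} t" "block_elements t = mset (labels s)"
      "\<And>A. A \<in> set (labels t) \<Longrightarrow> finite A \<and> A \<noteq> {} \<and> (\<forall>a\<in>A. a \<noteq> Max A \<longrightarrow> a \<in> M')"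
      "unfold_blocks m {A. Max A \<in> M'} t = s"
      using merge_blocks_props[OF assms(1) s(1,2)] unfolding t_def by blast+
    have part: "distinct (labels t)" "partition_on {1..n} (set (labels t))"
      using distinct_blocks_iff[of "labels s" t "{1..n}"] p(2,3) s(2,3) by auto
    have agree: "a \<in> M' \<longleftrightarrow> a \<noteq> Max A \<or> A \<in> M" if A: "A \<in> set (labels t)" "a \<in> A" for A a
      using p(3)[OF A(1)] A unfolding M_def by auto
    have "card ({1..n} - M') = n - (n - k)"
      using card_Diff_subset[of M' "{1..n}"] s(4,5) finite_subset[OF s(4)] by simp
    then have "card (set (labels t) - M) = k"
      using card_unmarked[OF part(2) agree] assms(2) by simp
    moreover have "good_T m M t" using p(1) good_tree_cong[of t M "{A. Max A \<in> M'}"] unfolding M_def by blast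
    ultimately have "(t, M) \<in> T_marked m n k" using part unfolding T_marked_def M_def by auto
    moreover have "unfold_blocks m M t = s" using p(4) unfold_blocks_cong[of t M "{A. Max A \<in> M'}"] unfolding M_def by simp
    moreover have "marks t M = M'"
    proof
      show "marks t M \<subseteq> M'" using agree unfolding marks_def by auto
      show "M' \<subseteq> marks t M"
      proof
        fix a assume a: "a \<in> M'"
        then obtain A where "A \<in> set (labels t)" "a \<in> A" using s(4) part(2) unfolding partition_on_def by blast
        then show "a \<in> marks t M" using a agree s(4) unfolding marks_def by blast
      qed
    qed
    ultimately show ?thesis unfolding sM \<phi>_def \<psi>_def t_def M_def by simp
  qed
  have "bij_betw \<phi> (T_marked m n k) (U_set m n k)"
    using T U by (intro bij_betw_byWitness[where f' = \<psi>]) auto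
  then show ?thesis unfolding eqpoll_def by blast
qed

lemma T_set_eqpoll_U_set:
  assumes "m \<ge> 1" "k \<le> n"
  shows "T_set m n k \<approx> U_set m n k"
  using T_set_eqpoll_T_marked T_marked_eqpoll_U_set[OF assms] by (rule eqpoll_trans)

section \<open>Difference arrangements and the finite field method\<close>

type_synonym 'n diff_eqn = "'n \<times> 'n \<times> int"

section \<open>Difference equations over the reals and modulo \<open>q\<close>\<close>

definition diff_val :: "'n::finite diff_eqn \<Rightarrow> real ^ 'n \<Rightarrow> real" where
  "diff_val h x = x $ fst h - x $ fst (snd h) - of_int (snd (snd h))"

definition real_sols :: "'n::finite diff_eqn set \<Rightarrow> (real ^ 'n) set" where
  "real_sols B = {x. \<forall>h\<in>B. diff_val h x = 0}"

definition holds_mod :: "nat \<Rightarrow> 'n diff_eqn \<Rightarrow> ('n \<Rightarrow> int) \<Rightarrow> bool" where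
  "holds_mod q h y \<longleftrightarrow> int q dvd y (fst h) - y (fst (snd h)) - snd (snd h)"

definition mod_sols :: "nat \<Rightarrow> 'n diff_eqn set \<Rightarrow> ('n \<Rightarrow> int) set" where
  "mod_sols q B = {y. (\<forall>i. y i \<in> {0..<int q}) \<and> (\<forall>h\<in>B. holds_mod q h y)}"

lemma diff_val_inner:
  "diff_val (i, j, s) x = (axis i 1 - axis j 1) \<bullet> x - of_int s"
  by (simp add: diff_val_def inner_diff_left inner_axis')

lemma diff_val_affine_combination:
  "diff_val h ((1 - t) *\<^sub>R x + t *\<^sub>R z) = (1 - t) * diff_val h x + t * diff_val h z"
  by (simp add: diff_val_def algebra_simps)

lemma continuous_diff_val: "continuous_on UNIV (diff_val h)"
  unfolding diff_val_def by (intro continuous_intros)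

lemma real_sols_insert: "real_sols (insert h B) = real_sols B \<inter> {x. diff_val h x = 0}"
  by (auto simp: real_sols_def)

lemma mod_sols_insert: "mod_sols q (insert h B) = {y\<in>mod_sols q B. holds_mod q h y}"
  by (auto simp: mod_sols_def)

lemma affine_real_sols: "affine (real_sols B)"
  unfolding affine_def real_sols_def
proof (intro ballI allI impI CollectI, elim CollectE)
  fix x z :: "real ^ 'a" and u v :: real and h
  assume A: "\<forall>h\<in>B. diff_val h x = 0" "\<forall>h\<in>B. diff_val h z = 0" "u + v = 1" "h \<in> B"
  have "u = 1 - v" using A(3) by simp
  then show "diff_val h (u *\<^sub>R x + v *\<^sub>R z) = 0"
    unfolding \<open>u = 1 - v\<close> diff_val_affine_combination using A by simp
qed

lemma mod_sols_subset_PiE: "mod_sols q B \<subseteq> UNIV \<rightarrow>\<^sub>E {0..<int q}"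
  by (auto simp: mod_sols_def)

lemma finite_mod_sols: "finite (mod_sols q (B :: 'n::finite diff_eqn set))"
  by (rule finite_subset[OF mod_sols_subset_PiE]) (intro finite_PiE; simp)

lemma aff_dim_real_sols_insert:
  "aff_dim (real_sols (insert h B)) = (if real_sols (insert h B) = {} then -1
     else if real_sols B \<subseteq> {x. diff_val h x = 0} then aff_dim (real_sols B) else aff_dim (real_sols B) - 1)"
proof -
  obtain i j s where h: "h = (i, j, s)" by (cases h)
  have "{x. diff_val h x = 0} = {x. (axis i 1 - axis j 1) \<bullet> x = real_of_int s}"
    unfolding h diff_val_inner by auto
  then show ?thesis
    unfolding real_sols_insert using aff_dim_affine_Int_hyperplane[OF affine_real_sols] by metis
qed

text \<open>A walk from \<open>i\<close> to \<open>j\<close> in the graph of equations;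
  \<open>w\<close> is the value of \<open>x $ i - x $ j\<close> to which its equations add up. As
  \<open>w\<close> is an integer, the same value is forced modulo \<open>q\<close>.\<close>

inductive offset :: "'n diff_eqn set \<Rightarrow> 'n \<Rightarrow> 'n \<Rightarrow> int \<Rightarrow> bool" for B i where
  base: "offset B i i 0"
| fwd: "offset B i j w \<Longrightarrow> (j, l, s) \<in> B \<Longrightarrow> offset B i l (w + s)"
| bwd: "offset B i j w \<Longrightarrow> (l, j, s) \<in> B \<Longrightarrow> offset B i l (w - s)"

lemma offset_real: "offset B i j w \<Longrightarrow> x \<in> real_sols B \<Longrightarrow> x $ i - x $ j = of_int w"
proof (induction rule: offset.induct)
  case (fwd j w l s)
  then have "diff_val (j, l, s) x = 0" by (auto simp: real_sols_def)
  then show ?case using fwd by (simp add: diff_val_def)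
next
  case (bwd j w l s)
  then have "diff_val (l, j, s) x = 0" by (auto simp: real_sols_def)
  then show ?case using bwd by (simp add: diff_val_def)
qed simp

lemma offset_mod: "offset B i j w \<Longrightarrow> y \<in> mod_sols q B \<Longrightarrow> int q dvd y i - y j - w"
proof (induction rule: offset.induct)
  case (fwd j w l s)
  then have "int q dvd y j - y l - s" by (auto simp: mod_sols_def holds_mod_def)
  then have "int q dvd (y i - y j - w) + (y j - y l - s)" using fwd by (intro dvd_add[of "int q" "y i - y j - w"]) auto
  then show ?case by (simp add: algebra_simps)
next
  case (bwd j w l s)
  then have "int q dvd y l - y j - s" by (auto simp: mod_sols_def holds_mod_def)
  then have "int q dvd (y i - y j - w) - (y l - y j - s)" using bwd by (intro dvd_diff[of "int q" "y i - y j - w"]) auto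
  then show ?case by (simp add: algebra_simps)
qed simp

lemma offset_closed:
  assumes "(k, l, s) \<in> B"
  shows "(\<exists>w. offset B i k w) \<longleftrightarrow> (\<exists>w. offset B i l w)"
  using assms offset.fwd offset.bwd by metis

text \<open>If no chain of equations of \<open>B\<close> links \<open>i\<close> and \<open>j\<close>, the coordinates linked to \<open>i\<close> can be
  translated independently of the others, over the reals as well as modulo \<open>q\<close>.\<close>

definition shift_class :: "'n diff_eqn set \<Rightarrow> 'n \<Rightarrow> 'n \<Rightarrow> int" where
  "shift_class B i k = (if \<exists>w. offset B i k w then 1 else 0)"

lemma shift_class_edge: "(k, l, s) \<in> B \<Longrightarrow> shift_class B i k = shift_class B i l"
  using offset_closed[of k l s B i] by (simp add: shift_class_def)

lemma shift_class_self: "shift_class B i i = 1"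
  using offset.base[of B i] unfolding shift_class_def by metis

lemma shift_class_unlinked: "\<nexists>w. offset B i j w \<Longrightarrow> shift_class B i j = 0"
  by (simp add: shift_class_def)

lemma unlinked_real:
  assumes "\<nexists>w. offset B i j w" "x \<in> real_sols B"
  shows "\<exists>z\<in>real_sols B. diff_val (i, j, s) z = c"
proof
  define t where "t = c - diff_val (i, j, s) x"
  define z where "z = (\<chi> k. x $ k + t * of_int (shift_class B i k))"
  show "diff_val (i, j, s) z = c"
    unfolding z_def t_def using shift_class_unlinked[OF assms(1)] by (simp add: diff_val_def shift_class_self)
  have "diff_val h z = 0" if "h \<in> B" for h
  proof -
    obtain k l r where h: "h = (k, l, r)" by (cases h)
    have "diff_val h x = 0" using assms(2) that by (auto simp: real_sols_def)
    then show ?thesis using shift_class_edge[of k l r B i] that unfolding h z_def by (simp add: diff_val_def)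
  qed
  then show "z \<in> real_sols B" by (simp add: real_sols_def)
qed

lemma unlinked_mod:
  assumes un: "\<nexists>w. offset B i j w" and q: "q \<ge> 1"
  shows "card (mod_sols q B) = q * card (mod_sols q (insert (i, j, s) (B :: 'n::finite diff_eqn set)))"
proof -
  define Y where "Y v = {y\<in>mod_sols q B. int q dvd y i - y j - s - v}" for v
  define sh where "sh v y k = (y k + v * shift_class B i k) mod int q" for v k and y :: "'n \<Rightarrow> int"
  note ii = shift_class_self[of B i] and ij = shift_class_unlinked[OF un]
  have cong: "int q dvd sh v y k - sh v y l - r \<longleftrightarrow>
      int q dvd y k - y l + v * (shift_class B i k - shift_class B i l) - r" for v y k l r
  proof -
    have "int q dvd sh v y k - sh v y l - r \<longleftrightarrow>
        int q dvd (y k + v * shift_class B i k) - (y l + v * shift_class B i l) - r"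
      unfolding sh_def dvd_eq_mod_eq_0 by (metis mod_diff_eq mod_diff_left_eq)
    then show ?thesis by (simp add: algebra_simps)
  qed
  have maps: "sh v y \<in> Y (a + v)" if "y \<in> Y a" for v a y
  proof -
    have y: "y \<in> mod_sols q B" and ya: "int q dvd y i - y j - s - a" using that by (auto simp: Y_def)
    have "holds_mod q h (sh v y)" if "h \<in> B" for h
    proof -
      obtain k l r where h: "h = (k, l, r)" by (cases h)
      have "int q dvd y k - y l - r" using y that unfolding h by (auto simp: mod_sols_def holds_mod_def)
      then show ?thesis
        using cong[of v y k l r] shift_class_edge[of k l r B i] that unfolding h by (simp add: holds_mod_def)
    qed
    moreover have "int q dvd sh v y i - sh v y j - (s + (a + v))"
      unfolding cong ii ij using ya by (simp add: algebra_simps)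
    ultimately show ?thesis using q by (auto simp: Y_def mod_sols_def sh_def algebra_simps)
  qed
  have inv: "sh (- v) (sh v y) = y" if "y \<in> mod_sols q B" for v y
  proof
    fix k
    have "y k \<in> {0..<int q}" using that by (auto simp: mod_sols_def)
    then show "sh (- v) (sh v y) k = y k" unfolding sh_def by (simp add: mod_simps)
  qed
  have card_eq: "card (Y v) = card (Y 0)" for v
  proof -
    have "bij_betw (sh v) (Y 0) (Y v)"
    proof (rule bij_betw_byWitness[where f' = "sh (- v)"])
      show "sh v ` Y 0 \<subseteq> Y v" using maps[of _ 0 v] by auto
      show "sh (- v) ` Y v \<subseteq> Y 0" using maps[of _ v "- v"] by auto
      show "\<forall>y\<in>Y 0. sh (- v) (sh v y) = y" using inv by (auto simp: Y_def)
      show "\<forall>y\<in>Y v. sh v (sh (- v) y) = y" using inv[of _ "- v"] by (auto simp: Y_def)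
    qed
    then show ?thesis using bij_betw_same_card by fastforce
  qed
  have "mod_sols q B = (\<Union>v\<in>{0..<int q}. Y v)"
  proof
    show "mod_sols q B \<subseteq> (\<Union>v\<in>{0..<int q}. Y v)"
    proof
      fix y assume y: "y \<in> mod_sols q B"
      let ?v = "(y i - y j - s) mod int q"
      have "?v \<in> {0..<int q}" using q by simp
      moreover have "y \<in> Y ?v" using y by (simp add: Y_def mod_eq_dvd_iff[symmetric])
      ultimately show "y \<in> (\<Union>v\<in>{0..<int q}. Y v)" by blast
    qed
  qed (auto simp: Y_def)
  moreover have "card (\<Union>v\<in>{0..<int q}. Y v) = (\<Sum>v\<in>{0..<int q}. card (Y v))"
  proof (rule card_UN_disjoint)
    show "\<forall>v\<in>{0..<int q}. finite (Y v)" using finite_mod_sols[of q B] by (auto simp: Y_def)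
    show "\<forall>v\<in>{0..<int q}. \<forall>w\<in>{0..<int q}. v \<noteq> w \<longrightarrow> Y v \<inter> Y w = {}"
    proof (intro ballI impI)
      fix v w assume vw: "v \<in> {0..<int q}" "w \<in> {0..<int q}" "v \<noteq> w"
      have False if "y \<in> Y v" "y \<in> Y w" for y
      proof -
        have "int q dvd y i - y j - s - v" "int q dvd y i - y j - s - w" using that by (auto simp: Y_def)
        then have "int q dvd (y i - y j - s - v) - (y i - y j - s - w)" by (rule dvd_diff)
        then have "int q dvd w - v" by simp
        then have "w mod int q = v mod int q" by (simp add: mod_eq_dvd_iff)
        then show False using vw by simp
      qed
      then show "Y v \<inter> Y w = {}" by blast
    qed
  qed simp
  moreover have "(\<Sum>v\<in>{0..<int q}. card (Y v)) = (\<Sum>v\<in>{0..<int q}. card (Y 0))"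
    by (rule sum.cong) (use card_eq in auto)
  ultimately have "card (mod_sols q B) = q * card (Y 0)" by simp
  moreover have "Y 0 = mod_sols q (insert (i, j, s) B)" unfolding Y_def mod_sols_insert holds_mod_def by simp
  ultimately show ?thesis by simp
qed

text \<open>If \<open>B\<close> links \<open>i\<close> and \<open>j\<close>, it forces their
  difference to an integer \<open>w\<close> over the reals and modulo \<open>q\<close> alike, and
  comparing \<open>w\<close> with \<open>s\<close> decides. Only the inconsistent case needs large
  \<open>q\<close>: a nonzero \<open>w - s\<close> must not be divisible by \<open>q\<close>. If
  they are not linked, the class of \<open>i\<close> can be shifted freely.\<close>

lemma diff_eqn_trichotomy:
  fixes B :: "'n::finite diff_eqn set"
  assumes ne: "real_sols B \<noteq> {}"
  obtains (implied) "real_sols B \<subseteq> {x. diff_val h x = 0}" "\<And>q. mod_sols q (insert h B) = mod_sols q B"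
  | (inconsistent) q0 where "real_sols (insert h B) = {}" "\<And>q. q \<ge> q0 \<Longrightarrow> mod_sols q (insert h B) = {}"
  | (independent) "real_sols (insert h B) \<noteq> {}" "\<not> real_sols B \<subseteq> {x. diff_val h x = 0}"
      "\<And>q. q \<ge> 1 \<Longrightarrow> card (mod_sols q B) = q * card (mod_sols q (insert h B))"
proof -
  obtain i j s where h: "h = (i, j, s)" by (cases h)
  show thesis
  proof (cases "\<exists>w. offset B i j w")
    case False
    obtain x where x: "x \<in> real_sols B" using ne by blast
    obtain z where "z \<in> real_sols B" "diff_val h z = 0" using unlinked_real[OF False x] unfolding h by blast
    moreover obtain z' where "z' \<in> real_sols B" "diff_val h z' = 1" using unlinked_real[OF False x] unfolding h by blast
    ultimately show thesis
      using unlinked_mod[OF False] unfolding h by (intro independent) (auto simp: h real_sols_insert)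
  next
    case True
    then obtain w where w: "offset B i j w" by blast
    show thesis
    proof (cases "w = s")
      case True
      have "real_sols B \<subseteq> {x. diff_val h x = 0}"
        using offset_real[OF w] True by (auto simp: h diff_val_def)
      moreover have "mod_sols q (insert h B) = mod_sols q B" for q
        using offset_mod[OF w] True by (auto simp: h mod_sols_insert holds_mod_def)
      ultimately show thesis by (rule implied)
    next
      case False
      have "real_sols (insert h B) = {}"
        using offset_real[OF w] False by (fastforce simp: h real_sols_insert diff_val_def)
      moreover have "mod_sols q (insert h B) = {}" if "q \<ge> nat (\<bar>w - s\<bar> + 1)" for q
      proof (rule ccontr)
        assume "mod_sols q (insert h B) \<noteq> {}"
        then obtain y where y: "y \<in> mod_sols q B" "int q dvd y i - y j - s"
          by (auto simp: h mod_sols_insert holds_mod_def)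
        have "int q dvd (y i - y j - s) - (y i - y j - w)" 
          by (rule dvd_diff[OF y(2) offset_mod[OF w y(1)]])
        then have "int q dvd w - s" by simp
        then have "int q \<le> \<bar>w - s\<bar>" using False by (intro zdvd_imp_le) (auto simp: dvd_abs_iff)
        then show False using that by linarith
      qed
      ultimately show thesis by (rule inconsistent)
    qed
  qed
qed

lemma aff_dim_real_sols_nonneg: "real_sols B \<noteq> {} \<Longrightarrow> aff_dim (real_sols B) \<ge> 0"
  using aff_dim_geq[of "real_sols B"] aff_dim_empty[of "real_sols B"] by linarith

text \<open>Each independent equation lowers the dimension by one and divides the number of points
  by \<open>q\<close>.\<close>

lemma card_mod_sols:
  fixes B :: "'n::finite diff_eqn set"
  assumes "finite B"
  shows "\<exists>q0. \<forall>q\<ge>q0. card (mod_sols q B) = (if real_sols B = {} then 0 else q ^ nat (aff_dim (real_sols B)))"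
  using assms
proof (induction B rule: finite_induct)
  case empty
  have "mod_sols q ({} :: 'n diff_eqn set) = UNIV \<rightarrow>\<^sub>E {0..<int q}" for q
    by (auto simp: mod_sols_def)
  moreover have "real_sols ({} :: 'n diff_eqn set) = UNIV" by (simp add: real_sols_def)
  ultimately show ?case by (simp add: card_PiE)
next
  case (insert h B)
  then obtain q0 where q0: "\<And>q. q \<ge> q0 \<Longrightarrow>
      card (mod_sols q B) = (if real_sols B = {} then 0 else q ^ nat (aff_dim (real_sols B)))" by blast
  show ?case
  proof (cases "real_sols B = {}")
    case True
    then have "mod_sols q B = {}" if "q \<ge> q0" for q using q0[OF that] finite_mod_sols[of q B] by simp
    then show ?thesis using True by (intro exI[of _ q0]) (simp add: real_sols_insert mod_sols_insert)
  next
    case False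
    then show ?thesis
    proof (cases rule: diff_eqn_trichotomy[of B h])
      case implied
      then have "real_sols (insert h B) = real_sols B" by (auto simp: real_sols_insert)
      then show ?thesis using implied(2) q0 by (intro exI[of _ q0]) simp
    next
      case (inconsistent q1)
      then show ?thesis by (intro exI[of _ q1]) simp
    next
      case independent
      define d where "d = nat (aff_dim (real_sols (insert h B)))"
      have "aff_dim (real_sols (insert h B)) = aff_dim (real_sols B) - 1"
        using independent by (simp add: aff_dim_real_sols_insert)
      then have d: "nat (aff_dim (real_sols B)) = Suc d"
        using aff_dim_real_sols_nonneg[OF independent(1)] unfolding d_def by linarith
      have "card (mod_sols q (insert h B)) = q ^ d" if "q \<ge> max q0 1" for q
        using that q0[of q] False independent(3)[of q] d by auto
      then show ?thesis using independent(1) unfolding d_def by metis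
    qed
  qed
qed

text \<open>These stand for the regions of \<open>A\<close> inside the flat of \<open>B\<close>: no
  hyperplane of \<open>A\<close> meets a region, so the set of its positive hyperplanes determines
  it.\<close>

definition sign_patterns :: "'n::finite diff_eqn set \<Rightarrow> 'n diff_eqn set \<Rightarrow> 'n diff_eqn set set" where
  "sign_patterns B A = (\<lambda>x. {h\<in>A. diff_val h x > 0}) ` {x\<in>real_sols B. \<forall>h\<in>A. diff_val h x \<noteq> 0}"

definition mod_avoiding :: "nat \<Rightarrow> 'n::finite diff_eqn set \<Rightarrow> 'n diff_eqn set \<Rightarrow> ('n \<Rightarrow> int) set" where
  "mod_avoiding q B A = {y\<in>mod_sols q B. \<forall>h\<in>A. \<not> holds_mod q h y}"

lemma finite_sign_patterns: "finite A \<Longrightarrow> finite (sign_patterns B A)"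
  by (rule finite_subset[of _ "Pow A"]) (auto simp: sign_patterns_def)

text \<open>Finitely many nonzero values keep their signs near \<open>x\<close>. Both signs of
  \<open>t\<close> are allowed, so that a point on a further hyperplane can be pushed to either side
  along one line.\<close>

lemma perturb:
  fixes x z :: "real ^ 'n::finite"
  assumes A: "finite A" "\<forall>h\<in>A. diff_val h x \<noteq> 0" and x: "x \<in> real_sols B" "z \<in> real_sols B"
  obtains e where "e > 0" "\<And>t. \<bar>t\<bar> \<le> e \<Longrightarrow> (1 - t) *\<^sub>R x + t *\<^sub>R z \<in> real_sols B"
    "\<And>t h. \<bar>t\<bar> \<le> e \<Longrightarrow> h \<in> A \<Longrightarrow> sgn (diff_val h ((1 - t) *\<^sub>R x + t *\<^sub>R z)) = sgn (diff_val h x)"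
proof -
  let ?p = "\<lambda>t. (1 - t) *\<^sub>R x + t *\<^sub>R z"
  have "\<forall>\<^sub>F t in nhds 0. sgn (diff_val h (?p t)) = sgn (diff_val h x)" if "h \<in> A" for h
  proof -
    have lim: "((\<lambda>t. diff_val h (?p t)) \<longlongrightarrow> diff_val h x) (nhds 0)"
      unfolding diff_val_affine_combination by (auto intro!: tendsto_eq_intros filterlim_ident)
    show ?thesis
    proof (cases "diff_val h x > 0")
      case True
      then show ?thesis using order_tendstoD(1)[OF lim, of 0] by (auto elim: eventually_mono)
    next
      case False
      then have "diff_val h x < 0" using A(2) that by force
      then show ?thesis using order_tendstoD(2)[OF lim, of 0] by (auto elim: eventually_mono)
    qed
  qed
  then have "\<forall>\<^sub>F t in nhds 0. \<forall>h\<in>A. sgn (diff_val h (?p t)) = sgn (diff_val h x)"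
    using A(1) by (simp add: eventually_ball_finite)
  then obtain e where e: "e > 0" "\<And>t. dist t 0 < e \<Longrightarrow> \<forall>h\<in>A. sgn (diff_val h (?p t)) = sgn (diff_val h x)"
    unfolding eventually_nhds_metric by blast
  show thesis
  proof (rule that[of "e / 2"])
    show "?p t \<in> real_sols B" for t
      using x by (simp add: real_sols_def diff_val_affine_combination)
  qed (use e in auto)
qed

text \<open>\<open>Xp\<close> and \<open>Xn\<close> collect the regions of \<open>A\<close> that
  reach the positive and the negative side of \<open>h\<close>. Together they are all regions; those
  in both are the ones met by \<open>h\<close>, that is, the regions of the restriction, and
  \<open>h\<close> cuts each of them in two.\<close>

lemma card_sign_patterns_insert:
  assumes A: "finite A" "h \<notin> A" and nsub: "\<not> real_sols B \<subseteq> {x. diff_val h x = 0}"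
  shows "card (sign_patterns B (insert h A)) = card (sign_patterns B A) + card (sign_patterns (insert h B) A)"
proof -
  let ?pat = "\<lambda>x. {g\<in>A. diff_val g x > 0}"
  let ?R = "{x\<in>real_sols B. \<forall>g\<in>A. diff_val g x \<noteq> 0}"
  define Xp where "Xp = ?pat ` {x\<in>?R. diff_val h x > 0}"
  define Xn where "Xn = ?pat ` {x\<in>?R. diff_val h x < 0}"
  obtain z where z: "z \<in> real_sols B" "diff_val h z \<noteq> 0" using nsub by auto
  have both: "?pat x \<in> Xp \<and> ?pat x \<in> Xn" if x: "x \<in> ?R" "diff_val h x = 0" for x
  proof -
    obtain e where e: "e > 0" "\<And>t. \<bar>t\<bar> \<le> e \<Longrightarrow> (1 - t) *\<^sub>R x + t *\<^sub>R z \<in> real_sols B"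
      "\<And>t g. \<bar>t\<bar> \<le> e \<Longrightarrow> g \<in> A \<Longrightarrow> sgn (diff_val g ((1 - t) *\<^sub>R x + t *\<^sub>R z)) = sgn (diff_val g x)"
      using perturb[of A x B z] A x z by auto
    have w: "(1 - t) *\<^sub>R x + t *\<^sub>R z \<in> ?R" "?pat ((1 - t) *\<^sub>R x + t *\<^sub>R z) = ?pat x"
      "diff_val h ((1 - t) *\<^sub>R x + t *\<^sub>R z) = t * diff_val h z" if t: "\<bar>t\<bar> \<le> e" for t
    proof -
      have "diff_val g ((1 - t) *\<^sub>R x + t *\<^sub>R z) \<noteq> 0" "diff_val g ((1 - t) *\<^sub>R x + t *\<^sub>R z) > 0 \<longleftrightarrow> diff_val g x > 0"
        if g: "g \<in> A" for g
      proof -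
        have "diff_val g x \<noteq> 0" using x(1) g by blast
        then show "diff_val g ((1 - t) *\<^sub>R x + t *\<^sub>R z) \<noteq> 0"
          "diff_val g ((1 - t) *\<^sub>R x + t *\<^sub>R z) > 0 \<longleftrightarrow> diff_val g x > 0"
          using e(3)[OF t g] by (auto simp: sgn_if split: if_splits)
      qed
      then show "(1 - t) *\<^sub>R x + t *\<^sub>R z \<in> ?R" "?pat ((1 - t) *\<^sub>R x + t *\<^sub>R z) = ?pat x"
        using e(2)[OF t] by auto
      show "diff_val h ((1 - t) *\<^sub>R x + t *\<^sub>R z) = t * diff_val h z"
        using x(2) by (simp add: diff_val_affine_combination)
    qed
    define t where "t = (if diff_val h z > 0 then e else - e)"
    have t: "\<bar>t\<bar> \<le> e" "\<bar>- t\<bar> \<le> e" "t * diff_val h z > 0" "(- t) * diff_val h z < 0"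
      using e(1) z(2) unfolding t_def by (auto simp: mult_neg_neg mult_less_0_iff)
    have "?pat x \<in> Xp" unfolding Xp_def
      by (rule image_eqI[where f = ?pat, OF w(2)[OF t(1), symmetric]]) (use w(1,3)[OF t(1)] t(3) in simp)
    moreover have "?pat x \<in> Xn" unfolding Xn_def
      by (rule image_eqI[where f = ?pat, OF w(2)[OF t(2), symmetric]]) (use w(1,3)[OF t(2)] t(4) in simp)
    ultimately show ?thesis ..
  qed
  have un: "Xp \<union> Xn = sign_patterns B A"
  proof
    show "Xp \<union> Xn \<subseteq> sign_patterns B A" by (auto simp: Xp_def Xn_def sign_patterns_def)
    show "sign_patterns B A \<subseteq> Xp \<union> Xn"
    proof
      fix P assume "P \<in> sign_patterns B A"
      then obtain x where x: "x \<in> ?R" "P = ?pat x" by (auto simp: sign_patterns_def)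
      consider "diff_val h x > 0" | "diff_val h x < 0" | "diff_val h x = 0" by linarith
      then show "P \<in> Xp \<union> Xn"
        using x both[OF x(1)] unfolding Xp_def Xn_def by cases auto
    qed
  qed
  have int: "Xp \<inter> Xn = sign_patterns (insert h B) A"
  proof
    show "sign_patterns (insert h B) A \<subseteq> Xp \<inter> Xn"
    proof
      fix P assume "P \<in> sign_patterns (insert h B) A"
      then obtain x where "x \<in> ?R" "diff_val h x = 0" "P = ?pat x"
        by (auto simp: sign_patterns_def real_sols_insert)
      then show "P \<in> Xp \<inter> Xn" using both[of x] by simp
    qed
    show "Xp \<inter> Xn \<subseteq> sign_patterns (insert h B) A"
    proof
      fix P assume "P \<in> Xp \<inter> Xn"
      then obtain x w where x: "x \<in> ?R" "diff_val h x > 0" "P = ?pat x"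
        and w: "w \<in> ?R" "diff_val h w < 0" "P = ?pat w" by (auto simp: Xp_def Xn_def)
      \<comment> \<open>The segment from \<open>x\<close> to \<open>w\<close> crosses
        \<open>h\<close> at this parameter; all other signs agree at its ends and hence along
        it.\<close>
      define t where "t = diff_val h x / (diff_val h x - diff_val h w)"
      have t: "0 < t" "t < 1" using x w by (auto simp: t_def field_simps)
      let ?v = "(1 - t) *\<^sub>R x + t *\<^sub>R w"
      have "diff_val h ?v = 0"
        using x w unfolding diff_val_affine_combination t_def by (simp add: field_simps)
      moreover have "diff_val g ?v \<noteq> 0 \<and> (diff_val g ?v > 0 \<longleftrightarrow> diff_val g x > 0)" if g: "g \<in> A" for g
      proof (cases "diff_val g x > 0")
        case True
        then have "diff_val g w > 0" using x(3) w(3) g by auto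
        then have "diff_val g ?v > 0" using True t unfolding diff_val_affine_combination by (simp add: add_pos_pos)
        then show ?thesis using True by simp
      next
        case False
        then have "g \<notin> ?pat w" using x(3) w(3) by auto
        moreover have "diff_val g w \<noteq> 0" using w(1) g by blast
        ultimately have "diff_val g w < 0" using g by simp
        moreover have "diff_val g x < 0" using False x(1) g by (auto simp: not_less_iff_gr_or_eq)
        ultimately have "diff_val g ?v < 0"
          using t unfolding diff_val_affine_combination by (simp add: add_neg_neg mult_pos_neg)
        then show ?thesis using False by simp
      qed
      moreover have "?v \<in> real_sols B"
        using x(1) w(1) by (simp add: real_sols_def diff_val_affine_combination)
      ultimately have "?v \<in> {x\<in>real_sols (insert h B). \<forall>g\<in>A. diff_val g x \<noteq> 0}" "?pat ?v = P"
        using x(3) by (auto simp: real_sols_insert)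
      then show "P \<in> sign_patterns (insert h B) A" unfolding sign_patterns_def by blast
    qed
  qed
  have "sign_patterns B (insert h A) = insert h ` Xp \<union> Xn"
  proof
    show "sign_patterns B (insert h A) \<subseteq> insert h ` Xp \<union> Xn"
    proof
      fix P assume "P \<in> sign_patterns B (insert h A)"
      then obtain x where x: "x \<in> ?R" "diff_val h x \<noteq> 0" "P = {g\<in>insert h A. diff_val g x > 0}"
        by (auto simp: sign_patterns_def)
      show "P \<in> insert h ` Xp \<union> Xn"
      proof (cases "diff_val h x > 0")
        case True
        then have "P = insert h (?pat x)" using x(3) by auto
        then show ?thesis using True x(1) by (auto simp: Xp_def)
      next
        case False
        then have "P = ?pat x" "diff_val h x < 0" using x(2,3) by auto
        then show ?thesis using x(1) by (auto simp: Xn_def)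
      qed
    qed
    show "insert h ` Xp \<union> Xn \<subseteq> sign_patterns B (insert h A)"
    proof
      fix P assume "P \<in> insert h ` Xp \<union> Xn"
      then consider x where "x \<in> ?R" "diff_val h x > 0" "P = insert h (?pat x)"
        | x where "x \<in> ?R" "diff_val h x < 0" "P = ?pat x"
        unfolding Xp_def Xn_def by auto
      then obtain x where x: "x \<in> ?R" "diff_val h x \<noteq> 0" "P = {g\<in>insert h A. diff_val g x > 0}"
      proof cases
        case (1 x)
        then show thesis by (intro that[of x]) auto
      next
        case (2 x)
        then show thesis by (intro that[of x]) auto
      qed
      then show "P \<in> sign_patterns B (insert h A)"
        unfolding sign_patterns_def by (intro image_eqI[where x = x] x(3)) simp
    qed
  qed
  moreover have "finite Xp" "finite Xn" using un finite_sign_patterns[OF A(1), of B] by (metis finite_Un)+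
  moreover have "insert h ` Xp \<inter> Xn = {}" "inj_on (insert h) Xp"
    using A(2) by (auto simp: Xp_def Xn_def inj_on_def)
  ultimately have "card (sign_patterns B (insert h A)) = card Xp + card Xn"
    by (simp add: card_Un_disjoint card_image)
  also have "\<dots> = card (Xp \<union> Xn) + card (Xp \<inter> Xn)"
    using \<open>finite Xp\<close> \<open>finite Xn\<close> by (rule card_Un_Int)
  finally show ?thesis unfolding un int .
qed

text \<open>Deletion and restriction act in the same way on the regions of an arrangement inside a flat and, up
  to sign, on the number of points modulo \<open>q\<close> that avoid it.\<close>

lemma sign_patterns_reciprocity:
  fixes A B :: "'n::finite diff_eqn set"
  assumes "finite A" "finite B"
  shows "\<exists>p :: real poly. (\<exists>q0. \<forall>q\<ge>q0. real (card (mod_avoiding q B A)) = poly p (real q)) \<and>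
    real (card (sign_patterns B A)) = (-1) ^ nat (aff_dim (real_sols B)) * poly p (-1)"
  using assms
proof (induction A arbitrary: B rule: finite_induct)
  case empty
  let ?d = "nat (aff_dim (real_sols B))"
  \<comment> \<open>A flat of dimension \<open>d\<close> has \<open>q ^ d\<close> points for large
    \<open>q\<close>. At -1 this is the sign \<open>(-1) ^ d\<close>, which cancels against the
    factor in the claim and leaves one region.\<close>
  define p :: "real poly" where "p = (if real_sols B = {} then 0 else monom 1 ?d)"
  have "card (sign_patterns B {}) = (if real_sols B = {} then 0 else 1)"
    by (auto simp: sign_patterns_def image_constant_conv)
  then have "real (card (sign_patterns B {})) = (-1) ^ ?d * poly p (-1)"
    by (simp add: p_def poly_monom flip: power_mult_distrib)
  moreover have "\<exists>q0. \<forall>q\<ge>q0. real (card (mod_avoiding q B {})) = poly p (real q)"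
  proof -
    obtain q0 where "\<And>q. q \<ge> q0 \<Longrightarrow>
        card (mod_sols q B) = (if real_sols B = {} then 0 else q ^ nat (aff_dim (real_sols B)))"
      using card_mod_sols[OF empty] by blast
    then show ?thesis by (intro exI[of _ q0]) (simp add: mod_avoiding_def p_def poly_monom)
  qed
  ultimately show ?case by blast
next
  case (insert h A)
  show ?case
  proof (cases "real_sols B \<subseteq> {x. diff_val h x = 0}")
    case True
    \<comment> \<open>A hyperplane containing the flat leaves no region and, for large
      \<open>q\<close>, no modular point, so the zero polynomial serves.\<close>
    have "sign_patterns B (insert h A) = {}" using True by (auto simp: sign_patterns_def)
    moreover have "\<exists>q0. \<forall>q\<ge>q0. mod_avoiding q B (insert h A) = {}"
    proof (cases "real_sols B = {}")
      case empty: True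
      then obtain q0 where q0: "\<And>q. q \<ge> q0 \<Longrightarrow> card (mod_sols q B) = 0"
        using card_mod_sols[OF insert.prems] by auto
      have "mod_sols q B = {}" if "q \<ge> q0" for q using q0[OF that] finite_mod_sols[of q B] by simp
      then show ?thesis by (intro exI[of _ q0]) (simp add: mod_avoiding_def)
    next
      case False
      then show ?thesis
      proof (cases rule: diff_eqn_trichotomy[of B h])
        case implied
        then have "holds_mod q h y" if "y \<in> mod_sols q B" for q y
          using that by (metis (no_types, lifting) mem_Collect_eq mod_sols_insert)
        then show ?thesis by (auto simp: mod_avoiding_def)
      next
        case (inconsistent q0)
        then show ?thesis using True False by (auto simp: real_sols_insert)
      next
        case independent
        then show ?thesis using True by simp
      qed
    qed
    then obtain q0 where "\<And>q. q \<ge> q0 \<Longrightarrow> mod_avoiding q B (insert h A) = {}" by blast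
    ultimately show ?thesis by (intro exI[of _ 0] conjI exI[of _ q0]) auto
  next
    case False
    then have ne: "real_sols B \<noteq> {}" by auto
    obtain p1 q1 where p1: "\<And>q. q \<ge> q1 \<Longrightarrow> real (card (mod_avoiding q B A)) = poly p1 (real q)"
      "real (card (sign_patterns B A)) = (-1) ^ nat (aff_dim (real_sols B)) * poly p1 (-1)"
      using insert.IH[OF insert.prems] by blast
    have finB: "finite (insert h B)" using insert.prems by simp
    obtain p2 q2 where p2: "\<And>q. q \<ge> q2 \<Longrightarrow> real (card (mod_avoiding q (insert h B) A)) = poly p2 (real q)"
      "real (card (sign_patterns (insert h B) A)) = (-1) ^ nat (aff_dim (real_sols (insert h B))) * poly p2 (-1)"
      using insert.IH[OF finB] by blast
    have "real (card (mod_avoiding q B (insert h A))) = poly (p1 - p2) (real q)" if "q \<ge> max q1 q2" for q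
    proof -
      have fin: "finite (mod_avoiding q B A)" using finite_mod_sols[of q B] by (simp add: mod_avoiding_def)
      have sub: "mod_avoiding q (insert h B) A \<subseteq> mod_avoiding q B A"
        by (auto simp: mod_avoiding_def mod_sols_insert)
      have "mod_avoiding q B (insert h A) = mod_avoiding q B A - mod_avoiding q (insert h B) A"
        by (auto simp: mod_avoiding_def mod_sols_insert)
      then have "real (card (mod_avoiding q B (insert h A)))
          = real (card (mod_avoiding q B A)) - real (card (mod_avoiding q (insert h B) A))"
        using card_Diff_subset[OF finite_subset[OF sub fin] sub] card_mono[OF fin sub] by (simp add: of_nat_diff)
      then show ?thesis using p1(1) p2(1) that by simp
    qed
    moreover have "real (card (sign_patterns B (insert h A))) =
        (-1) ^ nat (aff_dim (real_sols B)) * poly (p1 - p2) (-1)"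
    proof (cases "real_sols (insert h B) = {}")
      case True
      then have "sign_patterns (insert h B) A = {}" by (auto simp: sign_patterns_def)
      then have "poly p2 (-1) = 0" using p2(2) by simp
      then show ?thesis
        using card_sign_patterns_insert[OF insert.hyps(1,2) False] p1(2) \<open>sign_patterns (insert h B) A = {}\<close>
        by simp
    next
      case nonempty: False
      \<comment> \<open>The restriction has one dimension less, so its opposite sign turns the
        difference of the polynomials into the sum of the region counts.\<close>
      have "aff_dim (real_sols B) = aff_dim (real_sols (insert h B)) + 1"
        using nonempty False by (simp add: aff_dim_real_sols_insert)
      then have "nat (aff_dim (real_sols B)) = Suc (nat (aff_dim (real_sols (insert h B))))"
        using aff_dim_real_sols_nonneg[OF nonempty] by linarith
      then show ?thesis
        using card_sign_patterns_insert[OF insert.hyps(1,2) False] p1(2) p2(2) by (simp add: algebra_simps)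
    qed
    ultimately show ?thesis by blast
  qed
qed

section \<open>Cyclic configurations\<close>

text \<open>In a cyclic configuration \<open>y\<close> modulo \<open>q\<close>, the label \<open>b\<close> lies ahead of \<open>a\<close> and on a common hyperplane
  with it iff \<open>y b - y a\<close> is congruent to an element of \<open>ahead_window m a b\<close>; every hyperplane of the
  arrangement arises exactly once in this way. A leader is the last label of its cluster.\<close>

definition ahead_window :: "nat \<Rightarrow> 'a::linorder \<Rightarrow> 'a \<Rightarrow> int set" where
  "ahead_window m a b = (if a < b then {0..int m - 1} else {1..int m})"

definition ahead :: "nat \<Rightarrow> nat \<Rightarrow> ('a::linorder \<Rightarrow> int) \<Rightarrow> 'a \<Rightarrow> 'a \<Rightarrow> bool" where
  "ahead m q y a b \<longleftrightarrow> (\<exists>d\<in>ahead_window m a b. int q dvd y b - y a - d)"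

definition leaders :: "nat \<Rightarrow> nat \<Rightarrow> 'a::linorder set \<Rightarrow> ('a \<Rightarrow> int) \<Rightarrow> 'a set" where
  "leaders m q N y = {a\<in>N. \<forall>b\<in>N - {a}. \<not> ahead m q y a b}"

lemma card_ahead_window: "card (ahead_window m a b) = m" "finite (ahead_window m a b)"
  by (auto simp: ahead_window_def)

lemma card_residues:
  assumes "D \<subseteq> {0..int m}" "m < q"
  shows "card {v\<in>{0..<int q}. \<exists>d\<in>D. int q dvd v - c - d} = card D"
proof -
  have "{v\<in>{0..<int q}. \<exists>d\<in>D. int q dvd v - c - d} = (\<lambda>d. (c + d) mod int q) ` D"
  proof
    show "{v\<in>{0..<int q}. \<exists>d\<in>D. int q dvd v - c - d} \<subseteq> (\<lambda>d. (c + d) mod int q) ` D"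
    proof
      fix v assume "v \<in> {v\<in>{0..<int q}. \<exists>d\<in>D. int q dvd v - c - d}"
      then obtain d where d: "d \<in> D" "int q dvd v - c - d" "0 \<le> v" "v < int q" by auto
      have "int q dvd v - (c + d)" using d(2) by (simp add: algebra_simps)
      then have "v mod int q = (c + d) mod int q" by (simp add: mod_eq_dvd_iff)
      then have "v = (c + d) mod int q" using d by simp
      then show "v \<in> (\<lambda>d. (c + d) mod int q) ` D" using d(1) by blast
    qed
    show "(\<lambda>d. (c + d) mod int q) ` D \<subseteq> {v\<in>{0..<int q}. \<exists>d\<in>D. int q dvd v - c - d}"
    proof
      fix v assume "v \<in> (\<lambda>d. (c + d) mod int q) ` D"
      then obtain d where d: "d \<in> D" "v = (c + d) mod int q" by auto
      have "v mod int q = (c + d) mod int q" using d by simp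
      then have "int q dvd v - c - d" by (simp add: mod_eq_dvd_iff algebra_simps)
      then show "v \<in> {v\<in>{0..<int q}. \<exists>d\<in>D. int q dvd v - c - d}" using d assms(2) by auto
    qed
  qed
  moreover have "inj_on (\<lambda>d. (c + d) mod int q) D"
  proof (rule inj_onI)
    fix d e assume de: "d \<in> D" "e \<in> D" "(c + d) mod int q = (c + e) mod int q"
    then have "int q dvd d - e" by (simp add: mod_eq_dvd_iff)
    then have "d mod int q = e mod int q" by (simp add: mod_eq_dvd_iff)
    moreover have "0 \<le> d" "d < int q" "0 \<le> e" "e < int q" using de assms by force+
    ultimately show "d = e" by simp
  qed
  ultimately show ?thesis by (simp add: card_image)
qed

lemma ahead_window_bounds: "ahead_window m a b \<subseteq> {0..int m}"
  by (auto simp: ahead_window_def)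

text \<open>Fewer than \<open>q\<close> starting points are within distance \<open>m\<close> of a label, so the circle can be cut open.\<close>

lemma cyclic_lift:
  fixes y :: "'a::linorder \<Rightarrow> int"
  assumes "finite N" "m * card N < q"
  shows "\<exists>u :: 'a \<Rightarrow> int. \<forall>a\<in>N. \<forall>b\<in>N. \<forall>s. \<bar>s\<bar> \<le> int m \<longrightarrow> (int q dvd y b - y a - s \<longleftrightarrow> u b - u a = s)"
proof (cases "N = {}")
  case False
  have mq: "m < q"
  proof -
    have "card N \<ge> 1" using False assms(1) by (simp add: Suc_le_eq card_gt_0_iff)
    then have "m * 1 \<le> m * card N" by (intro mult_le_mono2)
    then show ?thesis using assms(2) by linarith
  qed
  \<comment> \<open>The cuts \<open>c\<close> that lie 1 to \<open>m\<close> steps after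
    \<open>y a\<close>. A cut that is bad for no label leaves a gap after every label, so that no
    step of length up to \<open>m\<close> crosses it.\<close>
  define bad where "bad a = {c\<in>{0..<int q}. \<exists>d\<in>{1..int m}. int q dvd c - y a - d}" for a
  have "card (bad a) = m" for a
    unfolding bad_def using card_residues[of "{1..int m}" m q "y a"] mq by simp
  then have "card (\<Union>a\<in>N. bad a) \<le> card N * m"
    using card_UN_le[OF assms(1), of bad] by simp
  then have "card (\<Union>a\<in>N. bad a) < card {0..<int q}" using assms(2) by (simp add: mult.commute)
  then have "\<not> {0..<int q} \<subseteq> (\<Union>a\<in>N. bad a)"
  proof -
    have "finite (bad a)" for a by (rule finite_subset[of _ "{0..<int q}"]) (auto simp: bad_def)
    then have "finite (\<Union>a\<in>N. bad a)" using assms(1) by simp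
    then show ?thesis using \<open>card (\<Union>a\<in>N. bad a) < card {0..<int q}\<close> card_mono by (metis not_le)
  qed
  then obtain c where c: "c \<in> {0..<int q}" "\<And>a. a \<in> N \<Longrightarrow> c \<notin> bad a" by blast
  define u where "u a = (y a - c) mod int q" for a
  have u: "0 \<le> u a" "u a < int q - int m" if a: "a \<in> N" for a
  proof -
    show "0 \<le> u a" using mq by (simp add: u_def)
    have uq: "u a < int q" using mq by (simp add: u_def)
    show "u a < int q - int m"
    proof (rule ccontr)
      assume "\<not> ?thesis"
      then have "int q - u a \<in> {1..int m}" using uq by auto
      moreover have "int q dvd c - y a - (int q - u a)"
      proof -
        have "int q dvd (y a - c) - u a" by (simp add: u_def mod_eq_dvd_iff[symmetric])
        then have "int q dvd - ((y a - c) - u a)" by (simp only: dvd_minus_iff)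
        then have "int q dvd - ((y a - c) - u a) - int q" by (rule dvd_diff) simp
        then show ?thesis by (simp add: algebra_simps)
      qed
      ultimately have "c \<in> bad a" using c(1) unfolding bad_def by blast
      then show False using c(2)[OF a] by simp
    qed
  qed
  have "int q dvd y b - y a - s \<longleftrightarrow> u b - u a = s" if ab: "a \<in> N" "b \<in> N" and s: "\<bar>s\<bar> \<le> int m" for a b s
  proof -
    have "(u b - u a - s) mod int q = (y b - y a - s) mod int q"
    proof -
      have "(u b - u a) mod int q = ((y b - c) - (y a - c)) mod int q" unfolding u_def by (rule mod_diff_eq)
      also have "(y b - c) - (y a - c) = y b - y a" by simp
      finally show ?thesis by (rule mod_diff_cong) simp
    qed
    then have "int q dvd y b - y a - s \<longleftrightarrow> int q dvd u b - u a - s" by (simp add: dvd_eq_mod_eq_0)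
    also have "\<dots> \<longleftrightarrow> u b - u a = s"
    proof
      assume dvd: "int q dvd u b - u a - s"
      have "\<bar>u b - u a - s\<bar> < int q" using u[OF ab(1)] u[OF ab(2)] s by linarith
      then show "u b - u a = s" using dvd zdvd_imp_le[of "int q" "\<bar>u b - u a - s\<bar>"] by (cases "u b - u a = s") auto
    qed simp
    finally show ?thesis .
  qed
  then show ?thesis by blast
qed simp

lemma ahead_lift:
  assumes "\<forall>s. \<bar>s\<bar> \<le> int m \<longrightarrow> (int q dvd y b - y a - s \<longleftrightarrow> u b - u a = s)"
  shows "ahead m q y a b \<longleftrightarrow> u b - u a \<in> ahead_window m a b"
proof -
  have "\<bar>d\<bar> \<le> int m" if "d \<in> ahead_window m a b" for d
    using that ahead_window_bounds[of m a b] by auto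
  then show ?thesis unfolding ahead_def using assms by auto
qed

text \<open>After cutting the circle open, take the last position and among its labels the largest.
  Ties are broken this way because a label at distance 0 is ahead only if it is larger.\<close>

lemma leaders_nonempty:
  assumes "finite N" "N \<noteq> {}" "m * card N < q"
  shows "leaders m q N y \<noteq> {}"
proof -
  obtain u where u: "\<And>a b. a \<in> N \<Longrightarrow> b \<in> N \<Longrightarrow> \<forall>s. \<bar>s\<bar> \<le> int m \<longrightarrow> (int q dvd y b - y a - s \<longleftrightarrow> u b - u a = s)"
    using cyclic_lift[OF assms(1,3), of y] by blast
  define v where "v = Max (u ` N)"
  define a where "a = Max {a\<in>N. u a = v}"
  have "v \<in> u ` N" unfolding v_def using assms by (intro Max_in) auto
  then have "{a\<in>N. u a = v} \<noteq> {}" by auto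
  then have a: "a \<in> N" "u a = v" unfolding a_def using assms(1) Max_in[of "{a\<in>N. u a = v}"] by auto
  have le: "u b \<le> v" if "b \<in> N" for b unfolding v_def using that assms(1) by simp
  have eq: "b \<le> a" if "b \<in> N" "u b = v" for b unfolding a_def using that assms(1) by simp
  have "\<not> ahead m q y a b" if b: "b \<in> N - {a}" for b
  proof
    assume "ahead m q y a b"
    then have "u b - u a \<in> ahead_window m a b" using ahead_lift[of m q y b a u, OF u[OF a(1)]] b by simp
    then show False using le[of b] eq[of b] a b by (auto simp: ahead_window_def split: if_splits)
  qed
  then have "a \<in> leaders m q N y" using a by (simp add: leaders_def)
  then show ?thesis by blast
qed

text \<open>If \<open>v\<close> is in reach of two positions, the position farther from
  \<open>v\<close> has the other one in reach. The boundary values fit: \<open>d - d' = m\<close>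
  would need \<open>b < a\<close> and \<open>a' < b\<close>, and \<open>d = d'\<close> is covered by
  the 0 in \<open>ahead_window m a a'\<close>.\<close>

lemma blocked_disjoint:
  assumes "a < a'" "b \<noteq> a" "b \<noteq> a'" "\<not> ahead m q z a a'" "\<not> ahead m q z a' a"
    and "d \<in> ahead_window m a b" "int q dvd v - z a - d"
    and "d' \<in> ahead_window m a' b" "int q dvd v - z a' - d'"
  shows False
proof -
  have "int q dvd (v - z a - d) - (v - z a' - d')" using assms(7,9) by (rule dvd_diff)
  then have D: "int q dvd z a' - z a - (d - d')" by (simp add: algebra_simps)
  have "int q dvd (v - z a' - d') - (v - z a - d)" using assms(9,7) by (rule dvd_diff)
  then have D': "int q dvd z a - z a' - (d' - d)" by (simp add: algebra_simps)
  show False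
  proof (cases "d - d' \<ge> 0")
    case True
    then have "d - d' \<in> ahead_window m a a'"
      using assms(1-3,6,8) by (auto simp: ahead_window_def split: if_splits)
    then show False using D assms(4) unfolding ahead_def by blast
  next
    case False
    then have "d' - d \<in> ahead_window m a' a"
      using assms(1-3,6,8) by (auto simp: ahead_window_def split: if_splits)
    then show False using D' assms(5) unfolding ahead_def by blast
  qed
qed

definition cyclic_configs :: "nat \<Rightarrow> 'a set \<Rightarrow> ('a \<Rightarrow> int) set" where
  "cyclic_configs q N = N \<rightarrow>\<^sub>E {0..<int q}"

lemma finite_cyclic_configs: "finite N \<Longrightarrow> finite (cyclic_configs q N)"
  unfolding cyclic_configs_def by (intro finite_PiE) auto

text \<open>Each leader blocks the \<open>m\<close> positions of its window, and the windows of
  different leaders are disjoint by \<open>blocked_disjoint\<close>.\<close>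

lemma card_free_positions:
  assumes "finite J" "b \<notin> J" "J \<subseteq> leaders m q N g" "J \<subseteq> N" "m * card J < q"
  shows "card {v\<in>{0..<int q}. \<forall>a\<in>J. \<not> (\<exists>d\<in>ahead_window m a b. int q dvd v - g a - d)} = q - m * card J"
proof (cases "J = {}")
  case False
  have mq: "m < q"
  proof -
    have "card J \<ge> 1" using False assms(1) by (simp add: Suc_le_eq card_gt_0_iff)
    then have "m * 1 \<le> m * card J" by (intro mult_le_mono2)
    then show ?thesis using assms(5) by linarith
  qed
  define W where "W a = {v\<in>{0..<int q}. \<exists>d\<in>ahead_window m a b. int q dvd v - g a - d}" for a
  have cW: "card (W a) = m" for a
    unfolding W_def using card_residues[OF ahead_window_bounds mq, of a b "g a"] by (simp add: card_ahead_window)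
  have finW: "finite (W a)" for a by (rule finite_subset[of _ "{0..<int q}"]) (auto simp: W_def)
  have disj: "W a \<inter> W a' = {}" if aa: "a \<in> J" "a' \<in> J" "a < a'" for a a'
  proof -
    have "\<not> ahead m q g a a'" "\<not> ahead m q g a' a"
      using assms(3,4) aa unfolding leaders_def by force+
    moreover have "b \<noteq> a" "b \<noteq> a'" using assms(2) aa by auto
    ultimately show ?thesis
      using blocked_disjoint[of a a' b m q g] aa(3) unfolding W_def by blast
  qed
  have "card (\<Union>a\<in>J. W a) = (\<Sum>a\<in>J. card (W a))"
  proof (rule card_UN_disjoint[OF assms(1)])
    show "\<forall>a\<in>J. finite (W a)" using finW by simp
    show "\<forall>a\<in>J. \<forall>a'\<in>J. a \<noteq> a' \<longrightarrow> W a \<inter> W a' = {}"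
    proof (intro ballI impI)
      fix a a' assume "a \<in> J" "a' \<in> J" "a \<noteq> a'"
      then show "W a \<inter> W a' = {}" using disj[of a a'] disj[of a' a] by (metis Int_commute linorder_neqE)
    qed
  qed
  then have "card (\<Union>a\<in>J. W a) = m * card J" using cW by simp
  moreover have "{v\<in>{0..<int q}. \<forall>a\<in>J. \<not> (\<exists>d\<in>ahead_window m a b. int q dvd v - g a - d)} = {0..<int q} - (\<Union>a\<in>J. W a)"
    unfolding W_def by blast
  moreover have "(\<Union>a\<in>J. W a) \<subseteq> {0..<int q}" "finite (\<Union>a\<in>J. W a)" using assms(1) finW by (auto simp: W_def)
  ultimately show ?thesis by (simp add: card_Diff_subset)
next
  case True
  then have "{v\<in>{0..<int q}. \<forall>a\<in>J. \<not> (\<exists>d\<in>ahead_window m a b. int q dvd v - g a - d)} = {0..<int q}" by blast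
  then show ?thesis using True by simp
qed

text \<open>Adding \<open>b\<close> keeps \<open>J\<close> among the leaders iff its position avoids
  the windows of \<open>J\<close>, whatever the remaining labels do.\<close>

lemma card_leaders_superset_step:
  assumes "finite N" "J \<subseteq> N" "b \<notin> N" "m * card J < q"
  shows "card {y\<in>cyclic_configs q (insert b N). J \<subseteq> leaders m q (insert b N) y} =
    (q - m * card J) * card {y\<in>cyclic_configs q N. J \<subseteq> leaders m q N y}"
proof -
  define free where "free g = {v\<in>{0..<int q}. \<forall>a\<in>J. \<not> (\<exists>d\<in>ahead_window m a b. int q dvd v - g a - d)}" for g
  define S where "S = {y\<in>cyclic_configs q N. J \<subseteq> leaders m q N y}"
  define \<phi> :: "('a \<Rightarrow> int) \<times> int \<Rightarrow> 'a \<Rightarrow> int" where "\<phi> = (\<lambda>(g, v). g(b := v))"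
  have key: "J \<subseteq> leaders m q (insert b N) (g(b := v)) \<longleftrightarrow>
      J \<subseteq> leaders m q N g \<and> (\<forall>a\<in>J. \<not> (\<exists>d\<in>ahead_window m a b. int q dvd v - g a - d))" for g v
  proof -
    have "a \<in> leaders m q (insert b N) (g(b := v)) \<longleftrightarrow>
        a \<in> leaders m q N g \<and> \<not> (\<exists>d\<in>ahead_window m a b. int q dvd v - g a - d)" if a: "a \<in> J" for a
    proof -
      have aN: "a \<in> N" "a \<noteq> b" using a assms(2,3) by auto
      have "ahead m q (g(b := v)) a c \<longleftrightarrow> ahead m q g a c" if "c \<in> N" for c
        using that aN assms(3) unfolding ahead_def by auto
      moreover have "insert b N - {a} = insert b (N - {a})" using aN by auto
      moreover have "ahead m q (g(b := v)) a b \<longleftrightarrow> (\<exists>d\<in>ahead_window m a b. int q dvd v - g a - d)"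
        using aN unfolding ahead_def by auto
      ultimately show ?thesis using aN unfolding leaders_def by auto
    qed
    then show ?thesis by blast
  qed
  have "{y\<in>cyclic_configs q (insert b N). J \<subseteq> leaders m q (insert b N) y} = \<phi> ` (SIGMA g:S. free g)"
  proof
    show "{y\<in>cyclic_configs q (insert b N). J \<subseteq> leaders m q (insert b N) y} \<subseteq> \<phi> ` (SIGMA g:S. free g)"
    proof
      fix y assume y: "y \<in> {y\<in>cyclic_configs q (insert b N). J \<subseteq> leaders m q (insert b N) y}"
      then have "y \<in> (\<lambda>(v, g). g(b := v)) ` ({0..<int q} \<times> (N \<rightarrow>\<^sub>E {0..<int q}))"
        unfolding cyclic_configs_def PiE_insert_eq by simp
      then obtain g v where gv: "y = g(b := v)" "v \<in> {0..<int q}" "g \<in> cyclic_configs q N"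
        unfolding cyclic_configs_def by auto
      have "J \<subseteq> leaders m q (insert b N) (g(b := v))" using y gv(1) by simp
      then have "g \<in> S" "v \<in> free g" using key[of g v] gv unfolding S_def free_def by auto
      then show "y \<in> \<phi> ` (SIGMA g:S. free g)"
        unfolding \<phi>_def gv(1) by (intro image_eqI[where x = "(g, v)"]) auto
    qed
    show "\<phi> ` (SIGMA g:S. free g) \<subseteq> {y\<in>cyclic_configs q (insert b N). J \<subseteq> leaders m q (insert b N) y}"
    proof
      fix y assume "y \<in> \<phi> ` (SIGMA g:S. free g)"
      then obtain g v where gv: "y = g(b := v)" "g \<in> S" "v \<in> free g" unfolding \<phi>_def by auto
      have "y \<in> cyclic_configs q (insert b N)"
        using gv unfolding S_def free_def cyclic_configs_def by (auto simp: PiE_iff extensional_def)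
      moreover have "J \<subseteq> leaders m q (insert b N) y"
        unfolding gv(1) key using gv(2,3) unfolding S_def free_def by blast
      ultimately show "y \<in> {y\<in>cyclic_configs q (insert b N). J \<subseteq> leaders m q (insert b N) y}" by blast
    qed
  qed
  moreover have "inj_on \<phi> (SIGMA g:S. free g)"
  proof (rule inj_onI)
    fix x x' assume A: "x \<in> (SIGMA g:S. free g)" "x' \<in> (SIGMA g:S. free g)" "\<phi> x = \<phi> x'"
    obtain g v g' v' where x: "x = (g, v)" "x' = (g', v')" by (cases x; cases x')
    have eq: "g(b := v) = g'(b := v')" using A(3) unfolding x \<phi>_def by simp
    have "g b = undefined" "g' b = undefined"
      using A(1,2) assms(3) unfolding x S_def cyclic_configs_def by (auto simp: PiE_iff extensional_def)
    then have "g = g'" using eq by (metis fun_upd_triv fun_upd_upd)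
    moreover have "v = v'" using eq by (metis fun_upd_same)
    ultimately show "x = x'" using x by simp
  qed
  moreover have "card (SIGMA g:S. free g) = (\<Sum>g\<in>S. card (free g))"
  proof (rule card_SigmaI)
    show "finite S" using finite_cyclic_configs[OF assms(1), of q] by (simp add: S_def)
    have "free g \<subseteq> {0..<int q}" for g by (auto simp: free_def)
    then show "\<forall>g\<in>S. finite (free g)" using finite_subset by blast
  qed
  moreover have "card (free g) = q - m * card J" if "g \<in> S" for g
    using that assms finite_subset[OF assms(2,1)] unfolding free_def S_def
    by (intro card_free_positions[of J b m q N]) auto
  ultimately show ?thesis by (simp add: card_image S_def)
qed

lemma card_leaders_superset_restrict:
  assumes "finite N" "J \<subseteq> N" "m * card J < q"
  shows "card {y\<in>cyclic_configs q N. J \<subseteq> leaders m q N y} =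
    (q - m * card J) ^ (card N - card J) * card {y\<in>cyclic_configs q J. J \<subseteq> leaders m q J y}"
proof -
  have finJ: "finite J" using assms finite_subset by blast
  have "card {y\<in>cyclic_configs q (J \<union> K). J \<subseteq> leaders m q (J \<union> K) y} =
      (q - m * card J) ^ card K * card {y\<in>cyclic_configs q J. J \<subseteq> leaders m q J y}"
    if "finite K" "J \<inter> K = {}" for K
    using that
  proof (induction K rule: finite_induct)
    case (insert b K)
    have "card {y\<in>cyclic_configs q (insert b (J \<union> K)). J \<subseteq> leaders m q (insert b (J \<union> K)) y} =
        (q - m * card J) * card {y\<in>cyclic_configs q (J \<union> K). J \<subseteq> leaders m q (J \<union> K) y}"
      using insert finJ assms(3) by (intro card_leaders_superset_step) auto
    then show ?case using insert by simp
  qed simp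
  from this[of "N - J"] show ?thesis
    using assms finJ by (simp add: card_Diff_subset Un_absorb1 Diff_partition)
qed

text \<open>The alternating sum counts the configurations without leaders, which
  \<open>leaders_nonempty\<close> excludes.\<close>

lemma card_no_leaders:
  assumes "finite N" "N \<noteq> {}" "m * card N < q"
  shows "(\<Sum>J\<in>Pow N. (-1) ^ card J * int (card {y\<in>cyclic_configs q N. J \<subseteq> leaders m q N y})) = 0"
proof -
  have "int (card {y\<in>cyclic_configs q N. N \<subseteq> - leaders m q N y})
      = (\<Sum>L\<in>Pow N. (-1) ^ card L * int (card {y\<in>cyclic_configs q N. - leaders m q N y \<inter> L = {}}))"
    using assms by (intro card_superset_inclusion_exclusion finite_cyclic_configs)
  moreover have "N \<subseteq> - leaders m q N y \<longleftrightarrow> False" for y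
    using leaders_nonempty[OF assms, of y] unfolding leaders_def by auto
  moreover have "- leaders m q N y \<inter> L = {} \<longleftrightarrow> L \<subseteq> leaders m q N y" for y L by auto
  ultimately show ?thesis by simp
qed

text \<open>Restriction to \<open>J\<close> leaves only the configurations in which all labels are
  leaders. Their number is the one unknown in the relation \<open>card_no_leaders\<close>, whose
  other terms are known by induction, and the proposed formula satisfies the same relation.\<close>

lemma card_leaders_superset:
  assumes "finite N" "N \<noteq> {}" "m * card N < q" "J \<subseteq> N"
  shows "int (card {y\<in>cyclic_configs q N. J \<subseteq> leaders m q N y}) = int q * (int q - int m * int (card J)) ^ (card N - 1)"
proof -
  define F where "F J = int (card {y\<in>cyclic_configs q J. J \<subseteq> leaders m q J y})" for J :: "'a set"
  have restrict: "int (card {y\<in>cyclic_configs q N. J \<subseteq> leaders m q N y}) =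
      (int q - int m * int (card J)) ^ (card N - card J) * F J"
    if N: "finite N" "m * card N < q" "J \<subseteq> N" for N J
  proof -
    have "m * card J \<le> m * card N" using N card_mono by (intro mult_le_mono2) auto
    then have "m * card J < q" using N(2) by linarith
    then show ?thesis
      using card_leaders_superset_restrict[OF N(1,3)] unfolding F_def by (simp add: of_nat_diff)
  qed
  have F0: "F {} = 1" unfolding F_def cyclic_configs_def by simp
  have F: "F N = int q * (int q - int m * int (card N)) ^ (card N - 1)"
    if "finite N" "N \<noteq> {}" "m * card N < q" for N
    using that
  proof (induction "card N" arbitrary: N rule: less_induct)
    case less
    define f where "f J = (int q - int m * int (card J)) ^ (card N - card J) * F J" for J
    define g where "g J = int q * (int q + (- int m) * of_nat (card J)) ^ (card N - 1)" for J :: "'a set"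
    have n0: "card N > 0" using less.prems by auto
    have "f J = g J" if J: "J \<in> Pow N - {N}" for J
    proof (cases "J = {}")
      case True
      then show ?thesis using F0 n0 unfolding f_def g_def by (simp add: power_eq_if)
    next
      case False
      have finJ: "finite J" using J less.prems(1) finite_subset by blast
      have lt: "card J < card N" using J less.prems(1) by (intro psubset_card_mono) auto
      then have "m * card J \<le> m * card N" by (intro mult_le_mono2) auto
      then have "m * card J < q" using less.prems(3) by linarith
      then have "F J = int q * (int q - int m * int (card J)) ^ (card J - 1)"
        by (rule less.hyps[OF lt finJ False])
      moreover have "card N - card J + (card J - 1) = card N - 1"
      proof -
        have "card J > 0" using False finJ by auto
        then show ?thesis using lt by simp
      qed
      ultimately show ?thesis unfolding f_def g_def by (simp add: mult.left_commute flip: power_add)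
    qed
    then have "(\<Sum>J\<in>Pow N - {N}. (-1) ^ card J * f J) = (\<Sum>J\<in>Pow N - {N}. (-1) ^ card J * g J)" by simp
    moreover have "(\<Sum>J\<in>Pow N. (-1) ^ card J * f J) = 0"
    proof -
      have "(\<Sum>J\<in>Pow N. (-1) ^ card J * f J) =
          (\<Sum>J\<in>Pow N. (-1) ^ card J * int (card {y\<in>cyclic_configs q N. J \<subseteq> leaders m q N y}))"
        unfolding f_def using restrict[OF less.prems(1,3)] by (intro sum.cong) auto
      then show ?thesis using card_no_leaders[OF less.prems] by simp
    qed
    moreover have "(\<Sum>J\<in>Pow N. (-1) ^ card J * g J) = 0"
    proof -
      have "(\<Sum>J\<in>Pow N. (-1) ^ card J * g J) =
          int q * (\<Sum>J\<in>Pow N. (-1) ^ card J * (int q + (- int m) * of_nat (card J)) ^ (card N - 1))"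
        unfolding g_def sum_distrib_left by (intro sum.cong) auto
      also have "\<dots> = 0"
        using sum_Pow_alternating_power[OF less.prems(1), of "card N - 1" "int q" "- int m"] n0 by simp
      finally show ?thesis .
    qed
    moreover have split: "(\<Sum>J\<in>Pow N. (-1) ^ card J * h J) =
        (-1) ^ card N * h N + (\<Sum>J\<in>Pow N - {N}. (-1) ^ card J * h J)" for h :: "'a set \<Rightarrow> int"
      using less.prems(1) by (intro sum.remove) auto
    ultimately have "(-1) ^ card N * f N = (-1) ^ card N * g N"
      using split[of f] split[of g] by linarith
    then show ?case unfolding f_def g_def by simp
  qed
  show ?thesis
  proof (cases "J = {}")
    case True
    have "card N > 0" using assms by auto
    then show ?thesis using True restrict[OF assms(1,3,4)] F0 by (simp add: power_eq_if)
  next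
    case False
    have finJ: "finite J" using assms finite_subset by blast
    have le: "card J \<le> card N" "card J > 0" using assms finJ False card_mono by auto
    then have "m * card J \<le> m * card N" by (intro mult_le_mono2) auto
    then have "m * card J < q" using assms(3) by linarith
    then have "F J = int q * (int q - int m * int (card J)) ^ (card J - 1)" by (rule F[OF finJ False])
    moreover have "card N - card J + (card J - 1) = card N - 1" using le by simp
    ultimately show ?thesis
      using restrict[OF assms(1,3,4)] by (simp add: mult.left_commute flip: power_add)
  qed
qed

lemma card_leaders_exactly:
  assumes "finite N" "N \<noteq> {}" "m * card N < q" "S \<subseteq> N"
  shows "int (card {y\<in>cyclic_configs q N. leaders m q N y = N - S}) =
    (\<Sum>L\<in>Pow S. (-1) ^ card L * (int q * (int q - int m * int (card N - card S + card L)) ^ (card N - 1)))"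
proof -
  define X where "X = {y\<in>cyclic_configs q N. N - S \<subseteq> leaders m q N y}"
  have finX: "finite X" using finite_cyclic_configs[OF assms(1)] by (simp add: X_def)
  have finS: "finite S" using assms finite_subset by blast
  have "{y\<in>cyclic_configs q N. leaders m q N y = N - S} = {y\<in>X. S \<subseteq> - leaders m q N y}"
  proof -
    have "leaders m q N y \<subseteq> N" for y by (auto simp: leaders_def)
    then show ?thesis using assms(4) unfolding X_def by blast
  qed
  then have "int (card {y\<in>cyclic_configs q N. leaders m q N y = N - S}) =
      (\<Sum>L\<in>Pow S. (-1) ^ card L * int (card {y\<in>X. - leaders m q N y \<inter> L = {}}))"
    using card_superset_inclusion_exclusion[OF finX finS, of "\<lambda>y. - leaders m q N y"] by simp
  also have "\<dots> = (\<Sum>L\<in>Pow S. (-1) ^ card L * (int q * (int q - int m * int (card N - card S + card L)) ^ (card N - 1)))"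
  proof (intro sum.cong refl)
    fix L assume L: "L \<in> Pow S"
    have "{y\<in>X. - leaders m q N y \<inter> L = {}} = {y\<in>cyclic_configs q N. (N - S) \<union> L \<subseteq> leaders m q N y}"
      unfolding X_def by auto
    moreover have "card ((N - S) \<union> L) = card N - card S + card L"
      using L assms finS finite_subset[of L S] by (subst card_Un_disjoint) (auto simp: card_Diff_subset)
    ultimately show "(-1) ^ card L * int (card {y\<in>X. - leaders m q N y \<inter> L = {}}) =
        (-1) ^ card L * (int q * (int q - int m * int (card N - card S + card L)) ^ (card N - 1))"
      using card_leaders_superset[OF assms(1-3), of "(N - S) \<union> L"] L assms(4) by auto
  qed
  finally show ?thesis .
qed

section \<open>Faces of the Shi arrangement\<close>

lemma mem_shi_hyperplanes: "(i, j, s) \<in> shi_hyperplanes m \<longleftrightarrow> i < j \<and> - int m + 1 \<le> s \<and> s \<le> int m"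
  by (simp add: shi_hyperplanes_def)

lemma finite_shi_hyperplanes: "finite (shi_hyperplanes m :: ('n::{finite,linorder} \<times> 'n \<times> int) set)"
  by (rule finite_subset[of _ "UNIV \<times> UNIV \<times> {- int m + 1..int m}"]) (auto simp: mem_shi_hyperplanes)

text \<open>The indicator vectors of the classes, indexed by the representatives in
  \<open>Ld\<close>, form an orthogonal basis.\<close>

lemma dim_constant_on_classes:
  fixes ld :: "'n::finite \<Rightarrow> 'n"
  assumes "\<And>i. ld i \<in> Ld" "\<And>c. c \<in> Ld \<Longrightarrow> ld c = c"
    and V: "\<And>v. v \<in> V \<longleftrightarrow> (\<forall>i. v $ i = v $ ld i)"
  shows "dim (V :: (real, 'n) vec set) = card Ld"
proof -
  define w :: "'n \<Rightarrow> (real, 'n) vec" where "w c = (\<chi> i. if ld i = c then 1 else 0)" for c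
  have inj: "inj_on w Ld"
  proof (rule inj_onI)
    fix c c' assume c: "c \<in> Ld" "c' \<in> Ld" "w c = w c'"
    have "w c $ c = 1" using assms(2)[OF c(1)] by (simp add: w_def)
    then have "w c' $ c = 1" using c(3) by metis
    then show "c = c'" using assms(2)[OF c(1)] by (simp add: w_def split: if_splits)
  qed
  show ?thesis
  proof (rule dim_unique)
    show "w ` Ld \<subseteq> V" using assms(1,2) by (auto simp: V w_def)
    show "V \<subseteq> span (w ` Ld)"
    proof
      fix v assume "v \<in> V"
      have "v = (\<Sum>c\<in>Ld. v $ c *\<^sub>R w c)"
      proof (rule vec_eq_iff[THEN iffD2], rule allI)
        fix i
        have "(\<Sum>c\<in>Ld. v $ c *\<^sub>R w c) $ i = (\<Sum>c\<in>Ld. if ld i = c then v $ c else 0)"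
          by (simp add: w_def if_distrib cong: if_cong)
        also have "\<dots> = v $ ld i" using assms(1) by simp
        finally show "v $ i = (\<Sum>c\<in>Ld. v $ c *\<^sub>R w c) $ i" using \<open>v \<in> V\<close> V by simp
      qed
      also have "\<dots> \<in> span (w ` Ld)" by (intro span_sum span_scale span_base) auto
      finally show "v \<in> span (w ` Ld)" .
    qed
    show "independent (w ` Ld)"
    proof (rule pairwise_orthogonal_independent)
      have "w c \<bullet> w c' = 0" if "c \<noteq> c'" for c c'
        using that by (auto simp: inner_vec_def w_def intro!: sum.neutral)
      then show "pairwise orthogonal (w ` Ld)" 
        unfolding pairwise_def orthogonal_def by (metis imageE)
      have "w c $ c = 1" if "c \<in> Ld" for c using assms(2)[OF that] by (simp add: w_def)
      then show "0 \<notin> w ` Ld" by (metis (no_types, lifting) imageE zero_index zero_neq_one)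
    qed
    show "card (w ` Ld) = card Ld" using inj by (rule card_image)
  qed
qed

text \<open>The hyperplanes satisfied by \<open>y\<close> tie coordinates together along
  \<open>adj\<close>, and each resulting cluster leaves one degree of freedom. Ordered by
  \<open>key\<close>, the clusters are intervals that end in leaders, so there are as many clusters
  as leaders.\<close>

lemma aff_dim_cluster_flat:
  fixes y :: "'n::{finite,linorder} \<Rightarrow> int"
  assumes "m * CARD('n) < q"
  shows "aff_dim (real_sols {h\<in>shi_hyperplanes m. holds_mod q h y}) = int (card (leaders m q UNIV y))"
proof -
  obtain u :: "'n \<Rightarrow> int" where u: "\<And>a b. \<forall>s. \<bar>s\<bar> \<le> int m \<longrightarrow> (int q dvd y b - y a - s \<longleftrightarrow> u b - u a = s)"
    using cyclic_lift[of "UNIV :: 'n set" m q y] assms by auto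
  define adj where "adj a b \<longleftrightarrow> b \<noteq> a \<and> u b - u a \<in> ahead_window m a b" for a b
  define Ld where "Ld = leaders m q UNIV y"
  have Ld: "c \<in> Ld \<longleftrightarrow> (\<forall>b. \<not> adj c b)" for c
  proof -
    have "ahead m q y a b \<longleftrightarrow> u b - u a \<in> ahead_window m a b" for a b by (rule ahead_lift) (rule u)
    then show ?thesis unfolding Ld_def leaders_def adj_def by auto
  qed
  define B where "B = {h\<in>shi_hyperplanes m. holds_mod q h y}"
  have B: "(i, j, s) \<in> B \<longleftrightarrow> i < j \<and> - int m + 1 \<le> s \<and> s \<le> int m \<and> u i - u j = s" for i j s
  proof (cases "- int m + 1 \<le> s \<and> s \<le> int m")
    case True
    then have "\<bar>s\<bar> \<le> int m" by linarith
    then show ?thesis using True u[of i j] by (simp add: B_def mem_shi_hyperplanes holds_mod_def)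
  qed (auto simp: B_def mem_shi_hyperplanes)

  \<comment> \<open>\<open>key\<close> encodes the lexicographic order by position \<open>u\<close>
    and then by label in one integer; \<open>adj\<close> always leads upwards in it.\<close>
  define idx where "idx a = int (card {b. b < a})" for a :: 'n
  define key where "key a = u a * int CARD('n) + idx a" for a
  have idx: "0 \<le> idx a" "idx a < int CARD('n)" for a
    unfolding idx_def by (auto intro!: psubset_card_mono)
  have key_u: "key a < key b" if "u a < u b" for a b
  proof -
    have "(u a + 1) * int CARD('n) \<le> u b * int CARD('n)" using that by (intro mult_right_mono) auto
    then show ?thesis using idx[of a] idx[of b] unfolding key_def by (simp add: algebra_simps)
  qed
  have key_idx: "key a < key b" if "u a = u b" "a < b" for a b
  proof -
    have "{c. c < a} \<subset> {c. c < b}" using that by (auto intro: less_trans)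
    then have "idx a < idx b" unfolding idx_def by (simp add: psubset_card_mono)
    then show ?thesis using that unfolding key_def by simp
  qed
  have key_iff: "key a < key b \<longleftrightarrow> u a < u b \<or> (u a = u b \<and> a < b)" for a b
    using key_u[of a b] key_u[of b a] key_idx[of a b] key_idx[of b a] by (metis less_asym less_irrefl linorder_neqE)
  have key_inj: "a = b" if "key a = key b" for a b
    using key_iff[of a b] key_iff[of b a] that by (metis less_irrefl linorder_neqE)
  have adj_key: "key a < key b" if "adj a b" for a b
    using that unfolding adj_def key_iff ahead_window_def by (auto split: if_splits)
  \<comment> \<open>Whatever lies between \<open>a\<close> and a label ahead of it has that label
    ahead as well. So no leader separates adjacent labels.\<close>
  have no_jump: "adj c b" if "adj a b" "key a \<le> key c" "key c < key b" for a b c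
  proof -
    have ac: "u a < u c \<or> (u a = u c \<and> a \<le> c)"
      using that(2) key_iff[of a c] key_inj[of a c] by (auto simp: le_less)
    have cb: "u c < u b \<or> (u c = u b \<and> c < b)" using that(3) key_iff by blast
    have "u b - u a \<in> ahead_window m a b" "a \<noteq> b" using that(1) by (auto simp: adj_def)
    then have "u b - u c \<in> ahead_window m c b"
      using ac cb unfolding ahead_window_def by (auto split: if_splits)
    then show ?thesis using cb by (auto simp: adj_def)
  qed
  \<comment> \<open>The first leader at or after \<open>i\<close>, which represents the cluster of
    \<open>i\<close>.\<close>
  define ld where "ld i = arg_min_on key {c\<in>Ld. key i \<le> key c}" for i
  have ld: "ld i \<in> Ld" "key i \<le> key (ld i)" "\<And>c. c \<in> Ld \<Longrightarrow> key i \<le> key c \<Longrightarrow> key (ld i) \<le> key c" for i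
  proof -
    have "Max (range key) \<in> range key" by (intro Max_in) auto
    then obtain c where c: "key c = Max (range key)" by (metis imageE)
    have top: "key b \<le> key c" for b unfolding c by simp
    have "c \<in> Ld" unfolding Ld using adj_key top by (meson not_less)
    then have ne: "{c\<in>Ld. key i \<le> key c} \<noteq> {}" using top by auto
    show "ld i \<in> Ld" "key i \<le> key (ld i)" "\<And>c. c \<in> Ld \<Longrightarrow> key i \<le> key c \<Longrightarrow> key (ld i) \<le> key c"
      using arg_min_if_finite[of "{c\<in>Ld. key i \<le> key c}" key] ne unfolding ld_def by (auto simp: not_less)
  qed
  have ld_self: "ld c = c" if "c \<in> Ld" for c
    using ld[of c] that key_inj by (metis order_antisym order_refl)
  have ld_adj: "ld a = ld b" if "adj a b" for a b
  proof -
    have "key a \<le> key c \<longleftrightarrow> key b \<le> key c" if c: "c \<in> Ld" for c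
      using no_jump[OF \<open>adj a b\<close>, of c] adj_key[OF \<open>adj a b\<close>] c unfolding Ld by (meson le_less_trans less_imp_le not_le)
    then have "{c\<in>Ld. key a \<le> key c} = {c\<in>Ld. key b \<le> key c}" by blast
    then show ?thesis unfolding ld_def by simp
  qed

  define V :: "(real, 'n) vec set" where "V = {v. \<forall>i. v $ i = v $ ld i}"
  have V_adj: "v \<in> V \<longleftrightarrow> (\<forall>a b. adj a b \<longrightarrow> v $ a = v $ b)" for v
  proof
    assume "v \<in> V"
    then show "\<forall>a b. adj a b \<longrightarrow> v $ a = v $ b" unfolding V_def using ld_adj by (metis (mono_tags, lifting) mem_Collect_eq)
  next
    assume const: "\<forall>a b. adj a b \<longrightarrow> v $ a = v $ b"
    have "v $ i = v $ ld i" for i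
    \<comment> \<open>Induction on the distance to the greatest key: a label that is not a leader
      shares its value with an adjacent label above it.\<close>
    proof (induction "nat (Max (range key) - key i)" arbitrary: i rule: less_induct)
      case less
      show ?case
      proof (cases "i \<in> Ld")
        case True
        then show ?thesis by (simp add: ld_self)
      next
        case False
        then obtain b where b: "adj i b" using Ld by blast
        have "key b \<le> Max (range key)" by simp
        then have "nat (Max (range key) - key b) < nat (Max (range key) - key i)"
          using adj_key[OF b] by linarith
        then have "v $ b = v $ ld b" by (rule less)
        then show ?thesis using const b ld_adj[OF b] by metis
      qed
    qed
    then show "v \<in> V" unfolding V_def by simp
  qed
  have "dim V = card Ld" by (rule dim_constant_on_classes[of ld]) (auto simp: ld(1) ld_self V_def)
  moreover have "subspace V" by (auto simp: subspace_def V_def)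
  ultimately have "aff_dim V = int (card Ld)" by (simp add: aff_dim_subspace)
  \<comment> \<open>The lift \<open>u\<close> is itself a real solution of \<open>B\<close>, so the
    flat is \<open>V\<close> translated by it.\<close>
  moreover define x :: "(real, 'n) vec" where "x = (\<chi> i. of_int (u i))"
  have "z \<in> real_sols B \<longleftrightarrow> z - x \<in> V" for z
  proof
    assume z: "z \<in> real_sols B"
    show "z - x \<in> V" unfolding V_adj
    proof (intro allI impI)
      fix a b assume ab: "adj a b"
      show "(z - x) $ a = (z - x) $ b"
      proof (cases "a < b")
        case True
        then have "(a, b, u a - u b) \<in> B" using ab unfolding B adj_def ahead_window_def by auto
        then have "diff_val (a, b, u a - u b) z = 0" using z unfolding real_sols_def by blast
        then show ?thesis by (simp add: diff_val_def x_def)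
      next
        case False
        then have "(b, a, u b - u a) \<in> B" using ab unfolding B adj_def ahead_window_def by auto
        then have "diff_val (b, a, u b - u a) z = 0" using z unfolding real_sols_def by blast
        then show ?thesis by (simp add: diff_val_def x_def)
      qed
    qed
  next
    assume z: "z - x \<in> V"
    have "diff_val h z = 0" if "h \<in> B" for h
    proof -
      obtain i j s where h: "h = (i, j, s)" by (cases h)
      have ij: "i < j" "- int m + 1 \<le> s" "s \<le> int m" "u i - u j = s" using that unfolding h B by auto
      \<comment> \<open>\<open>s \<le> 0\<close> puts \<open>j\<close> ahead of \<open>i\<close>,
        and \<open>s \<ge> 1\<close> puts \<open>i\<close> ahead of \<open>j\<close>; this is how
        the asymmetric range from \<open>- m + 1\<close> to \<open>m\<close> splits into the two
        windows.\<close>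
      have "adj i j \<or> adj j i" using ij unfolding adj_def ahead_window_def by auto
      then have "(z - x) $ i = (z - x) $ j" using z unfolding V_adj by metis
      then show ?thesis using ij(4) unfolding h by (simp add: diff_val_def x_def flip: of_int_diff)
    qed
    then show "z \<in> real_sols B" by (simp add: real_sols_def)
  qed
  then have "real_sols B = (+) x ` V"
    by (metis (no_types, opaque_lifting) add_diff_cancel_left' diff_add_cancel image_iff set_eq_iff add.commute)
  ultimately show ?thesis unfolding B_def[symmetric] Ld_def[symmetric] by (simp add: aff_dim_translation_eq)
qed

section \<open>Faces as sign classes of points\<close>

definition zero_set :: "nat \<Rightarrow> real ^ 'n::{finite,linorder} \<Rightarrow> 'n diff_eqn set" where
  "zero_set m x = {h\<in>shi_hyperplanes m. diff_val h x = 0}"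

definition pos_set :: "nat \<Rightarrow> real ^ 'n::{finite,linorder} \<Rightarrow> 'n diff_eqn set" where
  "pos_set m x = {h\<in>shi_hyperplanes m. diff_val h x > 0}"

definition sign_cell :: "nat \<Rightarrow> 'n diff_eqn set \<times> 'n diff_eqn set \<Rightarrow> (real ^ 'n::{finite,linorder}) set" where
  "sign_cell m = (\<lambda>(Z, P). {x. zero_set m x = Z \<and> pos_set m x = P})"

lemma sign_relation:
  fixes a b s :: real
  assumes "R \<in> {(<), (=), (>)}" "R a s"
  shows "R b s \<longleftrightarrow> (b - s = 0 \<longleftrightarrow> a - s = 0) \<and> (b - s > 0 \<longleftrightarrow> a - s > 0)"
  using assms by auto

lemma mem_sign_cell:
  "y \<in> sign_cell m (zero_set m x, pos_set m x) \<longleftrightarrow> (\<forall>h\<in>shi_hyperplanes m.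
     (diff_val h y = 0 \<longleftrightarrow> diff_val h x = 0) \<and> (diff_val h y > 0 \<longleftrightarrow> diff_val h x > 0))"
  unfolding sign_cell_def zero_set_def pos_set_def by auto

text \<open>Each of the three relations prescribes the sign of \<open>diff_val\<close>, so a face
  consists of the points that share all signs with any one of its points.\<close>

lemma shi_faces_eq:
  "shi_faces m = range (\<lambda>x :: real ^ 'n::{finite,linorder}. sign_cell m (zero_set m x, pos_set m x))"
proof
  have cell: "{y. \<forall>(i, j, s)\<in>shi_hyperplanes m. R (i, j, s) (y $ i - y $ j) (of_int s)}
      = sign_cell m (zero_set m x, pos_set m x)"
    if R: "R \<in> shi_hyperplanes m \<rightarrow> {(<), (=), (>)}"
      and x: "\<forall>(i, j, s)\<in>shi_hyperplanes m. R (i, j, s) (x $ i - x $ j) (of_int s)"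
    for R and x :: "(real, 'n) vec"
  proof -
    have "R h (y $ fst h - y $ fst (snd h)) (of_int (snd (snd h))) \<longleftrightarrow>
        (diff_val h y = 0 \<longleftrightarrow> diff_val h x = 0) \<and> (diff_val h y > 0 \<longleftrightarrow> diff_val h x > 0)"
      if "h \<in> shi_hyperplanes m" for h and y :: "(real, 'n) vec"
    proof -
      have "R h \<in> {(<), (=), (>)}" using R that by blast
      moreover have "R h (x $ fst h - x $ fst (snd h)) (of_int (snd (snd h)))" using x that by auto
      ultimately show ?thesis unfolding diff_val_def by (rule sign_relation)
    qed
    then have "(\<forall>h\<in>shi_hyperplanes m. R h (y $ fst h - y $ fst (snd h)) (of_int (snd (snd h)))) \<longleftrightarrow>
        y \<in> sign_cell m (zero_set m x, pos_set m x)" for y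
      unfolding mem_sign_cell by (intro ball_cong) auto
    then show ?thesis unfolding case_prod_beta by (intro set_eqI) simp
  qed
  show "shi_faces m \<subseteq> range (\<lambda>x :: (real, 'n) vec. sign_cell m (zero_set m x, pos_set m x))"
  proof
    fix F :: "(real, 'n) vec set" assume "F \<in> shi_faces m"
    then obtain R x where R: "R \<in> shi_hyperplanes m \<rightarrow> {(<), (=), (>)}" "x \<in> F"
      and F: "F = {x. \<forall>(i, j, s)\<in>shi_hyperplanes m. R (i, j, s) (x $ i - x $ j) (of_int s)}"
      unfolding shi_faces_def by blast
    then have "F = sign_cell m (zero_set m x, pos_set m x)" using cell[OF R(1), of x] by blast
    then show "F \<in> range (\<lambda>x. sign_cell m (zero_set m x, pos_set m x))" by blast
  qed
  show "range (\<lambda>x :: (real, 'n) vec. sign_cell m (zero_set m x, pos_set m x)) \<subseteq> shi_faces m"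
  proof
    fix F :: "(real, 'n) vec set" assume "F \<in> range (\<lambda>x. sign_cell m (zero_set m x, pos_set m x))"
    then obtain x where F: "F = sign_cell m (zero_set m x, pos_set m x)" by blast
    define R :: "'n diff_eqn \<Rightarrow> real \<Rightarrow> real \<Rightarrow> bool" where
      "R h = (if diff_val h x < 0 then (<) else if diff_val h x = 0 then (=) else (>))" for h
    have "R \<in> shi_hyperplanes m \<rightarrow> {(<), (=), (>)}" unfolding R_def by auto
    moreover have "\<forall>(i, j, s)\<in>shi_hyperplanes m. R (i, j, s) (x $ i - x $ j) (of_int s)"
      unfolding R_def diff_val_def by auto
    moreover have "x \<in> F" unfolding F mem_sign_cell by simp
    ultimately show "F \<in> shi_faces m" unfolding shi_faces_def using cell[of R x] F by blast
  qed
qed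

text \<open>The equations of a face give its flat and the strict inequalities an open set, so the
  face is a nonempty relatively open part of the flat.\<close>

lemma aff_dim_sign_cell:
  fixes x :: "real ^ 'n::{finite,linorder}"
  shows "aff_dim (sign_cell m (zero_set m x, pos_set m x)) = aff_dim (real_sols (zero_set m x))"
proof (rule aff_dim_openin)
  define C where "C = sign_cell m (zero_set m x, pos_set m x)"
  define O' where "O' = (\<Inter>h\<in>shi_hyperplanes m - zero_set m x.
    if diff_val h x > 0 then {y. 0 < diff_val h y} else {y. diff_val h y < 0})"
  have "open {y :: (real, 'n) vec. 0 < diff_val h y}" "open {y :: (real, 'n) vec. diff_val h y < 0}" for h
    by (auto intro!: open_Collect_less continuous_diff_val)
  then have "open O'" unfolding O'_def using finite_shi_hyperplanes[of m] by (intro open_INT) auto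
  moreover have "C = real_sols (zero_set m x) \<inter> O'"
  proof (intro set_eqI)
    fix y
    have "y \<in> real_sols (zero_set m x) \<inter> O' \<longleftrightarrow> (\<forall>h\<in>shi_hyperplanes m.
        (diff_val h x = 0 \<longrightarrow> diff_val h y = 0) \<and> (diff_val h x > 0 \<longrightarrow> diff_val h y > 0) \<and>
        (diff_val h x < 0 \<longrightarrow> diff_val h y < 0))"
      unfolding O'_def real_sols_def zero_set_def by (auto split: if_splits simp: not_less_iff_gr_or_eq)
    also have "\<dots> \<longleftrightarrow> y \<in> C" unfolding C_def mem_sign_cell
      by (intro ball_cong refl) (metis less_asym less_irrefl linorder_neqE)
    finally show "y \<in> C \<longleftrightarrow> y \<in> real_sols (zero_set m x) \<inter> O'" by simp
  qed
  ultimately show "openin (top_of_set (real_sols (zero_set m x))) (sign_cell m (zero_set m x, pos_set m x))"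
    unfolding C_def[symmetric] by (simp add: openin_open_Int)
  show "sign_cell m (zero_set m x, pos_set m x) \<noteq> {}" using mem_sign_cell[of x m x] by auto
qed (rule affine_real_sols)

text \<open>A face is determined by its zero and its positive hyperplanes. The sum also runs over
  sets \<open>B\<close> that miss some hyperplane containing their flat, but these have no sign
  patterns.\<close>

lemma card_shi_faces_sign_patterns:
  fixes H :: "'n::{finite,linorder} diff_eqn set" and m k :: nat
  defines "H \<equiv> shi_hyperplanes m"
  shows "finite {F \<in> shi_faces m :: (real, 'n) vec set set. aff_dim F = int k}"
    and "card {F \<in> shi_faces m :: (real, 'n) vec set set. aff_dim F = int k} =
      (\<Sum>B | B \<subseteq> H \<and> aff_dim (real_sols B) = int k. card (sign_patterns B (H - B)))"
proof -
  define Bs where "Bs = {B. B \<subseteq> H \<and> aff_dim (real_sols B) = int k}"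
  define G where "G = (SIGMA B:Bs. sign_patterns B (H - B))"
  have finH: "finite H" unfolding H_def by (rule finite_shi_hyperplanes)
  have finBs: "finite Bs" unfolding Bs_def using finH by simp
  have finG: "finite G" unfolding G_def using finBs finH by (auto intro: finite_sign_patterns)
  have G: "ZP \<in> G \<longleftrightarrow> (\<exists>x. ZP = (zero_set m x, pos_set m x) \<and> aff_dim (real_sols (zero_set m x)) = int k)" for ZP
  proof
    assume "ZP \<in> G"
    then obtain B x where B: "B \<subseteq> H" "aff_dim (real_sols B) = int k" "x \<in> real_sols B" "\<forall>h\<in>H - B. diff_val h x \<noteq> 0"
      and ZP: "ZP = (B, {h\<in>H - B. diff_val h x > 0})"
      unfolding G_def Bs_def sign_patterns_def by auto
    have "zero_set m x = B" using B unfolding zero_set_def H_def[symmetric] real_sols_def by auto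
    moreover have "pos_set m x = {h\<in>H - B. diff_val h x > 0}"
      using B(3) unfolding pos_set_def H_def[symmetric] real_sols_def by force
    ultimately show "\<exists>x. ZP = (zero_set m x, pos_set m x) \<and> aff_dim (real_sols (zero_set m x)) = int k"
      using ZP B(2) by auto
  next
    assume "\<exists>x. ZP = (zero_set m x, pos_set m x) \<and> aff_dim (real_sols (zero_set m x)) = int k"
    then obtain x where x: "ZP = (zero_set m x, pos_set m x)" "aff_dim (real_sols (zero_set m x)) = int k" by blast
    have "pos_set m x = {h\<in>H - zero_set m x. diff_val h x > 0}"
      unfolding pos_set_def zero_set_def H_def[symmetric] by auto
    moreover have "x \<in> real_sols (zero_set m x)" "\<forall>h\<in>H - zero_set m x. diff_val h x \<noteq> 0" "zero_set m x \<subseteq> H"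
      unfolding zero_set_def H_def[symmetric] real_sols_def by auto
    ultimately show "ZP \<in> G" using x unfolding G_def Bs_def sign_patterns_def by auto
  qed
  have faces: "{F \<in> shi_faces m :: (real, 'n) vec set set. aff_dim F = int k} = sign_cell m ` G"
  proof (intro set_eqI iffI)
    fix F assume "F \<in> {F \<in> shi_faces m :: (real, 'n) vec set set. aff_dim F = int k}"
    then obtain x where F: "F = sign_cell m (zero_set m x, pos_set m x)" and "aff_dim F = int k"
      unfolding shi_faces_eq by blast
    then have "aff_dim (real_sols (zero_set m x)) = int k" by (simp add: aff_dim_sign_cell)
    then have "(zero_set m x, pos_set m x) \<in> G" using G by blast
    then show "F \<in> sign_cell m ` G" unfolding F by (rule imageI)
  next
    fix F assume "F \<in> sign_cell m ` G"
    then obtain x where "F = sign_cell m (zero_set m x, pos_set m x)" "aff_dim (real_sols (zero_set m x)) = int k"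
      using G by auto
    then show "F \<in> {F \<in> shi_faces m :: (real, 'n) vec set set. aff_dim F = int k}"
      unfolding shi_faces_eq by (simp add: aff_dim_sign_cell)
  qed
  have "inj_on (sign_cell m) G"
  proof (rule inj_onI)
    fix a b assume ab: "a \<in> G" "b \<in> G" "sign_cell m a = sign_cell m b"
    obtain x where x: "a = (zero_set m x, pos_set m x)" using ab(1) G by blast
    obtain z where z: "b = (zero_set m z, pos_set m z)" using ab(2) G by blast
    have "x \<in> sign_cell m a" unfolding x sign_cell_def by simp
    then have "x \<in> sign_cell m b" using ab(3) by simp
    then show "a = b" unfolding x z sign_cell_def by simp
  qed
  then have "card (sign_cell m ` G) = card G" by (rule card_image)
  moreover have "card G = (\<Sum>B\<in>Bs. card (sign_patterns B (H - B)))"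
    unfolding G_def using finBs finH by (intro card_SigmaI) (auto intro: finite_sign_patterns)
  ultimately show "finite {F \<in> shi_faces m :: (real, 'n) vec set set. aff_dim F = int k}"
    "card {F \<in> shi_faces m :: (real, 'n) vec set set. aff_dim F = int k} =
      (\<Sum>B | B \<subseteq> H \<and> aff_dim (real_sols B) = int k. card (sign_patterns B (H - B)))"
    unfolding faces Bs_def using finG by auto
qed

lemma card_configs_with_leaders:
  fixes k m q :: nat
  assumes "k \<le> CARD('n::{finite,linorder})" "m * CARD('n) < q"
  shows "int (card {y\<in>cyclic_configs q (UNIV :: 'n set). card (leaders m q UNIV y) = k}) =
    (\<Sum>S | S \<subseteq> (UNIV :: 'n set) \<and> card S = CARD('n) - k. \<Sum>L\<in>Pow S.
       (-1) ^ card L * (int q * (int q - int m * int (k + card L)) ^ (CARD('n) - 1)))"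
proof -
  let ?n = "CARD('n)"
  let ?Y = "\<lambda>S. {y\<in>cyclic_configs q (UNIV :: 'n set). leaders m q UNIV y = UNIV - S}"
  let ?SS = "{S. S \<subseteq> (UNIV :: 'n set) \<and> card S = ?n - k}"
  have "{y\<in>cyclic_configs q (UNIV :: 'n set). card (leaders m q UNIV y) = k} = (\<Union>S\<in>?SS. ?Y S)"
  proof (intro set_eqI iffI)
    fix y assume "y \<in> {y\<in>cyclic_configs q (UNIV :: 'n set). card (leaders m q UNIV y) = k}"
    then have "y \<in> ?Y (UNIV - leaders m q UNIV y)" "UNIV - leaders m q UNIV y \<in> ?SS"
      by (auto simp: card_Diff_subset)
    then show "y \<in> (\<Union>S\<in>?SS. ?Y S)" by blast
  next
    fix y assume "y \<in> (\<Union>S\<in>?SS. ?Y S)"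
    then obtain S where S: "card S = ?n - k" "y \<in> ?Y S" by blast
    have "card (UNIV - S) = ?n - card S" by (simp add: card_Diff_subset)
    then show "y \<in> {y\<in>cyclic_configs q (UNIV :: 'n set). card (leaders m q UNIV y) = k}"
      using S assms(1) by simp
  qed
  moreover have "card (\<Union>S\<in>?SS. ?Y S) = (\<Sum>S\<in>?SS. card (?Y S))"
  proof (rule card_UN_disjoint)
    show "\<forall>S\<in>?SS. finite (?Y S)" using finite_cyclic_configs[of "UNIV :: 'n set" q] by auto
  qed auto
  moreover have "int (card (?Y S)) = (\<Sum>L\<in>Pow S.
       (-1) ^ card L * (int q * (int q - int m * int (k + card L)) ^ (?n - 1)))" if "S \<in> ?SS" for S
    using card_leaders_exactly[of "UNIV :: 'n set" m q S] that assms by simp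
  ultimately show ?thesis by simp
qed

section \<open>Comparison of polynomials and evaluation at -1\<close>

lemma poly_eqI_eventually:
  fixes P Q :: "real poly"
  assumes "\<And>q :: nat. q \<ge> q0 \<Longrightarrow> poly P (real q) = poly Q (real q)"
  shows "P = Q"
proof (rule ccontr)
  assume "P \<noteq> Q"
  then have "finite {x. poly (P - Q) x = 0}" by (intro poly_roots_finite) simp
  moreover have "real ` {q0..} \<subseteq> {x. poly (P - Q) x = 0}" using assms by auto
  ultimately have "finite (real ` {q0..})" using finite_subset by blast
  then have "finite {q0..}" by (rule finite_imageD) (simp add: inj_on_def)
  then show False using infinite_Ici by blast
qed

text \<open>Replacing \<open>L\<close> by \<open>S - L\<close> turns \<open>k + card L\<close> into
  \<open>n - card L\<close>, and \<open>- 1 - m * j\<close> is \<open>- (m * j + 1)\<close>; the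
  collected signs reduce to \<open>(-1) ^ k * (-1) ^ card L\<close>.\<close>

lemma face_polynomial_at_minus_one:
  assumes "finite N" "card N = n" "k \<le> n" "n \<ge> 1"
  shows "(\<Sum>S | S \<subseteq> N \<and> card S = n - k. \<Sum>L\<in>Pow S.
      (-1) ^ card L * (- 1 * (- 1 - int m * int (k + card L)) ^ (n - 1))) = (-1) ^ k * face_number m n k"
proof -
  have "(\<Sum>L\<in>Pow S. (-1) ^ card L * (- 1 * (- 1 - int m * int (k + card L)) ^ (n - 1))) =
      (-1) ^ k * (\<Sum>L\<in>Pow S. (-1) ^ card L * int (m * (n - card L) + 1) ^ (n - 1))"
    if S: "S \<subseteq> N" "card S = n - k" for S
  proof -
    have finS: "finite S" using S assms(1) finite_subset by blast
    have "(\<Sum>L\<in>Pow S. (-1) ^ card L * (- 1 * (- 1 - int m * int (k + card L)) ^ (n - 1))) =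
        (\<Sum>L\<in>Pow S. (-1) ^ card (S - L) * (- 1 * (- 1 - int m * int (k + card (S - L))) ^ (n - 1)))"
      by (rule sum.reindex_bij_witness[of _ "\<lambda>L. S - L" "\<lambda>L. S - L"]) (auto simp: double_diff)
    also have "\<dots> = (\<Sum>L\<in>Pow S. (-1) ^ k * ((-1) ^ card L * int (m * (n - card L) + 1) ^ (n - 1)))"
    proof (intro sum.cong refl)
      fix L assume "L \<in> Pow S"
      then have L: "L \<subseteq> S" "finite L" "card L \<le> n - k" using finS S(2) card_mono[of S L] finite_subset by auto
      have c: "card (S - L) = n - k - card L" using L S(2) by (simp add: card_Diff_subset)
      have e: "- 1 - int m * int (k + card (S - L)) = (-1) * int (m * (n - card L) + 1)"
      proof -
        have "k + card (S - L) = n - card L" unfolding c using L(3) assms(3) by simp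
        then show ?thesis by (simp only: of_nat_add of_nat_mult of_nat_1) (simp only: algebra_simps)
      qed
      have "(- 1 :: int) ^ (n - k - card L) * (- 1 * (- 1) ^ (n - 1)) = (-1) ^ (n - k - card L + n)"
      proof -
        have "(- 1 :: int) * (- 1) ^ (n - 1) = (- 1) ^ n" using assms(4) by (cases n) auto
        then show ?thesis by (simp only: power_add)
      qed
      also have "\<dots> = (-1) ^ (k + card L + 2 * (n - k - card L))"
      proof -
        have "n - k - card L + n = k + card L + 2 * (n - k - card L)" using L(3) assms(3) by simp
        then show ?thesis by (rule arg_cong)
      qed
      also have "\<dots> = (-1) ^ k * (-1) ^ card L" by (simp add: power_add)
      finally have sg: "(- 1 :: int) ^ (n - k - card L) * (- 1 * (- 1) ^ (n - 1)) = (-1) ^ k * (-1) ^ card L" .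
      show "(-1) ^ card (S - L) * (- 1 * (- 1 - int m * int (k + card (S - L))) ^ (n - 1)) =
          (-1) ^ k * ((-1) ^ card L * int (m * (n - card L) + 1) ^ (n - 1))"
        unfolding e power_mult_distrib mult.assoc[symmetric] unfolding c sg[symmetric]
        by (simp only: mult.assoc)
    qed
    finally show ?thesis by (simp add: sum_distrib_left)
  qed
  then show ?thesis using assms by (simp add: face_number_eq_sum[of N] sum_distrib_left)
qed

lemma card_shi_faces:
  assumes "n = CARD('n::{finite,linorder})" "k \<le> n"
  shows "int (card {F \<in> shi_faces m :: (real, 'n) vec set set. aff_dim F = int k}) = face_number m n k"
proof -
  define H :: "'n diff_eqn set" where "H = shi_hyperplanes m"
  define Bs where "Bs = {B. B \<subseteq> H \<and> aff_dim (real_sols B) = int k}"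
  have finH: "finite H" unfolding H_def by (rule finite_shi_hyperplanes)
  have finBs: "finite Bs" unfolding Bs_def using finH by simp
  have n1: "n \<ge> 1" unfolding assms(1) by (simp add: Suc_le_eq)
  have "\<forall>B\<in>Bs. \<exists>p q0. (\<forall>q\<ge>q0. real (card (mod_avoiding q B (H - B))) = poly p (real q)) \<and>
      real (card (sign_patterns B (H - B))) = (-1) ^ k * poly p (-1)"
  proof
    fix B assume "B \<in> Bs"
    then have B: "B \<subseteq> H" "nat (aff_dim (real_sols B)) = k" by (auto simp: Bs_def)
    have "finite B" "finite (H - B)" using B(1) finH finite_subset by auto
    then show "\<exists>p q0. (\<forall>q\<ge>q0. real (card (mod_avoiding q B (H - B))) = poly p (real q)) \<and>
      real (card (sign_patterns B (H - B))) = (-1) ^ k * poly p (-1)"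
      using sign_patterns_reciprocity[of "H - B" B] B(2) by blast
  qed
  then obtain p q0 where p: "\<And>B q. B \<in> Bs \<Longrightarrow> q \<ge> q0 B \<Longrightarrow> real (card (mod_avoiding q B (H - B))) = poly (p B) (real q)"
    "\<And>B. B \<in> Bs \<Longrightarrow> real (card (sign_patterns B (H - B))) = (-1) ^ k * poly (p B) (-1)"
    by metis
  \<comment> \<open>For large \<open>q\<close>, \<open>P\<close> counts the configurations whose
    satisfied hyperplanes have a flat of dimension \<open>k\<close>, and \<open>Q\<close> those with
    \<open>k\<close> leaders. By \<open>aff_dim_cluster_flat\<close> these are the same
    configurations.\<close>
  define P where "P = (\<Sum>B\<in>Bs. p B)"
  define Q :: "real poly" where "Q = (\<Sum>S | S \<subseteq> (UNIV :: 'n set) \<and> card S = n - k. \<Sum>L\<in>Pow S.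
    smult ((-1) ^ card L) ([:0, 1:] * [:- real (m * (k + card L)), 1:] ^ (n - 1)))"
  have Q: "poly Q (of_int z) = of_int (\<Sum>S | S \<subseteq> (UNIV :: 'n set) \<and> card S = n - k. \<Sum>L\<in>Pow S.
    (-1) ^ card L * (z * (z - int m * int (k + card L)) ^ (n - 1)))" for z
    unfolding Q_def by (simp add: poly_sum mult.left_commute)
  have "P = Q"
  proof (rule poly_eqI_eventually)
    fix q assume q: "q \<ge> Max (insert 0 (q0 ` Bs)) + m * n + 1"
    then have mq: "m * n < q" by simp
    have q0: "q \<ge> q0 B" if "B \<in> Bs" for B
    proof -
      have "q0 B \<le> Max (insert 0 (q0 ` Bs))" using that finBs by (intro Max_ge) auto
      then show ?thesis using q by simp
    qed
    have avoid: "mod_avoiding q B (H - B) = {y\<in>cyclic_configs q UNIV. {h\<in>H. holds_mod q h y} = B}" if "B \<in> Bs" for B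
      using that unfolding mod_avoiding_def mod_sols_def cyclic_configs_def Bs_def by auto
    have "poly P (real q) = (\<Sum>B\<in>Bs. real (card (mod_avoiding q B (H - B))))"
      unfolding P_def poly_sum using p(1) q0 by simp
    also have "\<dots> = real (\<Sum>B\<in>Bs. card {y\<in>cyclic_configs q UNIV. {h\<in>H. holds_mod q h y} = B})"
      using avoid by simp
    also have "(\<Sum>B\<in>Bs. card {y\<in>cyclic_configs q UNIV. {h\<in>H. holds_mod q h y} = B}) =
        card (\<Union>B\<in>Bs. {y\<in>cyclic_configs q UNIV. {h\<in>H. holds_mod q h y} = B})"
      using finBs finite_cyclic_configs[of "UNIV :: 'n set" q] by (intro card_UN_disjoint[symmetric]) auto
    also have "(\<Union>B\<in>Bs. {y\<in>cyclic_configs q UNIV. {h\<in>H. holds_mod q h y} = B}) =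
        {y\<in>cyclic_configs q (UNIV :: 'n set). card (leaders m q UNIV y) = k}"
    proof -
      have "aff_dim (real_sols {h\<in>H. holds_mod q h y}) = int (card (leaders m q UNIV y))" for y
        unfolding H_def using mq assms(1) by (intro aff_dim_cluster_flat) simp
      then show ?thesis unfolding Bs_def by auto
    qed
    also have "real (card \<dots>) = poly Q (real q)"
    proof -
      have "int (card {y\<in>cyclic_configs q (UNIV :: 'n set). card (leaders m q UNIV y) = k}) =
          (\<Sum>S | S \<subseteq> (UNIV :: 'n set) \<and> card S = n - k. \<Sum>L\<in>Pow S.
             (-1) ^ card L * (int q * (int q - int m * int (k + card L)) ^ (n - 1)))"
        using assms(2) mq unfolding assms(1) by (rule card_configs_with_leaders)
      from Q[of "int q", folded this] show ?thesis by simp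
    qed
    finally show "poly P (real q) = poly Q (real q)" .
  qed
  have "real (card {F \<in> shi_faces m :: (real, 'n) vec set set. aff_dim F = int k}) =
      (\<Sum>B\<in>Bs. real (card (sign_patterns B (H - B))))"
    using card_shi_faces_sign_patterns(2)[where 'n = 'n, of m k] unfolding Bs_def H_def by simp
  also have "\<dots> = (-1) ^ k * poly P (-1)"
    using p(2) unfolding P_def poly_sum by (simp add: sum_distrib_left)
  \<comment> \<open>One sign comes from reciprocity in dimension \<open>k\<close>, the other from
    evaluating \<open>Q\<close> at -1; they cancel.\<close>
  also have "\<dots> = (-1) ^ k * of_int ((-1) ^ k * face_number m n k)"
    using Q[of "-1", unfolded face_polynomial_at_minus_one[OF finite assms(1)[symmetric] assms(2) n1]]
    unfolding \<open>P = Q\<close> by simp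
  also have "\<dots> = ((-1) ^ k * (-1) ^ k) * of_int (face_number m n k)" by simp
  also have "\<dots> = of_int (face_number m n k)" unfolding power_mult_distrib[symmetric] by simp
  finally show ?thesis by (metis of_int_eq_iff of_int_of_nat_eq)
qed


theorem theorem5p2:
  fixes m n k :: nat
  assumes "n = CARD('n::{finite,linorder})" and "n \<ge> 1" and "m \<ge> 1" and "k \<in> {1..n}"
  shows "(T_set m n k \<approx> U_set m n k \<and> T_set m n k \<approx> V_set m n k \<and> T_set m n k \<approx> W_set m n k \<and>
          U_set m n k \<approx> V_set m n k \<and> U_set m n k \<approx> W_set m n k \<and> V_set m n k \<approx> W_set m n k) \<and>
         finite {F \<in> shi_faces m :: (real ^ 'n::{finite,linorder}) set set. aff_dim F = int k} \<and>
         card {F \<in> shi_faces m :: (real ^ 'n::{finite,linorder}) set set. aff_dim F = int k} = card (T_set m n k) \<and>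
         card (T_set m n k) = card (U_set m n k) \<and>
         card (U_set m n k) = card (V_set m n k) \<and>
         card (V_set m n k) = card (W_set m n k)"
proof -
  have k: "k \<le> n" using assms(4) by simp
  have TU: "T_set m n k \<approx> U_set m n k" using T_set_eqpoll_U_set[OF assms(3) k] .
  have fin: "finite (U_set m n k)" "finite (V_set m n k)" "finite (W_set m n k)"
    using card_U_set(1)[OF k] card_V_set(1)[OF k assms(3)] card_W_set(1)[OF k assms(2)] .
  have finT: "finite (T_set m n k)" using TU fin(1) by (simp add: eqpoll_finite_iff)
  have cT: "card (T_set m n k) = card (U_set m n k)" using TU finT fin(1) by (simp add: eqpoll_iff_card)
  have card: "int (card (U_set m n k)) = face_number m n k" "int (card (V_set m n k)) = face_number m n k"
    "int (card (W_set m n k)) = face_number m n k"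
    using card_U_set(2)[OF k] card_V_set(2)[OF k assms(3)] card_W_set(2)[OF k assms(2)] .
  then have eq: "card (U_set m n k) = card (V_set m n k)" "card (V_set m n k) = card (W_set m n k)" by linarith+
  have faces: "card {F \<in> shi_faces m :: (real ^ 'n::{finite,linorder}) set set. aff_dim F = int k} = card (T_set m n k)"
    using card_shi_faces[OF assms(1) k, of m] card(1) cT by linarith
  show ?thesis
    using card_shi_faces_sign_patterns(1)[where 'n = 'n, of m k] faces cT eq fin finT
    by (simp add: eqpoll_iff_card)
qed

end
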